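(* Let $(\phi,\rho)$ be a Fuchsian, convex equivariant (space-like polyhedral) embedding of a closed surface $S$ of genus at least $2$ in $\mathbb{R}^3_1$. Let $(\dot\phi,\dot\rho)$ be a first-order deformation of $(\phi,\rho)$ among Fuchsian equivariant embeddings. If the first-order variation of the metric induced on $S$ by $(\phi,\rho)$ vanishes, then $(\dot\phi,\dot\rho)$ is trivial, i.e. $\dot\phi$ is the restriction to $\phi(\tilde S)$ of a Killing field of $\mathbb{R}^3_1$ which vanishes at $0$, and $\dot\rho=0$.
   Context: $\mathbb{R}^3_1$ is the Minkowski space, i.e. $\mathbb{R}^3$ with the bilinear form $\langle(x,y,z),(x',y',z')\rangle=xx'+yy'-zz'$; $SO_0(2,1)$ is the identity component of the group $SO(2,1)$ of isometries of $\mathbb{R}^3_1$ fixing the origin. $\tilde S$ is the universal cover of $S$. An equivariant space-like polyhedral embedding of $S$ in $\mathbb{R}^3_1$ is a couple $(\phi,\rho)$ where: (1) $\phi:\tilde S\to\mathbb{R}^3_1$ is a space-like polyhedral embedding, i.e. $\phi$ is continuous; there exists a cellular decomposition of $S$ as the union of a finite number of cells, each the image by a diffeomorphism of the interior of a convex polygon in $\mathbb{R}^2$, such that the image by $\phi$ of each cell of the corresponding cellular decomposition of $\tilde S$ is the interior of a convex polygon in some space-like plane of $\mathbb{R}^3_1$; and, for each space-like plane $H$ in $\mathbb{R}^3_1$, the orthogonal projection of $\phi(\tilde S)$ on $H$ is one-to-one; (2) $\rho$ is a morphism from $\pi_1(S)$ to the isometry group of $\mathbb{R}^3_1$; (3)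 $\phi(\gamma x)=\rho(\gamma)\phi(x)$ for all $x\in\tilde S$ and $\gamma\in\pi_1(S)$. It is Fuchsian if $\rho(\pi_1(S))\subset SO_0(2,1)$. It is convex if $\phi(\tilde S)$ is a convex polyhedral surface, in the usual sense. The metric induced on $\tilde S$ by $\phi$ is invariant under $\pi_1(S)$, so that $(\phi,\rho)$ induces a metric on $S$. A first-order deformation of $(\phi,\rho)$ among Fuchsian equivariant embeddings is a couple $(\dot\phi,\dot\rho)$, corresponding to a deformation of $\phi$ among such embeddings, where: $\dot\phi$ is a vector field defined over $\phi(\tilde S)$; $\dot\rho:\pi_1(S)\to T\,SO(2,1)$ is a map such that $\dot\rho(\gamma)\in T_{\rho(\gamma)}SO_0(2,1)$ for all $\gamma\in\pi_1(S)$ and, considering $\rho(\gamma),\rho(\gamma')$ as acting on $SO(2,1)$ and $\dot\rho$ as sending elements of $\pi_1(S)$ to vector fields on $SO(2,1)$, $\dot\rho(\gamma\gamma')=\dot\rho(\gamma)(\rho(\gamma'))+\rho(\gamma)_*\dot\rho(\gamma')$ for all $\gamma,\gamma'\in\pi_1(S)$; and, identifying the elements of the Lie algebra $so(2,1)$ with the Killing fields of $\mathbb{R}^3_1$ which vanish at $0$, $\dot\phi(\gamma x)=\rho(\gamma)_*\dot\phi(x)+\dot\rho(\gamma)\phi(x)$ for all $x\in\tilde S$ and $\gamma\in\pi_1(S)$.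
   Formalization: The deformation is polyhedral for one fixed cellulation with no vertex inside a flat region of φ (else pushing such a vertex is a counterexample), and "ρ̇=0" is replaced by ρ̇(γ)=Yρ(γ)−ρ(γ)Y for the Killing field Y, since literal ρ̇=0 fails for infinitesimal conjugation. *)

theory Defs
  imports "HOL-Analysis.Analysis" "HOL-Homology.Homology"
begin

section \<open>Minkowski space\<close>

definition mink :: "real^3 \<Rightarrow> real^3 \<Rightarrow> real" where
  "mink u v = u$1 * v$1 + u$2 * v$2 - u$3 * v$3"

definition spacelike_plane :: "(real^3) set \<Rightarrow> bool" where
  "spacelike_plane H \<longleftrightarrow> affine H \<and> aff_dim H = 2 \<and>
     (\<forall>u\<in>H. \<forall>v\<in>H. u \<noteq> v \<longrightarrow> mink (u - v) (u - v) > 0)"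

definition orth_proj :: "(real^3) set \<Rightarrow> real^3 \<Rightarrow> real^3" where
  "orth_proj H x = (THE q. q \<in> H \<and> (\<forall>u\<in>H. mink (x - q) (u - q) = 0))"

definition isom_group :: "(real^3 \<Rightarrow> real^3) monoid" where
  "isom_group = \<lparr>carrier = {f. bij f \<and>
       (\<forall>x y. mink (f x - f y) (f x - f y) = mink (x - y) (x - y))},
     monoid.mult = (\<circ>), one = id\<rparr>"

definition SO21 :: "(real^3^3) set" where
  "SO21 = {B. (\<forall>u v. mink (B *v u) (B *v v) = mink u v) \<and> det B = 1}"

definition SO21_0 :: "(real^3^3) set" where
  "SO21_0 = connected_component_set SO21 (mat 1)"

definition tangent_space :: "'v::real_normed_vector set \<Rightarrow> 'v \<Rightarrow> 'v set" where
  "tangent_space G b = {w. \<exists>c. c 0 = b \<and> (\<forall>t. c t \<in> G) \<and>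
     (c has_vector_derivative w) (at (0::real))}"

text \<open>The last conjunct says that the Lie derivative of the (constant) Minkowski metric along
  the vector field vanishes.\<close>

definition killing_field :: "(real^3 \<Rightarrow> real^3) \<Rightarrow> bool" where
  "killing_field Y \<longleftrightarrow> (\<forall>x. Y differentiable (at x) \<and>
     (\<forall>u v. mink (frechet_derivative Y (at x) u) v + mink u (frechet_derivative Y (at x) v) = 0))"


section \<open>Closed surfaces and cellular decompositions\<close>

primrec Ck_on :: "nat \<Rightarrow> (real^2) set \<Rightarrow> (real^2 \<Rightarrow> real^2) \<Rightarrow> bool" where
  "Ck_on 0 W f \<longleftrightarrow> continuous_on W f"
| "Ck_on (Suc k) W f \<longleftrightarrow> (\<forall>x\<in>W. f differentiable (at x)) \<and>
     (\<forall>v. Ck_on k W (\<lambda>x. frechet_derivative f (at x) v))"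

text \<open>Used for open sets only.\<close>

definition smooth_on :: "(real^2) set \<Rightarrow> (real^2 \<Rightarrow> real^2) \<Rightarrow> bool" where
  "smooth_on W f \<longleftrightarrow> (\<forall>k. Ck_on k W f)"

type_synonym 'b atlas = "('b set \<times> ('b \<Rightarrow> real^2)) set"

definition smooth_atlas :: "'b::topological_space atlas \<Rightarrow> bool" where
  "smooth_atlas A \<longleftrightarrow>
     (\<forall>(U, \<psi>)\<in>A. open U \<and> open (\<psi> ` U) \<and> homeomorphism U (\<psi> ` U) \<psi> (inv_into U \<psi>)) \<and>
     \<Union>(fst ` A) = UNIV \<and>
     (\<forall>(U, \<psi>)\<in>A. \<forall>(V, \<theta>)\<in>A. smooth_on (\<psi> ` (U \<inter> V)) (\<theta> \<circ> inv_into U \<psi>))"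

definition diffeomorphism_onto ::
    "'b::topological_space atlas \<Rightarrow> (real^2) set \<Rightarrow> 'b set \<Rightarrow> (real^2 \<Rightarrow> 'b) \<Rightarrow> bool" where
  "diffeomorphism_onto A W C e \<longleftrightarrow> open W \<and> open C \<and>
     (\<exists>e'. homeomorphism W C e e' \<and>
       (\<forall>(U, \<psi>)\<in>A. smooth_on (W \<inter> e -` U) (\<psi> \<circ> e) \<and>
                   smooth_on (\<psi> ` (U \<inter> C)) (e' \<circ> inv_into U \<psi>)))"

text \<open>The surface is the whole type \<open>'b\<close>, with the smooth structure given by the atlas. A closed
  connected surface has \<open>H\<^sub>1 \<cong> \<int>\<^sup>2\<^sup>g\<close> for some \<open>g\<close> iff it is orientable, and \<open>g\<close> is then its genus (for a
  non-orientable surface the first homology group has 2-torsion).\<close>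

definition closed_surface_of_genus :: "'b::t2_space atlas \<Rightarrow> nat \<Rightarrow> bool" where
  "closed_surface_of_genus A g \<longleftrightarrow>
     smooth_atlas A \<and> compact (UNIV :: 'b set) \<and> connected (UNIV :: 'b set) \<and>
     homology_group 1 (euclidean :: 'b topology) \<cong> free_Abelian_group {..<2 * g}"

definition universal_cover :: "('a::t2_space \<Rightarrow> 'b::t2_space) \<Rightarrow> bool" where
  "universal_cover p \<longleftrightarrow> covering_space UNIV p UNIV \<and> simply_connected (UNIV :: 'a set)"

text \<open>The fundamental group of the base, realised as the group of deck transformations of the
  universal cover.\<close>

definition pi1 :: "('a::t2_space \<Rightarrow> 'b::t2_space) \<Rightarrow> ('a \<Rightarrow> 'a) monoid" where
  "pi1 p = \<lparr>carrier = {\<gamma>. (\<exists>\<gamma>'. homeomorphism UNIV UNIV \<gamma> \<gamma>') \<and> p \<circ> \<gamma> = p},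
     monoid.mult = (\<circ>), one = id\<rparr>"

text \<open>\<open>D k\<close> is the set of (open) \<open>k\<close>-cells. Every cell has a characteristic map defined on a closed
  convex polygon (segment, point) and sending its relative boundary to cells of lower dimension;
  the 2-cells are moreover diffeomorphic images of interiors of convex polygons.\<close>

definition cell_decomposition :: "'b::t2_space atlas \<Rightarrow> (nat \<Rightarrow> 'b set set) \<Rightarrow> bool" where
  "cell_decomposition A D \<longleftrightarrow>
     (\<forall>k. finite (D k)) \<and> (\<forall>k>2. D k = {}) \<and>
     disjoint (\<Union>k. D k) \<and> \<Union>(\<Union>k. D k) = UNIV \<and>
     (\<forall>k. \<forall>C\<in>D k. \<exists>(P :: (real^2) set) h h'. polytope P \<and> aff_dim P = int k \<and>
        continuous_on P h \<and> homeomorphism (rel_interior P) C h h' \<and>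
        h ` rel_frontier P \<subseteq> \<Union>(\<Union>j<k. D j)) \<and>
     (\<forall>C\<in>D 2. \<exists>P e. polytope P \<and> aff_dim P = 2 \<and> diffeomorphism_onto A (interior P) C e)"


section \<open>Equivariant polyhedral embeddings\<close>

text \<open>The cells of the corresponding decomposition of the universal cover are the connected
  components of the preimages of the cells.\<close>

definition polyhedral_wrt ::
    "('a::t2_space \<Rightarrow> 'b::t2_space) \<Rightarrow> (nat \<Rightarrow> 'b set set) \<Rightarrow> ('a \<Rightarrow> real^3) \<Rightarrow> bool" where
  "polyhedral_wrt p D \<phi> \<longleftrightarrow>
     (\<forall>C\<in>D 2. \<forall>C'\<in>components (p -` C). \<exists>H Q. spacelike_plane H \<and> polytope Q \<and> aff_dim Q = 2 \<and>
        Q \<subseteq> H \<and> \<phi> ` C' = rel_interior Q)"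

definition spacelike_polyhedral_embedding ::
    "('a::t2_space \<Rightarrow> 'b::t2_space) \<Rightarrow> 'b atlas \<Rightarrow> ('a \<Rightarrow> real^3) \<Rightarrow> bool" where
  "spacelike_polyhedral_embedding p A \<phi> \<longleftrightarrow>
     continuous_on UNIV \<phi> \<and> inj \<phi> \<and>
     (\<exists>D. cell_decomposition A D \<and> polyhedral_wrt p D \<phi>) \<and>
     (\<forall>H. spacelike_plane H \<longrightarrow> inj_on (orth_proj H) (range \<phi>))"

definition equivariant_embedding ::
    "('a::t2_space \<Rightarrow> 'b::t2_space) \<Rightarrow> 'b atlas \<Rightarrow> ('a \<Rightarrow> real^3) \<Rightarrow>
     (('a \<Rightarrow> 'a) \<Rightarrow> real^3 \<Rightarrow> real^3) \<Rightarrow> bool" where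
  "equivariant_embedding p A \<phi> \<rho> \<longleftrightarrow>
     spacelike_polyhedral_embedding p A \<phi> \<and> \<rho> \<in> hom (pi1 p) isom_group \<and>
     (\<forall>\<gamma>\<in>carrier (pi1 p). \<forall>x. \<phi> (\<gamma> x) = \<rho> \<gamma> (\<phi> x))"

definition fuchsian ::
    "('a::t2_space \<Rightarrow> 'b::t2_space) \<Rightarrow> (('a \<Rightarrow> 'a) \<Rightarrow> real^3 \<Rightarrow> real^3) \<Rightarrow> bool" where
  "fuchsian p \<rho> \<longleftrightarrow> \<rho> ` carrier (pi1 p) \<subseteq> (*v) ` SO21_0"

text \<open>A convex surface is a piece of the boundary of a convex body (possibly unbounded).\<close>

definition convex_surface :: "(real^3) set \<Rightarrow> bool" where
  "convex_surface \<Sigma> \<longleftrightarrow>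
     (\<exists>K. closed K \<and> convex K \<and> interior K \<noteq> {} \<and> \<Sigma> \<subseteq> frontier K)"


section \<open>The induced metric\<close>

text \<open>The path metric induced on the universal cover: infimum of the Minkowski lengths of the
  polygonal paths drawn on the surface \<open>range \<phi>\<close>; then the quotient metric on the surface.\<close>

definition induced_dist_cover :: "('a \<Rightarrow> real^3) \<Rightarrow> 'a \<Rightarrow> 'a \<Rightarrow> real" where
  "induced_dist_cover \<phi> x y = Inf {\<Sum>i<n. sqrt (mink (\<phi> (z (Suc i)) - \<phi> (z i)) (\<phi> (z (Suc i)) - \<phi> (z i))) | n z.
     z 0 = x \<and> z n = y \<and> (\<forall>i<n. closed_segment (\<phi> (z i)) (\<phi> (z (Suc i))) \<subseteq> range \<phi>)}"

definition induced_dist :: "('a \<Rightarrow> 'b) \<Rightarrow> ('a \<Rightarrow> real^3) \<Rightarrow> 'b \<Rightarrow> 'b \<Rightarrow> real" where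
  "induced_dist p \<phi> a b = Inf {induced_dist_cover \<phi> x y | x y. p x = a \<and> p y = b}"

definition metric_variation_vanishes ::
    "('a \<Rightarrow> 'b) \<Rightarrow> (real \<Rightarrow> 'a \<Rightarrow> real^3) \<Rightarrow> bool" where
  "metric_variation_vanishes p \<Phi> \<longleftrightarrow>
     (\<forall>a b. ((\<lambda>t. induced_dist p (\<Phi> t) a b) has_real_derivative 0) (at 0))"


section \<open>First-order deformations\<close>

text \<open>A deformation \<open>(\<Phi> t, R t)\<close>, \<open>\<bar>t\<bar> < \<epsilon>\<close>, of \<open>(\<phi>, \<rho>)\<close> among Fuchsian equivariant embeddings is
  polyhedral for one cellular decomposition, whose vertices are vertices of the polyhedral surface
  \<open>\<phi>\<close>, that is, are not sent to interior points of planar regions of \<open>\<phi>\<close>. (Faces may be subdivided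
  and bent along diagonals. If artificial vertices inside a planar region were allowed, pushing
  one of them orthogonally to that region would leave the metric unchanged to first order.)\<close>

definition flat_at :: "('a::topological_space \<Rightarrow> real^3) \<Rightarrow> 'a \<Rightarrow> bool" where
  "flat_at \<phi> x \<longleftrightarrow> (\<exists>W H. open W \<and> x \<in> W \<and> affine H \<and> aff_dim H = 2 \<and> \<phi> ` W \<subseteq> H)"

definition fuchsian_deformation ::
    "('a::t2_space \<Rightarrow> 'b::t2_space) \<Rightarrow> 'b atlas \<Rightarrow> ('a \<Rightarrow> real^3) \<Rightarrow>
     (('a \<Rightarrow> 'a) \<Rightarrow> real^3 \<Rightarrow> real^3) \<Rightarrow> (real \<Rightarrow> 'a \<Rightarrow> real^3) \<Rightarrow>
     (real \<Rightarrow> ('a \<Rightarrow> 'a) \<Rightarrow> real^3 \<Rightarrow> real^3) \<Rightarrow> bool" where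
  "fuchsian_deformation p A \<phi> \<rho> \<Phi> R \<longleftrightarrow>
     \<Phi> 0 = \<phi> \<and> R 0 = \<rho> \<and>
     (\<exists>\<epsilon>>0. \<exists>D. cell_decomposition A D \<and>
        (\<forall>x. {p x} \<in> D 0 \<longrightarrow> \<not> flat_at \<phi> x) \<and>
        (\<forall>t. \<bar>t\<bar> < \<epsilon> \<longrightarrow> polyhedral_wrt p D (\<Phi> t) \<and>
           equivariant_embedding p A (\<Phi> t) (R t) \<and> fuchsian p (R t)))"

text \<open>\<open>d\<phi> x\<close> is the value of the vector field at the point \<open>\<phi> x\<close>; tangent vectors to \<open>SO(2,1)\<close> are
  matrices, so that \<open>\<rho>(\<gamma>)\<^sub>*\<close> is left multiplication by the matrix of \<open>\<rho> \<gamma>\<close>.\<close>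

definition first_order_deformation ::
    "('a::t2_space \<Rightarrow> 'b::t2_space) \<Rightarrow> 'b atlas \<Rightarrow> ('a \<Rightarrow> real^3) \<Rightarrow>
     (('a \<Rightarrow> 'a) \<Rightarrow> real^3 \<Rightarrow> real^3) \<Rightarrow> (real \<Rightarrow> 'a \<Rightarrow> real^3) \<Rightarrow>
     (real \<Rightarrow> ('a \<Rightarrow> 'a) \<Rightarrow> real^3 \<Rightarrow> real^3) \<Rightarrow>
     ('a \<Rightarrow> real^3) \<Rightarrow> (('a \<Rightarrow> 'a) \<Rightarrow> real^3^3) \<Rightarrow> bool" where
  "first_order_deformation p A \<phi> \<rho> \<Phi> R d\<phi> d\<rho> \<longleftrightarrow>
     fuchsian_deformation p A \<phi> \<rho> \<Phi> R \<and>
     (\<forall>x. ((\<lambda>t. \<Phi> t x) has_vector_derivative d\<phi> x) (at 0)) \<and>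
     (\<forall>\<gamma>\<in>carrier (pi1 p). ((\<lambda>t. matrix (R t \<gamma>)) has_vector_derivative d\<rho> \<gamma>) (at 0)) \<and>
     (\<forall>\<gamma>\<in>carrier (pi1 p). d\<rho> \<gamma> \<in> tangent_space SO21_0 (matrix (\<rho> \<gamma>))) \<and>
     (\<forall>\<gamma>\<in>carrier (pi1 p). \<forall>\<gamma>'\<in>carrier (pi1 p).
        d\<rho> (\<gamma> \<circ> \<gamma>') = d\<rho> \<gamma> ** matrix (\<rho> \<gamma>') + matrix (\<rho> \<gamma>) ** d\<rho> \<gamma>') \<and>
     (\<forall>\<gamma>\<in>carrier (pi1 p). \<forall>x. d\<phi> (\<gamma> x) = matrix (\<rho> \<gamma>) *v d\<phi> x + d\<rho> \<gamma> *v \<phi> x)"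

text \<open>The infinitesimal isometry \<open>Y\<close>, applied to the whole equivariant embedding, moves \<open>\<phi>\<close> with
  velocity \<open>Y \<circ> \<phi>\<close> and \<open>\<rho>\<close> by infinitesimal conjugation, with velocity
  \<open>Y \<circ> \<rho> \<gamma> - \<rho> \<gamma> \<circ> Y\<close>. The vanishing of the variation of \<open>\<rho>\<close> is understood after this motion
  has been subtracted; it cannot be understood literally unless \<open>Y = 0\<close>, by equivariance.\<close>

definition trivial_deformation ::
    "('a::t2_space \<Rightarrow> 'b::t2_space) \<Rightarrow> ('a \<Rightarrow> real^3) \<Rightarrow> (('a \<Rightarrow> 'a) \<Rightarrow> real^3 \<Rightarrow> real^3) \<Rightarrow>
     ('a \<Rightarrow> real^3) \<Rightarrow> (('a \<Rightarrow> 'a) \<Rightarrow> real^3^3) \<Rightarrow> bool" where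
  "trivial_deformation p \<phi> \<rho> d\<phi> d\<rho> \<longleftrightarrow>
     (\<exists>Y. killing_field Y \<and> Y 0 = 0 \<and> (\<forall>x. d\<phi> x = Y (\<phi> x)) \<and>
        (\<forall>\<gamma>\<in>carrier (pi1 p). \<forall>v. d\<rho> \<gamma> *v v - (Y (\<rho> \<gamma> v) - \<rho> \<gamma> (Y v)) = 0))"

end

theory Submission
  imports Defs
begin

text \<open>The function \<open>u = \<langle>d\<phi>, \<phi>\<rangle>\<close> is invariant under the holonomy, since the latter fixes the origin. Vanishing of
  the metric variation makes \<open>d\<phi>\<close> the restriction of a Killing field on each face, so that \<open>u\<close> is affine on
  faces and attains its maximum. The surface lies in the cone of timelike vectors and turns its convex side to
  the origin: this is seen at the point where \<open>\<langle>\<phi>, \<phi>\<rangle>\<close> is maximal, and propagates by connectedness. If \<open>u\<close> had a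
  positive maximum at \<open>x\<close>, subtracting a translation normal to a support plane at \<open>x\<close> (and a rotation) would
  give an infinitesimal isometric deformation of the tangent cone at \<open>x\<close> which fixes the apex and moves no point
  upwards; as the total angle around the vertical axis is fixed, this is impossible unless the cone is flat along
  every crease that moves. Choosing \<open>x\<close> to maximise \<open>\<langle>\<phi>, \<phi>\<rangle>\<close> among the maxima of \<open>u\<close> leaves only flat points,
  which are not vertices. Hence \<open>u \<le> 0\<close>, and \<open>u = 0\<close> by symmetry. Then the Killing field of each face vanishes
  at the origin, and those of adjacent faces agree because they agree on an edge whose line misses the origin.\<close>

section \<open>Minkowski geometry\<close>

text \<open>The hypothesis concerns an infimum of path lengths in the quotient, whose derivative is
  not directly accessible. Away from time 0 only one inequality is used: the distance is at most the
  length of a chord inside a cell. At time 0 equality holds for nearby points, so chord length minus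
  distance is minimal there and its derivative vanishes. The equality uses convexity a second time:
  a segment drawn on the surface with an inner point in a cell lies in the plane of that cell.
  Preserved lengths inside a face say nothing about the component of \<open>d\<phi>\<close> normal
  to it. That \<open>d\<phi>\<close> is affine on a face comes from differentiating the coplanarity
  of the cells of \<open>\<Phi> t\<close>, which is why all cells are those of the one decomposition
  that is fixed along the deformation. Flatness at the maximum is contradictory only at a vertex.
  Strict convexity of \<open>\<langle>\<phi>, \<phi>\<rangle>\<close> along chords shows that the
  maximum is a corner of all its cells, but 1-cells are mere topological arcs, not assumed to be
  straight. That a corner is not inside a 1-cell needs an argument on triods.\<close>

lemma mink_add_left: "mink (u + v) w = mink u w + mink v w"
  and mink_add_right: "mink w (u + v) = mink w u + mink w v"
  and mink_diff_left: "mink (u - v) w = mink u w - mink v w"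
  and mink_diff_right: "mink w (u - v) = mink w u - mink w v"
  and mink_scaleR_left: "mink (c *\<^sub>R u) w = c * mink u w"
  and mink_scaleR_right: "mink w (c *\<^sub>R u) = c * mink w u"
  and mink_minus_left: "mink (- u) w = - mink u w"
  and mink_minus_right: "mink w (- u) = - mink w u"
  and mink_zero_left: "mink 0 w = 0"
  and mink_zero_right: "mink w 0 = 0"
  by (auto simp: mink_def algebra_simps)

lemmas mink_simps = mink_add_left mink_add_right mink_diff_left mink_diff_right
  mink_scaleR_left mink_scaleR_right mink_minus_left mink_minus_right mink_zero_left mink_zero_right

lemma mink_commute: "mink u v = mink v u"
  by (simp add: mink_def algebra_simps)

text \<open>The matrix of the form: it turns \<open>mink\<close> into the Euclidean inner product,
  and Euclidean normals of support planes into Minkowski vectors.\<close>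

definition refl3 :: "real^3 \<Rightarrow> real^3" where
  "refl3 s = vector [s$1, s$2, - s$3]"

lemma refl3_nth: "refl3 s $ 1 = s$1" "refl3 s $ 2 = s$2" "refl3 s $ 3 = - s$3"
  by (simp_all add: refl3_def)

lemma mink_inner: "mink u v = refl3 u \<bullet> v"
  by (simp add: mink_def inner_vec_def sum_3 refl3_nth)

lemma norm_refl3: "norm (refl3 u) = norm u"
  by (simp add: norm_vec_def L2_set_def sum_3 refl3_nth)

lemma bounded_bilinear_mink: "bounded_bilinear mink"
proof
  have "norm (mink a b) \<le> norm a * norm b * 1" for a b
    using Cauchy_Schwarz_ineq2[of "refl3 a" b] by (simp add: mink_inner norm_refl3)
  then show "\<exists>K. \<forall>a b. norm (mink a b) \<le> norm a * norm b * K"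
    by blast
qed (auto simp: mink_simps)

interpretation mink: bounded_bilinear mink
  by (rule bounded_bilinear_mink)

lemma mink_nondegenerate: "(\<And>v. mink u v = 0) \<Longrightarrow> u = 0"
  using mink_inner[of u "refl3 u"] by (metis inner_eq_zero_iff norm_eq_zero norm_refl3)

lemma mink_vanishes_independent:
  assumes "independent B" "card B = 3" "\<And>b. b \<in> B \<Longrightarrow> mink u b = 0"
  shows "u = 0"
proof (rule mink_nondegenerate)
  fix v
  have "span B = UNIV"
    using assms card_ge_dim_independent[of B UNIV]
    by (simp add: dim_UNIV independent_imp_finite) (metis UNIV_I span_subspace subset_UNIV subspace_UNIV top.extremum_uniqueI)
  then have "v \<in> span B" by simp
  then show "mink u v = 0"
    by (induction rule: span_induct_alt) (auto simp: mink_simps assms(3))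
qed

definition frame :: "real^3 \<Rightarrow> real^3 \<Rightarrow> real^3 \<Rightarrow> bool" where
  "frame e1 e2 e3 \<longleftrightarrow> mink e1 e1 = 1 \<and> mink e2 e2 = 1 \<and> mink e3 e3 = -1 \<and>
     mink e1 e2 = 0 \<and> mink e1 e3 = 0 \<and> mink e2 e3 = 0"

lemma frame_simps:
  assumes "frame e1 e2 e3"
  shows "mink e1 e1 = 1" "mink e2 e2 = 1" "mink e3 e3 = -1"
    "mink e1 e2 = 0" "mink e2 e1 = 0" "mink e1 e3 = 0" "mink e3 e1 = 0" "mink e2 e3 = 0" "mink e3 e2 = 0"
  using assms by (auto simp: frame_def mink_commute)

lemma frame_independent:
  assumes "frame e1 e2 e3"
  shows "independent {e1, e2, e3}" "card {e1, e2, e3} = 3"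
proof -
  note f = frame_simps[OF assms]
  have ne: "e1 \<noteq> e2" "e1 \<noteq> e3" "e2 \<noteq> e3"
    using f by auto
  show "card {e1, e2, e3} = 3"
    using ne by auto
  have z: "a = 0 \<and> b = 0 \<and> c = 0" if "a *\<^sub>R e1 + b *\<^sub>R e2 + c *\<^sub>R e3 = 0" for a b c
  proof -
    have "mink (a *\<^sub>R e1 + b *\<^sub>R e2 + c *\<^sub>R e3) e1 = 0" "mink (a *\<^sub>R e1 + b *\<^sub>R e2 + c *\<^sub>R e3) e2 = 0"
      "mink (a *\<^sub>R e1 + b *\<^sub>R e2 + c *\<^sub>R e3) e3 = 0"
      unfolding that by (simp_all add: mink_simps)
    then show ?thesis
      by (simp add: mink_simps f)
  qed
  show "independent {e1, e2, e3}"
    unfolding dependent_finite[OF finite.insertI[OF finite.insertI[OF finite.insertI[OF finite.emptyI]]]]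
  proof (intro notI, elim exE conjE)
    fix u assume "\<exists>v\<in>{e1,e2,e3}. u v \<noteq> 0" "(\<Sum>v\<in>{e1, e2, e3}. u v *\<^sub>R v) = 0"
    then show False
      using z[of "u e1" "u e2" "u e3"] ne by (auto simp: add.assoc)
  qed
qed

lemma frame_expand:
  assumes "frame e1 e2 e3"
  shows "v = mink v e1 *\<^sub>R e1 + mink v e2 *\<^sub>R e2 - mink v e3 *\<^sub>R e3"
proof -
  note f = frame_simps[OF assms]
  have "v - (mink v e1 *\<^sub>R e1 + mink v e2 *\<^sub>R e2 - mink v e3 *\<^sub>R e3) = 0"
    by (rule mink_vanishes_independent[OF frame_independent[OF assms]]) (auto simp: mink_simps f)
  then show ?thesis by simp
qed

lemma frame_mink:
  assumes "frame e1 e2 e3"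
  shows "mink v w = mink v e1 * mink w e1 + mink v e2 * mink w e2 - mink v e3 * mink w e3"
  by (subst (1) frame_expand[OF assms, of w]) (simp add: mink_simps)

lemma frame_exists:
  assumes "mink x x < 0"
  obtains e1 e2 where "frame e1 e2 (x /\<^sub>R sqrt (- mink x x))"
proof -
  define a b c where "a = x$1" and "b = x$2" and "c = x$3"
  have t: "a\<^sup>2 + b\<^sup>2 < c\<^sup>2"
    using assms by (simp add: mink_def a_def b_def c_def power2_eq_square)
  define m where "m = sqrt (c\<^sup>2 - a\<^sup>2)"
  define k where "k = sqrt (c\<^sup>2 - a\<^sup>2 - b\<^sup>2)"
  have m: "m > 0" "m\<^sup>2 = c\<^sup>2 - a\<^sup>2" and k: "k > 0" "k\<^sup>2 = c\<^sup>2 - a\<^sup>2 - b\<^sup>2"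
  proof -
    have "0 < c\<^sup>2 - a\<^sup>2" using t zero_le_power2[of b] by linarith
    then show "m > 0" "m\<^sup>2 = c\<^sup>2 - a\<^sup>2" by (simp_all add: m_def)
    have "0 < c\<^sup>2 - a\<^sup>2 - b\<^sup>2" using t by linarith
    then show "k > 0" "k\<^sup>2 = c\<^sup>2 - a\<^sup>2 - b\<^sup>2" by (simp_all add: k_def)
  qed
  have q: "mink x x = - k\<^sup>2" using k(2)
    by (simp add: mink_def a_def b_def c_def power2_eq_square)
  \<comment> \<open>\<open>e1\<close> is the unit vector orthogonal to \<open>x\<close> with second
    coordinate 0, and \<open>e2\<close> is the normalised vector orthogonal to both. The radicands
    of \<open>m\<close> and \<open>k\<close> are positive because \<open>x = (a, b, c)\<close> is
    timelike.\<close>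
  define e1 :: "real^3" where "e1 = (1/m) *\<^sub>R vector [c, 0, a]"
  define e2 :: "real^3" where "e2 = (1/(m*k)) *\<^sub>R vector [a*b, m\<^sup>2, c*b]"
  have v: "mink (vector [p,q,r]) (vector [p',q',r']) = p*p' + q*q' - r*r'" for p q r p' q' r' :: real
    by (simp add: mink_def)
  have x: "x = vector [a,b,c]"
    by (simp add: vec_eq_iff forall_3 a_def b_def c_def)
  have k2: "sqrt (- mink x x) = k" using k(1) q by simp
  have 1: "mink e1 e1 = 1"
    using m by (simp add: e1_def mink_simps v field_simps power2_eq_square)
  have mm: "m\<^sup>2 * m\<^sup>2 + (a*b)*(a*b) - (c*b)*(c*b) = m\<^sup>2 * k\<^sup>2"
  proof -
    have "(a*b)*(a*b) - (c*b)*(c*b) = - (b\<^sup>2 * (c\<^sup>2 - a\<^sup>2))"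
      by (simp add: algebra_simps power2_eq_square)
    also have "\<dots> = - (b\<^sup>2 * m\<^sup>2)" by (simp only: m(2))
    finally have *: "(a*b)*(a*b) - (c*b)*(c*b) = - (b\<^sup>2 * m\<^sup>2)" .
    have "k\<^sup>2 = m\<^sup>2 - b\<^sup>2" using m(2) k(2) by simp
    then have "m\<^sup>2 * k\<^sup>2 = m\<^sup>2 * m\<^sup>2 - b\<^sup>2 * m\<^sup>2"
      by (simp only: right_diff_distrib mult.commute)
    then show ?thesis using * by linarith
  qed
  have 2: "mink e2 e2 = 1"
  proof -
    have "mink e2 e2 = (1/(m*k))\<^sup>2 * (m\<^sup>2 * k\<^sup>2)"
      using mm by (simp add: e2_def mink_simps v power2_eq_square algebra_simps)
    also have "\<dots> = 1" using m(1) k(1) by (simp add: power_divide power_mult_distrib)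
    finally show ?thesis .
  qed
  have 3: "mink e1 e2 = 0" by (simp add: e1_def e2_def mink_simps v)
  have 4: "mink e1 x = 0" by (simp add: e1_def mink_simps v x)
  have 5: "mink e2 x = 0"
  proof -
    have "a*b*a + m\<^sup>2*b - c*b * c = 0" unfolding m(2) by (simp add: algebra_simps power2_eq_square)
    then show ?thesis by (simp add: e2_def mink_simps v x)
  qed
  have "frame e1 e2 (x /\<^sub>R sqrt (- mink x x))"
    unfolding frame_def k2 using 1 2 3 4 5 q k(1)
    by (auto simp: mink_simps field_simps power2_eq_square)
  then show ?thesis by (rule that)
qed

definition proj2 :: "real^3 \<Rightarrow> real^3 \<Rightarrow> real^3 \<Rightarrow> real^2" where
  "proj2 e1 e2 v = vector [mink v e1, mink v e2]"

lemma proj2_nth [simp]: "proj2 e1 e2 v $ 1 = mink v e1" "proj2 e1 e2 v $ 2 = mink v e2"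
  by (simp_all add: proj2_def)

lemma bounded_linear_proj2: "bounded_linear (proj2 e1 e2)"
proof -
  have "linear (proj2 e1 e2)"
    by (rule linearI) (simp_all add: vec_eq_iff forall_2 mink_simps)
  then show ?thesis by (simp add: linear_conv_bounded_linear)
qed

lemma norm_real2: "(norm (v::real^2))\<^sup>2 = (v$1)\<^sup>2 + (v$2)\<^sup>2"
  by (simp add: norm_vec_def L2_set_def sum_2)

lemma frame_mink_self:
  assumes "frame e1 e2 e3"
  shows "mink v v = (norm (proj2 e1 e2 v))\<^sup>2 - (mink v e3)\<^sup>2"
  unfolding norm_real2 using frame_mink[OF assms, of v v] by (simp add: power2_eq_square)

text \<open>The projection along a timelike direction \<open>e3\<close> has the spacelike plane orthogonal to \<open>e3\<close>
  as a target, so the injectivity assumption on \<open>orth_proj\<close> applies to it.\<close>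

lemma orth_proj_frame:
  assumes "frame e1 e2 e3"
  shows "spacelike_plane (span {e1, e2})"
    and "orth_proj (span {e1, e2}) v = mink v e1 *\<^sub>R e1 + mink v e2 *\<^sub>R e2"
proof -
  note f = frame_simps[OF assms]
  have ind: "independent {e1, e2}"
    by (rule independent_mono[OF frame_independent(1)[OF assms]]) auto
  have "e1 \<noteq> e2" using f by auto
  then have d: "dim {e1, e2} = 2" using dim_eq_card_independent[OF ind] by simp
  have sp: "w \<in> span {e1, e2} \<longleftrightarrow> (\<exists>a b. w = a *\<^sub>R e1 + b *\<^sub>R e2)" for w
    unfolding span_insert span_empty by (auto simp: algebra_simps)
  have pos: "mink w w > 0" if ws: "w \<in> span {e1, e2}" "w \<noteq> 0" for w
  proof -
    obtain a b where w: "w = a *\<^sub>R e1 + b *\<^sub>R e2" using ws(1) sp[of w] by blast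
    then have "mink w w = a*a + b*b" by (simp add: mink_simps f)
    moreover have "a \<noteq> 0 \<or> b \<noteq> 0" using ws(2) w by auto
    ultimately show ?thesis
      by (metis add_pos_nonneg add_nonneg_pos not_real_square_gt_zero zero_le_square)
  qed
  show "spacelike_plane (span {e1, e2})"
    unfolding spacelike_plane_def
  proof (intro conjI ballI impI)
    show "affine (span {e1, e2})" by (simp add: subspace_imp_affine)
    show "aff_dim (span {e1, e2}) = 2" using d by (simp add: aff_dim_subspace)
    fix u v assume "u \<in> span {e1, e2}" "v \<in> span {e1, e2}" "u \<noteq> v"
    then show "mink (u - v) (u - v) > 0" by (intro pos) (auto intro: span_diff)
  qed
  define q where "q = mink v e1 *\<^sub>R e1 + mink v e2 *\<^sub>R e2"
  have q: "q \<in> span {e1, e2}" using sp q_def by blast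
  have qo: "mink (v - q) u = 0" if "u \<in> span {e1, e2}" for u
    using that sp by (auto simp: q_def mink_simps f)
  show "orth_proj (span {e1, e2}) v = mink v e1 *\<^sub>R e1 + mink v e2 *\<^sub>R e2"
    unfolding orth_proj_def q_def[symmetric]
  proof (rule the_equality)
    show "q \<in> span {e1, e2} \<and> (\<forall>u\<in>span {e1, e2}. mink (v - q) (u - q) = 0)"
      using q qo by (auto intro: span_diff)
    fix q' assume q': "q' \<in> span {e1, e2} \<and> (\<forall>u\<in>span {e1, e2}. mink (v - q') (u - q') = 0)"
    have "mink (v - q') (q - q') = 0" "mink (v - q) (q - q') = 0"
      using q q' qo by (auto intro: span_diff)
    then have "mink (q - q') (q - q') = 0" by (simp add: mink_simps)
    then show "q' = q" using pos[of "q - q'"] q q' by (auto intro: span_diff)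
  qed
qed

lemma inj_proj2:
  assumes "\<And>H. spacelike_plane H \<Longrightarrow> inj_on (orth_proj H) S" and "frame e1 e2 e3"
  shows "inj_on (proj2 e1 e2) S"
proof (rule inj_onI)
  fix x y assume xy: "x \<in> S" "y \<in> S" "proj2 e1 e2 x = proj2 e1 e2 y"
  then have "mink x e1 = mink y e1" "mink x e2 = mink y e2"
    by (metis proj2_nth)+
  then have "orth_proj (span {e1, e2}) x = orth_proj (span {e1, e2}) y"
    using orth_proj_frame(2)[OF assms(2)] by simp
  then show "x = y" using assms(1)[OF orth_proj_frame(1)[OF assms(2)]] xy by (auto dest: inj_onD)
qed

lemma standard_frame: "frame (axis 1 1) (axis 2 1) (axis 3 1)"
  by (simp add: frame_def mink_def axis_def)

text \<open>A timelike chord could serve as the third axis of a frame, and the projection along it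
  would identify its two ends.\<close>

lemma not_timelike_diff:
  assumes "\<And>H. spacelike_plane H \<Longrightarrow> inj_on (orth_proj H) S" and "x \<in> S" "y \<in> S"
  shows "mink (x - y) (x - y) \<ge> 0"
proof (rule ccontr)
  assume "\<not> ?thesis"
  then have neg: "mink (x - y) (x - y) < 0" by simp
  then obtain e1 e2 where f: "frame e1 e2 ((x - y) /\<^sub>R sqrt (- mink (x - y) (x - y)))"
    by (rule frame_exists)
  have "sqrt (- mink (x - y) (x - y)) \<noteq> 0" using neg by simp
  then have "mink e1 (x - y) = 0" "mink e2 (x - y) = 0"
    using frame_simps[OF f] by (auto simp: mink_simps)
  then have "proj2 e1 e2 x = proj2 e1 e2 y"
    by (simp add: proj2_def mink_commute[of _ e1] mink_commute[of _ e2] mink_simps)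
  then have "x = y" using inj_proj2[OF assms(1) f] assms(2,3) by (auto dest: inj_onD)
  then show False using neg by (simp add: mink_simps)
qed

definition mlen :: "real^3 \<Rightarrow> real" where
  "mlen v = sqrt (mink v v)"

lemma spacelike_plane_triangle:
  assumes "spacelike_plane H" "x \<in> H" "a \<in> H" "b \<in> H"
  shows "mlen (b - x) \<le> mlen (a - x) + mlen (b - a)"
proof -
  have nn: "mink (u - v) (u - v) \<ge> 0" if "u \<in> H" "v \<in> H" for u v
    using assms(1) that unfolding spacelike_plane_def by (cases "u = v") (auto simp: mink_simps less_imp_le)
  define v w where "v = a - x" and "w = b - a"
  have qq: "mink v v + 2 * t * mink v w + t\<^sup>2 * mink w w \<ge> 0" for t
  proof -
    have "affine H" using assms(1) by (simp add: spacelike_plane_def)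
    then have "a + t *\<^sub>R (b - a) \<in> H"
      using assms(3,4) mem_affine[of H a b "1 - t" t] by (simp add: algebra_simps)
    then have "mink ((a + t *\<^sub>R (b - a)) - x) ((a + t *\<^sub>R (b - a)) - x) \<ge> 0" using nn assms by blast
    moreover have "(a + t *\<^sub>R (b - a)) - x = v + t *\<^sub>R w" by (simp add: v_def w_def)
    moreover have "mink (v + t *\<^sub>R w) (v + t *\<^sub>R w) = mink v v + 2 * t * mink v w + t\<^sup>2 * mink w w"
      using mink_commute[of v w] by (simp add: mink_simps power2_eq_square algebra_simps)
    ultimately show ?thesis by simp
  qed
  have vv: "mink v v \<ge> 0" "mink w w \<ge> 0" using nn assms by (auto simp: v_def w_def)
  have "(mink v w)\<^sup>2 \<le> mink v v * mink w w"
  proof (cases "mink w w = 0")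
    case True
    have "mink v w = 0"
    proof (rule ccontr)
      assume n: "mink v w \<noteq> 0"
      \<comment> \<open>At this parameter the affine function of \<open>t\<close> would take the
        value -1.\<close>
      have "mink v v + 2 * (- (mink v v + 1) / (2 * mink v w)) * mink v w \<ge> 0"
        using qq[of "- (mink v v + 1) / (2 * mink v w)"] True by simp
      then show False using n by (simp add: field_simps)
    qed
    then show ?thesis using vv by simp
  next
    case False
    then have p: "mink w w > 0" using vv by simp
    have "mink v v + 2 * (- mink v w / mink w w) * mink v w + (- mink v w / mink w w)\<^sup>2 * mink w w
       = mink v v - (mink v w)\<^sup>2 / mink w w"
      using p by (simp add: power2_eq_square field_simps)
    then have "mink v v - (mink v w)\<^sup>2 / mink w w \<ge> 0" using qq[of "- mink v w / mink w w"] by simp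
    then show ?thesis using p by (simp add: field_simps)
  qed
  then have cs: "mink v w \<le> mlen v * mlen w"
    unfolding mlen_def using real_le_rsqrt[of "mink v w" "mink v v * mink w w"] by (simp add: real_sqrt_mult)
  have "mink (v + w) (v + w) = mink v v + 2 * mink v w + mink w w"
    using mink_commute[of v w] by (simp add: mink_simps)
  also have "\<dots> \<le> (mlen v + mlen w)\<^sup>2"
    using cs vv by (simp add: mlen_def power2_eq_square algebra_simps)
  finally have "mlen (v + w) \<le> mlen v + mlen w"
    unfolding mlen_def using vv by (intro real_le_lsqrt) (auto simp: mlen_def)
  then show ?thesis by (simp add: v_def w_def)
qed

section \<open>Bending of polyhedral cones\<close>

text \<open>\<open>bend h u j\<close> is the increment, from the \<open>j\<close>-th to the next direction, of the angular velocity of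
  the horizontal projection of an isometric deformation with vertical velocity \<open>u\<close> of the cone which
  is the graph of the homogeneous function with value \<open>h j\<close> in the direction \<open>\<theta> j\<close>.\<close>

definition bend :: "(nat \<Rightarrow> real) \<Rightarrow> (nat \<Rightarrow> real) \<Rightarrow> (nat \<Rightarrow> real) \<Rightarrow> nat \<Rightarrow> real" where
  "bend \<theta> h u j = (u j * (h j * cos (\<theta> (Suc j) - \<theta> j) - h (Suc j)) +
     u (Suc j) * (h (Suc j) * cos (\<theta> (Suc j) - \<theta> j) - h j)) / sin (\<theta> (Suc j) - \<theta> j)"

text \<open>The change of slope of the cone across the direction \<open>\<theta> (Suc j)\<close>.\<close>

definition slope_jump :: "(nat \<Rightarrow> real) \<Rightarrow> (nat \<Rightarrow> real) \<Rightarrow> nat \<Rightarrow> real" where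
  "slope_jump \<theta> h j =
     (h (Suc j) * cos (\<theta> (Suc (Suc j)) - \<theta> (Suc j)) - h (Suc (Suc j))) / sin (\<theta> (Suc (Suc j)) - \<theta> (Suc j)) +
     (h (Suc j) * cos (\<theta> (Suc j) - \<theta> j) - h j) / sin (\<theta> (Suc j) - \<theta> j)"

text \<open>Summation by parts over one period: \<open>u (Suc j)\<close> receives one term from the
  sector that ends in the direction \<open>\<theta> (Suc j)\<close> and one from the sector that
  starts there.\<close>

lemma sum_bend_eq_sum_slope_jump:
  assumes "\<And>j. u (j + N) = u j" "\<And>j. h (j + N) = h j" "\<And>j. \<theta> (j + N) = \<theta> j + 2 * pi"
  shows "(\<Sum>j<N. bend \<theta> h u j) = (\<Sum>j<N. u (Suc j) * slope_jump \<theta> h j)"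
proof -
  define \<alpha> where "\<alpha> j = u j * (h j * cos (\<theta> (Suc j) - \<theta> j) - h (Suc j)) / sin (\<theta> (Suc j) - \<theta> j)" for j
  define \<beta> where "\<beta> j = u (Suc j) * (h (Suc j) * cos (\<theta> (Suc j) - \<theta> j) - h j) / sin (\<theta> (Suc j) - \<theta> j)" for j
  have per: "\<alpha> N = \<alpha> 0"
    using assms(1)[of 0] assms(2)[of 0] assms(2)[of 1] assms(3)[of 0] assms(3)[of 1]
    by (simp add: \<alpha>_def)
  have "(\<Sum>j<N. \<alpha> (Suc j)) = (\<Sum>j<N. \<alpha> j)"
    using sum.lessThan_Suc_shift[of \<alpha> N] sum.lessThan_Suc[of \<alpha> N] per by simp
  then have "(\<Sum>j<N. \<alpha> j + \<beta> j) = (\<Sum>j<N. \<alpha> (Suc j) + \<beta> j)"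
    by (simp add: sum.distrib)
  moreover have "bend \<theta> h u j = \<alpha> j + \<beta> j" "u (Suc j) * slope_jump \<theta> h j = \<alpha> (Suc j) + \<beta> j" for j
    by (simp_all add: bend_def slope_jump_def \<alpha>_def \<beta>_def add_divide_distrib distrib_left)
  ultimately show ?thesis by simp
qed

text \<open>With \<open>m\<close> the derivative of \<open>l\<close> in the angle, each
  \<open>bend\<close> is the increment of the product of \<open>h\<close> and \<open>m\<close>, so
  the sum telescopes over a period.\<close>

lemma sum_bend_linear:
  assumes "\<And>j. h (j + N) = h j" "\<And>j. \<theta> (j + N) = \<theta> j + 2 * pi"
    and "\<And>j. sin (\<theta> (Suc j) - \<theta> j) \<noteq> 0" "\<And>j. l j = a * cos (\<theta> j) + b * sin (\<theta> j)"
  shows "(\<Sum>j<N. bend \<theta> h l j) = 0"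
proof -
  define m where "m j = b * cos (\<theta> j) - a * sin (\<theta> j)" for j
  have eq: "bend \<theta> h l j = h (Suc j) * m (Suc j) - h j * m j" for j
  proof -
    define c d where "c = cos (\<theta> (Suc j) - \<theta> j)" and "d = sin (\<theta> (Suc j) - \<theta> j)"
    have t: "\<theta> (Suc j) = \<theta> j + (\<theta> (Suc j) - \<theta> j)" by simp
    have 0: "cos (\<theta> (Suc j)) = cos (\<theta> j) * c - sin (\<theta> j) * d" "sin (\<theta> (Suc j)) = sin (\<theta> j) * c + cos (\<theta> j) * d"
      unfolding c_def d_def by (subst t, simp only: cos_add sin_add)+
    have cd: "c * c + d * d = 1"
      using sin_cos_squared_add3[of "\<theta> (Suc j) - \<theta> j"] by (simp add: c_def d_def)
    have 1: "l (Suc j) = l j * c + m j * d" "m (Suc j) = m j * c - l j * d"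
      by (simp_all add: assms(4) m_def 0 algebra_simps)
    have 2: "l (Suc j) * c - l j = d * m (Suc j)"
    proof -
      have "l (Suc j) * c - l j = l j * (c * c) + m j * d * c - l j * (c * c + d * d)"
        by (simp only: 1 cd) (simp add: algebra_simps)
      then show ?thesis by (simp add: 1 algebra_simps)
    qed
    have 3: "l j * c - l (Suc j) = - (d * m j)" by (simp add: 1)
    have "l j * (h j * c - h (Suc j)) + l (Suc j) * (h (Suc j) * c - h j)
       = h j * (l j * c - l (Suc j)) + h (Suc j) * (l (Suc j) * c - l j)"
      by (simp add: algebra_simps)
    also have "\<dots> = d * (h (Suc j) * m (Suc j) - h j * m j)"
      by (simp only: 2 3) (simp add: algebra_simps)
    finally show ?thesis
      using assms(3)[of j] by (simp add: bend_def c_def[symmetric] d_def[symmetric])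
  qed
  have "(\<Sum>j<N. bend \<theta> h l j) = h N * m N - h 0 * m 0"
    unfolding eq by (rule sum_lessThan_telescope)
  also have "\<dots> = 0"
    using assms(1)[of 0] assms(2)[of 0] by (simp add: m_def)
  finally show ?thesis .
qed

text \<open>\<open>bend\<close> is symmetric in \<open>h\<close> and \<open>u\<close>, and both \<open>bend \<theta> h u\<close> (the total angle \<open>2 * pi\<close> is fixed) and
  \<open>bend \<theta> h l\<close> (linear functions do not bend) sum to \<open>0\<close>. The first sum forces \<open>u\<close> to vanish at every crease,
  so that all terms of the second one have the same sign.\<close>

lemma slope_jump_eq_0:
  assumes "\<And>j. u (j + N) = u j" "\<And>j. h (j + N) = h j" "\<And>j. \<theta> (j + N) = \<theta> j + 2 * pi" "0 < N"
    and "\<And>j. sin (\<theta> (Suc j) - \<theta> j) \<noteq> 0" "\<And>j. l j = a * cos (\<theta> j) + b * sin (\<theta> j)"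
    and b: "\<And>j. \<beta> (Suc j) - \<beta> j = bend \<theta> h u j" "\<And>j. \<beta> (j + N) = \<beta> j"
    and neg: "\<And>j. slope_jump \<theta> h j \<le> 0" "\<And>j. u j \<le> 0"
    and pos: "\<And>j. slope_jump \<theta> h j \<noteq> 0 \<Longrightarrow> u (Suc j) = 0 \<Longrightarrow> l (Suc j) > 0"
    and "j < N"
  shows "slope_jump \<theta> h j = 0"
proof -
  have lper: "l (j + N) = l j" for j by (simp add: assms(3,6))
  have "(\<Sum>j<N. u (Suc j) * slope_jump \<theta> h j) = (\<Sum>j<N. bend \<theta> h u j)"
    by (rule sum_bend_eq_sum_slope_jump[symmetric]) (simp_all add: assms)
  also have "\<dots> = \<beta> N - \<beta> 0" unfolding b(1)[symmetric] by (rule sum_lessThan_telescope)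
  also have "\<dots> = 0" using b(2)[of 0] by simp
  finally have "\<forall>j\<in>{..<N}. u (Suc j) * slope_jump \<theta> h j = 0"
    by (subst sum_nonneg_eq_0_iff[symmetric]) (auto intro: mult_nonpos_nonpos neg)
  then have lpos: "slope_jump \<theta> h j = 0 \<or> l (Suc j) > 0" if "j < N" for j
    using pos that by auto
  then have le: "l (Suc j) * slope_jump \<theta> h j \<le> 0" if "j < N" for j
    using lpos[OF that] neg(1)[of j] by (cases "slope_jump \<theta> h j = 0") (auto intro: mult_nonneg_nonpos less_imp_le)
  have "(\<Sum>j<N. l (Suc j) * slope_jump \<theta> h j) = (\<Sum>j<N. bend \<theta> h l j)"
    by (rule sum_bend_eq_sum_slope_jump[symmetric]) (simp_all add: assms lper)
  also have "\<dots> = 0" by (rule sum_bend_linear) (rule assms)+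
  finally have "(\<Sum>j<N. - (l (Suc j) * slope_jump \<theta> h j)) = 0" by (simp add: sum_negf)
  then have "\<forall>j\<in>{..<N}. - (l (Suc j) * slope_jump \<theta> h j) = 0"
    by (subst sum_nonneg_eq_0_iff[symmetric]) (auto intro: le)
  then show ?thesis using lpos[OF \<open>j < N\<close>] \<open>j < N\<close>
    by (metis lessThan_iff mult_eq_0_iff neg_equal_0_iff_equal order_less_irrefl)
qed

section \<open>Subdivision of the circle\<close>

definition cdir :: "real \<Rightarrow> real^2" where
  "cdir t = vector [cos t, sin t]"

lemma cdir_nth [simp]: "cdir t $ 1 = cos t" "cdir t $ 2 = sin t"
  by (simp_all add: cdir_def)

lemma norm_cdir [simp]: "norm (cdir t) = 1"
  by (simp add: norm_vec_def L2_set_def sum_2)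

lemma cdir_periodic [simp]: "cdir (t + 2 * pi) = cdir t"
  by (simp add: vec_eq_iff forall_2)

lemma cdir_shift [simp]: "cdir (t + 2 * pi * real k) = cdir t"
proof -
  have *: "2 * pi * real k = 2 * real k * pi" by simp
  show ?thesis unfolding * vec_eq_iff forall_2 cdir_nth cos_add sin_add cos_2npi sin_2npi by simp
qed

lemma cdir_pi: "cdir (t + pi) = - cdir t"
  by (simp add: vec_eq_iff forall_2)

lemma continuous_cdir: "continuous_on S cdir"
proof -
  have "cdir = (\<lambda>t. cos t *\<^sub>R axis 1 1 + sin t *\<^sub>R axis 2 1)"
    by (simp add: fun_eq_iff vec_eq_iff forall_2 axis_def)
  moreover have "continuous_on S (\<lambda>t. cos t *\<^sub>R axis 1 1 + sin t *\<^sub>R axis 2 1 :: real^2)"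
    by (intro continuous_intros)
  ultimately show ?thesis by (simp only:)
qed

lemma polar_real2: obtains r t where "v = r *\<^sub>R cdir t" "r = norm v" "0 \<le> t" "t < 2 * pi"
proof -
  define z where "z = Complex (v$1) (v$2)"
  have n: "norm v = norm z" by (simp add: z_def norm_vec_def L2_set_def sum_2 cmod_def)
  define t where "t = Arg2pi z"
  have t: "0 \<le> t" "t < 2 * pi" "z = of_real (norm z) * exp (\<i> * of_real t)"
    by (simp_all add: t_def Arg2pi_ge_0 Arg2pi_lt_2pi flip: Arg2pi_eq)
  have "v $ 1 = norm v * cos t \<and> v $ 2 = norm v * sin t"
    using arg_cong[OF t(3), of Re] arg_cong[OF t(3), of Im] n
    by (simp add: z_def Re_exp Im_exp)
  then have "v = norm v *\<^sub>R cdir t" by (simp add: vec_eq_iff forall_2)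
  then show ?thesis using t that by blast
qed

text \<open>An arc bulges out of the triangle over its chord; halving the radius brings it back
  inside. The weights \<open>x\<close> and \<open>y\<close> come from the law of sines, and each is
  at most 1/2 because sine increases on the small angles considered.\<close>

lemma half_arc_in_triangle:
  assumes "convex T" "0 \<in> T" "r *\<^sub>R cdir a \<in> T" "r *\<^sub>R cdir b \<in> T" "a \<le> t" "t \<le> b" "b - a < 1"
  shows "(r/2) *\<^sub>R cdir t \<in> T"
proof (cases "a = b")
  case True
  then have "(1/2) *\<^sub>R 0 + (1/2) *\<^sub>R (r *\<^sub>R cdir t) \<in> T"
    using assms by (intro convexD) auto
  then show ?thesis by simp
next
  case False
  define s where "s = sin (b - a)"
  have s: "s > 0" using assms False pi_gt3 by (auto simp: s_def intro!: sin_gt_zero)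
  define x y where "x = sin (b - t) / (2 * s)" and "y = sin (t - a) / (2 * s)"
  have xy: "x \<ge> 0" "y \<ge> 0" using assms s pi_gt3 by (auto simp: x_def y_def intro!: divide_nonneg_pos sin_ge_zero)
  have "sin (b - t) \<le> s" "sin (t - a) \<le> s"
    unfolding s_def using assms pi_gt3 by (auto intro!: sin_monotone_2pi_le)
  then have le: "x \<le> 1/2" "y \<le> 1/2" using s by (auto simp: x_def y_def field_simps)
  have e: "sin (b - t) * cos a + sin (t - a) * cos b = s * cos t"
    "sin (b - t) * sin a + sin (t - a) * sin b = s * sin t"
  proof -
    define p q where "p = t - a" and "q = b - t"
    have "b = t + q" "a = t - p" by (auto simp: p_def q_def)
    then have *: "s = sin (p + q)" "sin (b - t) = sin q" "sin (t - a) = sin p" by (auto simp: s_def add.commute)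
    show "sin (b - t) * cos a + sin (t - a) * cos b = s * cos t"
      "sin (b - t) * sin a + sin (t - a) * sin b = s * sin t"
      unfolding * \<open>b = t + q\<close> \<open>a = t - p\<close> by (simp_all add: sin_add cos_add sin_diff cos_diff algebra_simps)
  qed
  have xc: "x * cos a + y * cos b = cos t / 2" "x * sin a + y * sin b = sin t / 2"
    unfolding x_def y_def times_divide_eq_left add_divide_distrib[symmetric] e using s by auto
  have m: "(1/2) *\<^sub>R ((2 * x) *\<^sub>R (r *\<^sub>R cdir a)) + (1/2) *\<^sub>R ((2 * y) *\<^sub>R (r *\<^sub>R cdir b)) \<in> T"
  proof (rule convexD[OF assms(1)])
    have sc: "c *\<^sub>R v \<in> T" if "v \<in> T" "0 \<le> c" "c \<le> 1" for c v
      using convexD[OF assms(1) that(1) assms(2), of c "1 - c"] that by simp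
    show "(2 * x) *\<^sub>R (r *\<^sub>R cdir a) \<in> T" "(2 * y) *\<^sub>R (r *\<^sub>R cdir b) \<in> T"
      by (rule sc[OF assms(3)] sc[OF assms(4)], use xy le in simp, use xy le in simp)+
  qed auto
  have "(r/2) *\<^sub>R cdir t = r *\<^sub>R (x *\<^sub>R cdir a + y *\<^sub>R cdir b)"
    using xc by (simp add: vec_eq_iff forall_2)
  also have "\<dots> = (1/2) *\<^sub>R ((2 * x) *\<^sub>R (r *\<^sub>R cdir a)) + (1/2) *\<^sub>R ((2 * y) *\<^sub>R (r *\<^sub>R cdir b))"
    by (simp add: scaleR_add_right mult.commute)
  finally show ?thesis using m by simp
qed

text \<open>Among finitely many sets one contains the points at infinitely many angles of a sequence
  tending to \<open>t\<close>. Being closed it also contains the point at angle \<open>t\<close>,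
  and being convex a whole arc of half the radius.\<close>

lemma arc_germ:
  fixes \<T> :: "(real^2) set set"
  assumes fin: "finite \<T>" and T: "\<And>T. T \<in> \<T> \<Longrightarrow> closed T \<and> convex T \<and> 0 \<in> T"
    and cover: "\<And>t. r *\<^sub>R cdir t \<in> \<Union>\<T>" and \<sigma>: "\<sigma> = 1 \<or> \<sigma> = -(1::real)"
  obtains d T where "0 < d" "d < 1" "T \<in> \<T>" "\<And>s. 0 \<le> s \<Longrightarrow> s \<le> d \<Longrightarrow> (r/2) *\<^sub>R cdir (t + \<sigma> * s) \<in> T"
proof -
  \<comment> \<open>The shift by 2 keeps the angles below 1, as \<open>half_arc_in_triangle\<close>
    demands.\<close>
  define s where "s n = 1 / (real n + 2)" for n
  have s: "0 < s n" "s n < 1" for n by (auto simp: s_def)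
  have s0: "s \<longlonglongrightarrow> 0" unfolding s_def
    using LIMSEQ_ignore_initial_segment[OF lim_1_over_n, of 2] by (simp add: add.commute)
  have "\<forall>n. \<exists>T\<in>\<T>. r *\<^sub>R cdir (t + \<sigma> * s n) \<in> T" using cover by auto
  then obtain F where F: "\<And>n. F n \<in> \<T>" "\<And>n. r *\<^sub>R cdir (t + \<sigma> * s n) \<in> F n" by metis
  have "finite (range F)" using F(1) fin by (meson finite_subset image_subsetI)
  then obtain n0 where inf: "infinite {n. F n = F n0}"
    using pigeonhole_infinite[of "UNIV::nat set" F] by auto
  define T where "T = F n0"
  have TT: "closed T" "convex T" "0 \<in> T" using T F(1) by (auto simp: T_def)
  have at0: "r *\<^sub>R cdir t \<in> T"
  proof -
    obtain \<nu> :: "nat \<Rightarrow> nat" where \<nu>: "strict_mono \<nu>" "\<And>k. \<nu> k \<in> {n. F n = F n0}"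
      using infinite_enumerate[OF inf] by blast
    have "(\<lambda>k. t + \<sigma> * s (\<nu> k)) \<longlonglongrightarrow> t + \<sigma> * 0"
      using LIMSEQ_subseq_LIMSEQ[OF s0 \<nu>(1)] by (intro tendsto_intros) (simp add: o_def)
    then have "(\<lambda>k. r *\<^sub>R cdir (t + \<sigma> * s (\<nu> k))) \<longlonglongrightarrow> r *\<^sub>R cdir t"
      using continuous_on_tendsto_compose[OF continuous_cdir[of UNIV], of "\<lambda>k. t + \<sigma> * s (\<nu> k)" t]
      by (intro tendsto_intros) simp
    moreover have "r *\<^sub>R cdir (t + \<sigma> * s (\<nu> k)) \<in> T" for k
      using F(2)[of "\<nu> k"] \<nu>(2)[of k] by (simp add: T_def)
    ultimately show ?thesis by (rule closed_sequentially[OF TT(1), rotated])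
  qed
  show ?thesis
  proof
    show "0 < s n0" "s n0 < 1" "T \<in> \<T>" using s F by (auto simp: T_def)
    fix v assume v: "0 \<le> v" "v \<le> s n0"
    show "(r/2) *\<^sub>R cdir (t + \<sigma> * v) \<in> T"
    proof (cases "\<sigma> = 1")
      case True
      then show ?thesis
        using half_arc_in_triangle[OF TT(2,3) at0, of "t + s n0" "t + v"] F(2)[of n0] v s by (simp add: T_def)
    next
      case False
      then show ?thesis
        using half_arc_in_triangle[OF TT(2,3) _ at0, of "t - s n0" "t - v"] F(2)[of n0] \<sigma> v s by (simp add: T_def)
    qed
  qed
qed

definition arc_in :: "real \<Rightarrow> real \<Rightarrow> real \<Rightarrow> (real^2) set \<Rightarrow> bool" where
  "arc_in r a b T \<longleftrightarrow> (\<forall>t. a \<le> t \<and> t \<le> b \<longrightarrow> r *\<^sub>R cdir t \<in> T)"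

text \<open>The bound 1 on the angle of a sector is below pi, which later makes the sines in the
  denominators of \<open>bend\<close> and \<open>slope_jump\<close> positive.\<close>

definition subdivided :: "(real^2) set set \<Rightarrow> real \<Rightarrow> real \<Rightarrow> real \<Rightarrow> bool" where
  "subdivided \<T> r a b \<longleftrightarrow> (\<exists>N \<theta> T. \<theta> 0 = a \<and> \<theta> N = b \<and>
     (\<forall>j<(N::nat). \<theta> j < \<theta> (Suc j) \<and> \<theta> (Suc j) < \<theta> j + 1 \<and> T j \<in> \<T> \<and> arc_in r (\<theta> j) (\<theta> (Suc j)) (T j)))"

lemma subdivided_refl: "subdivided \<T> r a a"
  unfolding subdivided_def by (rule exI[of _ 0]) auto

lemma subdivided_single:
  assumes "a \<le> b" "b < a + 1" "T \<in> \<T>" "arc_in r a b T"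
  shows "subdivided \<T> r a b"
proof (cases "a = b")
  case False
  then show ?thesis unfolding subdivided_def using assms
    by (intro exI[of _ 1] exI[of _ "\<lambda>j. if j = 0 then a else b"] exI[of _ "\<lambda>_. T"]) auto
qed (simp add: subdivided_refl)

lemma subdivided_trans:
  assumes "subdivided \<T> r a b" "subdivided \<T> r b c"
  shows "subdivided \<T> r a c"
proof -
  obtain N \<theta> T where 1: "\<theta> 0 = a" "\<theta> N = b"
    "\<And>j. j < N \<Longrightarrow> \<theta> j < \<theta> (Suc j) \<and> \<theta> (Suc j) < \<theta> j + 1 \<and> T j \<in> \<T> \<and> arc_in r (\<theta> j) (\<theta> (Suc j)) (T j)"
    using assms(1) unfolding subdivided_def by blast
  obtain N' \<theta>' T' where 2: "\<theta>' 0 = b" "\<theta>' N' = c"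
    "\<And>j. j < N' \<Longrightarrow> \<theta>' j < \<theta>' (Suc j) \<and> \<theta>' (Suc j) < \<theta>' j + 1 \<and> T' j \<in> \<T> \<and> arc_in r (\<theta>' j) (\<theta>' (Suc j)) (T' j)"
    using assms(2) unfolding subdivided_def by blast
  define \<eta> where "\<eta> j = (if j \<le> N then \<theta> j else \<theta>' (j - N))" for j
  define S where "S j = (if j < N then T j else T' (j - N))" for j
  have \<eta>: "\<eta> j = \<theta>' (j - N)" if "N \<le> j" for j
    using that 1(2) 2(1) by (cases "j = N") (auto simp: \<eta>_def)
  have "\<eta> j < \<eta> (Suc j) \<and> \<eta> (Suc j) < \<eta> j + 1 \<and> S j \<in> \<T> \<and> arc_in r (\<eta> j) (\<eta> (Suc j)) (S j)"
    if j: "j < N + N'" for j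
  proof (cases "j < N")
    case True
    then show ?thesis using 1(3)[of j] by (simp add: \<eta>_def S_def)
  next
    case False
    then show ?thesis using 2(3)[of "j - N"] \<eta>[of j] \<eta>[of "Suc j"] j by (simp add: S_def Suc_diff_le)
  qed
  moreover have "\<eta> 0 = a" "\<eta> (N + N') = c" using 1(1) 2(2) \<eta>[of "N + N'"] by (auto simp: \<eta>_def)
  ultimately show ?thesis unfolding subdivided_def by blast
qed

text \<open>Germs of arcs on both sides of every angle subdivide all short intervals around it, and
  subdivisions concatenate: this is what the bisection principle asks for.\<close>

lemma circle_subdivided:
  assumes "finite \<T>" and "\<And>T. T \<in> \<T> \<Longrightarrow> closed T \<and> convex T \<and> 0 \<in> T"
    and "\<And>t. r *\<^sub>R cdir t \<in> \<Union>\<T>"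
  shows "subdivided \<T> (r/2) 0 (2 * pi)"
proof (rule Bolzano[where P = "subdivided \<T> (r/2)"])
  show "0 \<le> 2 * pi" by simp
  fix t :: real
  obtain d T where T: "0 < d" "d < 1" "T \<in> \<T>" "\<And>s. 0 \<le> s \<Longrightarrow> s \<le> d \<Longrightarrow> (r/2) *\<^sub>R cdir (t + 1 * s) \<in> T"
    by (rule arc_germ[OF assms, where \<sigma> = 1 and t = t]) auto
  obtain d' T' where T': "0 < d'" "d' < 1" "T' \<in> \<T>" "\<And>s. 0 \<le> s \<Longrightarrow> s \<le> d' \<Longrightarrow> (r/2) *\<^sub>R cdir (t + (-1) * s) \<in> T'"
    by (rule arc_germ[OF assms, where \<sigma> = "-1" and t = t]) auto
  show "\<exists>d>0. \<forall>a b. a \<le> t \<and> t \<le> b \<and> b - a < d \<longrightarrow> subdivided \<T> (r/2) a b"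
  proof (intro exI conjI allI impI)
    show "0 < min d d'" using T T' by simp
    fix a b assume ab: "a \<le> t \<and> t \<le> b \<and> b - a < min d d'"
    have "arc_in (r/2) t b T"
      unfolding arc_in_def using T(4)[of "x - t" for x] ab by (auto simp: algebra_simps)
    moreover have "arc_in (r/2) a t T'"
      unfolding arc_in_def using T'(4)[of "t - x" for x] ab by (auto simp: algebra_simps)
    ultimately show "subdivided \<T> (r/2) a b"
      using ab T T' by (intro subdivided_trans[OF subdivided_single subdivided_single]) auto
  qed
qed (rule subdivided_trans)

lemma circle_cyclic_subdivision:
  assumes "finite \<T>" and "\<And>T. T \<in> \<T> \<Longrightarrow> closed T \<and> convex T \<and> 0 \<in> T"
    and "\<And>t. r *\<^sub>R cdir t \<in> \<Union>\<T>"
  obtains N \<theta> T where "0 < N" "\<And>j. \<theta> (j + N) = \<theta> j + 2 * pi" "\<And>j. T (j + N) = T j"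
    "\<And>j. \<theta> j < \<theta> (Suc j)" "\<And>j. \<theta> (Suc j) < \<theta> j + 1" "\<And>j. T j \<in> \<T>"
    "\<And>j. arc_in (r/2) (\<theta> j) (\<theta> (Suc j)) (T j)" "\<theta> 0 = 0"
proof -
  obtain N \<eta> S where S: "\<eta> 0 = 0" "\<eta> N = 2 * pi"
    "\<And>j. j < N \<Longrightarrow> \<eta> j < \<eta> (Suc j) \<and> \<eta> (Suc j) < \<eta> j + 1 \<and> S j \<in> \<T> \<and> arc_in (r/2) (\<eta> j) (\<eta> (Suc j)) (S j)"
    using circle_subdivided[OF assms] unfolding subdivided_def by blast
  have N: "0 < N" using S(1,2) by (cases N) auto
  \<comment> \<open>Each further turn adds 2 pi, so that the last sector and the first one become
    neighbours like any others.\<close>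
  define \<theta> where "\<theta> j = \<eta> (j mod N) + 2 * pi * real (j div N)" for j
  define T where "T j = S (j mod N)" for j
  have \<theta>Suc: "\<theta> (Suc j) = \<eta> (Suc (j mod N)) + 2 * pi * real (j div N)" for j
  proof (cases "Suc (j mod N) = N")
    case True
    then show ?thesis using S(1,2) N by (simp add: \<theta>_def mod_Suc div_Suc algebra_simps)
  next
    case False
    then show ?thesis using N by (simp add: \<theta>_def mod_Suc div_Suc)
  qed
  have J: "j mod N < N" for j using N by simp
  show ?thesis
  proof
    show "0 < N" by fact
    show "\<theta> 0 = 0" using S(1) by (simp add: \<theta>_def)
    fix j
    show "\<theta> (j + N) = \<theta> j + 2 * pi" "T (j + N) = T j" using N by (simp_all add: \<theta>_def T_def algebra_simps)
    show "\<theta> j < \<theta> (Suc j)" "\<theta> (Suc j) < \<theta> j + 1" "T j \<in> \<T>"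
      unfolding \<theta>Suc using S(3)[OF J[of j]] by (simp_all add: \<theta>_def T_def)
    show "arc_in (r/2) (\<theta> j) (\<theta> (Suc j)) (T j)"
      unfolding arc_in_def
    proof (intro allI impI)
      fix t assume t: "\<theta> j \<le> t \<and> t \<le> \<theta> (Suc j)"
      have "arc_in (r/2) (\<eta> (j mod N)) (\<eta> (Suc (j mod N))) (T j)" using S(3)[OF J[of j]] by (simp add: T_def)
      then have "(r/2) *\<^sub>R cdir (t - 2 * pi * real (j div N)) \<in> T j"
        unfolding arc_in_def using t unfolding \<theta>Suc by (simp add: \<theta>_def)
      then show "(r/2) *\<^sub>R cdir t \<in> T j"
        using cdir_shift[of "t - 2 * pi * real (j div N)" "j div N"] by simp
    qed
  qed
qed

section \<open>Spacelike polyhedral complexes\<close>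

text \<open>Isolates what the local geometry uses, without any covering or group. Cells are closed
  polygons, and \<open>open_map\<close> is invariance of domain for the surface, stated without
  asking for charts.\<close>

locale spacelike_complex =
  fixes \<phi> :: "'a::t2_space \<Rightarrow> real^3" and \<C> :: "'a set set"
  assumes cont_phi: "continuous_on UNIV \<phi>"
    and inj_phi: "inj \<phi>"
    and connected_UNIV: "connected (UNIV :: 'a set)"
    and compact_cell: "K \<in> \<C> \<Longrightarrow> compact K"
    and convex_cell: "K \<in> \<C> \<Longrightarrow> convex (\<phi> ` K)"
    and cell_plane: "K \<in> \<C> \<Longrightarrow> \<exists>H. spacelike_plane H \<and> \<phi> ` K \<subseteq> H"
    and cell_dim: "K \<in> \<C> \<Longrightarrow> aff_dim (\<phi> ` K) = 2"
    and finite_cells: "finite {K \<in> \<C>. x \<in> K}"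
    and star_nbhd: "\<exists>W. open W \<and> x \<in> W \<and> W \<subseteq> \<Union>{K \<in> \<C>. x \<in> K}"
    and proj_inj: "spacelike_plane H \<Longrightarrow> inj_on (orth_proj H) (range \<phi>)"
    and open_map: "continuous_on UNIV f \<Longrightarrow> inj f \<Longrightarrow> open W \<Longrightarrow> open ((f :: 'a \<Rightarrow> real^2) ` W)"
begin

definition star :: "'a \<Rightarrow> 'a set" where
  "star x = \<Union>{K \<in> \<C>. x \<in> K}"

lemma compact_star: "compact (star x)"
  unfolding star_def using finite_cells[of x] compact_cell by (intro compact_Union) auto

lemma closed_cell: "K \<in> \<C> \<Longrightarrow> closed K"
  by (simp add: compact_cell compact_imp_closed)

lemma interior_star: "x \<in> interior (star x)"
  unfolding star_def using star_nbhd[of x] by (auto intro: interiorI)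

lemma cont_proj: "continuous_on S (\<lambda>y. proj2 e1 e2 (\<phi> y))"
  by (intro bounded_linear.continuous_on[OF bounded_linear_proj2] continuous_on_subset[OF cont_phi]) auto

lemma inj_proj:
  assumes "frame e1 e2 e3"
  shows "inj (\<lambda>y. proj2 e1 e2 (\<phi> y))"
  using inj_proj2[OF proj_inj assms] inj_phi by (auto simp: inj_on_def)

text \<open>By invariance of domain the surface is a graph over a small disc, whatever the timelike
  axis of the frame.\<close>

lemma proj_ball:
  assumes "frame e1 e2 e3" "open W" "x \<in> W"
  shows "\<exists>R>0. \<forall>w. norm w < R \<longrightarrow> (\<exists>y\<in>W. proj2 e1 e2 (\<phi> y - \<phi> x) = w)"
proof -
  let ?p = "\<lambda>y. proj2 e1 e2 (\<phi> y)"
  have "open (?p ` W)" by (rule open_map[OF cont_proj inj_proj[OF assms(1)] assms(2)])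
  then obtain R where R: "R > 0" "ball (?p x) R \<subseteq> ?p ` W"
    using assms(3) by (auto simp: open_contains_ball)
  show ?thesis
  proof (intro exI conjI allI impI)
    show "R > 0" by fact
    fix w :: "real^2" assume "norm w < R"
    then have "?p x + w \<in> ball (?p x) R" by (simp add: dist_norm)
    then obtain y where "y \<in> W" "?p y = ?p x + w" using R(2) by force
    then show "\<exists>y\<in>W. proj2 e1 e2 (\<phi> y - \<phi> x) = w"
      by (intro bexI[of _ y]) (auto simp: linear_diff[OF bounded_linear.linear[OF bounded_linear_proj2]])
  qed
qed

lemma same_cell_spacelike:
  assumes "K \<in> \<C>" "x \<in> K" "y \<in> K" "x \<noteq> y"
  shows "mink (\<phi> x - \<phi> y) (\<phi> x - \<phi> y) > 0"
proof -
  obtain H where "spacelike_plane H" "\<phi> ` K \<subseteq> H" using cell_plane[OF assms(1)] by blast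
  moreover have "\<phi> x \<noteq> \<phi> y" using inj_phi assms(4) by (auto dest: injD)
  ultimately show ?thesis using assms unfolding spacelike_plane_def by blast
qed

lemma chord_slope:
  assumes "frame e1 e2 e3" "K \<in> \<C>" "x \<in> K" "y \<in> K" "x \<noteq> y"
  shows "\<bar>mink (\<phi> y - \<phi> x) e3\<bar> < norm (proj2 e1 e2 (\<phi> y - \<phi> x))"
proof -
  have "mink (\<phi> y - \<phi> x) (\<phi> y - \<phi> x) > 0"
    using same_cell_spacelike[OF assms(2,4,3)] assms(5) by simp
  then have "(mink (\<phi> y - \<phi> x) e3)\<^sup>2 < (norm (proj2 e1 e2 (\<phi> y - \<phi> x)))\<^sup>2"
    using frame_mink_self[OF assms(1), of "\<phi> y - \<phi> x"] by simp
  then have "\<bar>mink (\<phi> y - \<phi> x) e3\<bar>\<^sup>2 < (norm (proj2 e1 e2 (\<phi> y - \<phi> x)))\<^sup>2" by simp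
  then show ?thesis by (rule power2_less_imp_less) simp
qed

lemma star_proj_ball:
  assumes "frame e1 e2 e3"
  shows "\<exists>R>0. \<forall>w. norm w < R \<longrightarrow> (\<exists>y K. K \<in> \<C> \<and> x \<in> K \<and> y \<in> K \<and> proj2 e1 e2 (\<phi> y - \<phi> x) = w)"
proof -
  obtain W where W: "open W" "x \<in> W" "W \<subseteq> \<Union>{K \<in> \<C>. x \<in> K}" using star_nbhd by blast
  obtain R where "R > 0" "\<forall>w. norm w < R \<longrightarrow> (\<exists>y\<in>W. proj2 e1 e2 (\<phi> y - \<phi> x) = w)"
    using proj_ball[OF assms W(1,2)] by blast
  moreover have "\<exists>K. K \<in> \<C> \<and> x \<in> K \<and> y \<in> K" if "y \<in> W" for y
    using W(3) that by auto
  ultimately show ?thesis by meson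
qed

lemma cell_segment:
  assumes "K \<in> \<C>" "x \<in> K" "y \<in> K" "0 \<le> s" "s \<le> 1"
  obtains m where "m \<in> K" "\<phi> m = (1 - s) *\<^sub>R \<phi> x + s *\<^sub>R \<phi> y"
proof -
  have "(1 - s) *\<^sub>R \<phi> x + s *\<^sub>R \<phi> y \<in> \<phi> ` K"
    using convexD_alt[OF convex_cell[OF assms(1)], of "\<phi> x" "\<phi> y" s] assms by auto
  then show ?thesis using that by auto
qed

lemma cell_span:
  assumes "K \<in> \<C>" "x \<in> K" "a \<in> K" "b \<in> K" "w \<in> K"
    and "independent {\<phi> a - \<phi> x, \<phi> b - \<phi> x}" "\<phi> a - \<phi> x \<noteq> \<phi> b - \<phi> x"
  shows "\<phi> w - \<phi> x \<in> span {\<phi> a - \<phi> x, \<phi> b - \<phi> x}"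
proof -
  define S where "S = (\<lambda>v. v - \<phi> x) ` \<phi> ` K"
  have "aff_dim (\<phi> ` K) = int (dim S)"
    unfolding S_def by (rule aff_dim_eq_dim_subtract) (use assms in \<open>auto intro: hull_inc\<close>)
  then have "dim S = 2" using cell_dim[OF assms(1)] by simp
  moreover have "{\<phi> a - \<phi> x, \<phi> b - \<phi> x} \<subseteq> S" using assms by (auto simp: S_def)
  ultimately have "S \<subseteq> span {\<phi> a - \<phi> x, \<phi> b - \<phi> x}"
    using assms(6,7) by (intro card_ge_dim_independent) auto
  then show ?thesis using assms by (auto simp: S_def)
qed

subsection \<open>The surface is timelike\<close>

text \<open>If the maximal value were not negative, a step whose horizontal part points away from
  the axis would increase it: chords of cells have slope below 1, so the height lost cannot outweigh
  the horizontal gain.\<close>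

lemma max_timelike:
  assumes "\<And>x. mink (\<phi> x) (\<phi> x) \<le> mink (\<phi> x0) (\<phi> x0)"
  shows "mink (\<phi> x) (\<phi> x) < 0"
proof -
  define e1 e2 e3 :: "real^3" where "e1 = axis 1 1" and "e2 = axis 2 1" and "e3 = axis 3 1"
  have fr: "frame e1 e2 e3" unfolding e1_def e2_def e3_def by (rule standard_frame)
  define a where "a = proj2 e1 e2 (\<phi> x0)"
  define c where "c = mink (\<phi> x0) e3"
  obtain R where R: "R > 0" "\<And>w. norm w < R \<Longrightarrow> \<exists>y K. K \<in> \<C> \<and> x0 \<in> K \<and> y \<in> K \<and> proj2 e1 e2 (\<phi> y - \<phi> x0) = w"
    using star_proj_ball[OF fr, of x0] by metis
  have "mink (\<phi> x0) (\<phi> x0) < 0"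
  proof (rule ccontr)
    assume "\<not> ?thesis"
    then have "c\<^sup>2 \<le> (norm a)\<^sup>2" using frame_mink_self[OF fr, of "\<phi> x0"] by (simp add: a_def c_def)
    then have ca: "\<bar>c\<bar> \<le> norm a" by (metis abs_norm_cancel power2_le_iff_abs_le abs_ge_zero norm_ge_zero)
    \<comment> \<open>A small horizontal vector parallel to \<open>a\<close>, or in any direction if
      \<open>a\<close> vanishes, so that Cauchy-Schwarz is an equality.\<close>
    obtain w e where w: "w \<noteq> 0" "norm w < R" "a \<bullet> w = norm a * norm w"
    proof (cases "a = 0")
      case True
      obtain w :: "real^2" where "norm w = R/2" using R(1) vector_choose_size[of "R/2"] by auto
      then show ?thesis using that[of w] R(1) True by auto
    next
      case False
      then show ?thesis
        using that[of "(R / (2 * norm a)) *\<^sub>R a"] R(1) by (auto simp: power2_norm_eq_inner[symmetric] power2_eq_square)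
    qed
    obtain y K where y: "K \<in> \<C>" "x0 \<in> K" "y \<in> K" "proj2 e1 e2 (\<phi> y - \<phi> x0) = w"
      using R(2)[OF w(2)] by blast
    define v where "v = \<phi> y - \<phi> x0"
    have "y \<noteq> x0" using y(4) w(1) by (auto simp: vec_eq_iff forall_2 mink_simps)
    then have v: "mink v v > 0" "\<bar>mink v e3\<bar> < norm w"
      using same_cell_spacelike[OF y(1,3,2)] chord_slope[OF fr y(1,2,3)] y(4) by (auto simp: v_def)
    have wn: "w $ 1 = mink v e1" "w $ 2 = mink v e2" using y(4) by (auto simp: v_def)
    have "mink (\<phi> x0) v = a \<bullet> w - c * mink v e3"
      by (subst frame_mink[OF fr]) (simp add: wn a_def c_def inner_vec_def sum_2)
    moreover have "c * mink v e3 \<le> \<bar>c\<bar> * \<bar>mink v e3\<bar>" by (metis abs_ge_self abs_mult)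
    moreover have "\<bar>c\<bar> * \<bar>mink v e3\<bar> \<le> norm a * norm w" using ca v(2) by (intro mult_mono) auto
    ultimately have "mink (\<phi> x0) v \<ge> 0" using w(3) by simp
    moreover have "\<phi> y = \<phi> x0 + v" by (simp add: v_def)
    ultimately have "mink (\<phi> y) (\<phi> y) > mink (\<phi> x0) (\<phi> x0)"
      using v(1) mink_commute[of v "\<phi> x0"] by (simp add: mink_simps)
    then show False using assms[of y] by simp
  qed
  then show ?thesis using assms[of x] by simp
qed

end

section \<open>Support planes of the convex body\<close>

locale convex_spacelike_complex = spacelike_complex \<phi> \<C>
  for \<phi> :: "'a::t2_space \<Rightarrow> real^3" and \<C> :: "'a set set" +
  fixes B :: "(real^3) set" and xm :: 'a
  assumes closed_body: "closed B" and convex_body: "convex B" and interior_body: "interior B \<noteq> {}"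
    and surface_body: "range \<phi> \<subseteq> frontier B"
    and xm_max: "mink (\<phi> x) (\<phi> x) \<le> mink (\<phi> xm) (\<phi> xm)"
begin

lemma timelike: "mink (\<phi> x) (\<phi> x) < 0"
  by (rule max_timelike[OF xm_max])

lemma surface_subset: "\<phi> x \<in> B"
  using surface_body closed_body frontier_subset_eq by auto

lemma not_interior: "\<phi> z \<notin> interior B"
  using surface_body by (auto simp: frontier_def)

definition supports :: "real^3 \<Rightarrow> 'a \<Rightarrow> bool" where
  "supports s z \<longleftrightarrow> s \<noteq> 0 \<and> (\<forall>y. s \<bullet> \<phi> z \<le> s \<bullet> \<phi> y)"

lemma inner3: "(u::real^3) \<bullet> v = proj2 (axis 1 1) (axis 2 1) u \<bullet> proj2 (axis 1 1) (axis 2 1) v + u$3 * v$3"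
  by (simp add: inner_vec_def sum_2 sum_3 mink_def axis_def)

lemma mink_axis3: "mink v (axis 3 1) = - (v$3)"
  by (simp add: mink_def axis_def)

lemma timelike_nth3: "mink v v < 0 \<longleftrightarrow> norm (proj2 (axis 1 1) (axis 2 1) v) < \<bar>v$3\<bar>"
  unfolding frame_mink_self[OF standard_frame] mink_axis3
  by (simp add: abs_le_square_iff[symmetric] not_le[symmetric])

text \<open>A support plane is spacelike: otherwise the step whose horizontal part is opposite to
  that of \<open>s\<close> would cross the plane, the height of a chord being too small to
  compensate.\<close>

lemma support_timelike:
  assumes "supports s z"
  shows "mink s s < 0"
proof (rule ccontr)
  assume n: "\<not> mink s s < 0"
  let ?p = "proj2 (axis 1 1) (axis 2 1) :: real^3 \<Rightarrow> real^2"
  let ?a = "?p s"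
  have sa: "\<bar>s$3\<bar> \<le> norm ?a" using n unfolding timelike_nth3 by simp
  have a0: "norm ?a > 0"
  proof (rule ccontr)
    assume "\<not> ?thesis"
    then have "s \<bullet> s = 0" using sa by (simp add: inner3)
    then show False using assms by (simp add: supports_def)
  qed
  obtain R where R: "R > 0" "\<And>w. norm w < R \<Longrightarrow> \<exists>y K. K \<in> \<C> \<and> z \<in> K \<and> y \<in> K \<and> ?p (\<phi> y - \<phi> z) = w"
    using star_proj_ball[OF standard_frame, of z] by metis
  define r where "r = R / (2 * norm ?a)"
  have r: "r > 0" using R(1) a0 by (simp add: r_def)
  have "norm (- r *\<^sub>R ?a) < R" using R(1) a0 by (simp add: r_def)
  then obtain y K where y: "K \<in> \<C>" "z \<in> K" "y \<in> K" "?p (\<phi> y - \<phi> z) = - r *\<^sub>R ?a" using R(2) by blast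
  have "y \<noteq> z" using y(4) r a0 by (auto simp: vec_eq_iff forall_2 mink_simps)
  have k: "\<bar>(\<phi> y - \<phi> z)$3\<bar> < r * norm ?a"
    using chord_slope[OF standard_frame y(1,2,3) \<open>y \<noteq> z\<close>[symmetric]] y(4) r unfolding mink_axis3 by simp
  have "0 \<le> s \<bullet> (\<phi> y - \<phi> z)" using assms by (simp add: supports_def inner_diff_right)
  also have "\<dots> = - r * (norm ?a)\<^sup>2 + s$3 * (\<phi> y - \<phi> z)$3"
    unfolding inner3 y(4) by (simp add: power2_norm_eq_inner)
  finally have "r * (norm ?a)\<^sup>2 \<le> s$3 * (\<phi> y - \<phi> z)$3" by simp
  also have "\<dots> \<le> \<bar>s$3\<bar> * \<bar>(\<phi> y - \<phi> z)$3\<bar>" by (metis abs_ge_self abs_mult)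
  also have "\<dots> \<le> norm ?a * \<bar>(\<phi> y - \<phi> z)$3\<bar>" using sa by (intro mult_right_mono) auto
  also have "\<dots> < norm ?a * (r * norm ?a)" using k a0 by (intro mult_strict_left_mono) auto
  finally show False by (simp add: power2_eq_square)
qed

lemma timelike_inner_pos:
  assumes "mink s s < 0" "mink v v < 0" "s$3 * v$3 > 0"
  shows "s \<bullet> v > 0"
proof -
  let ?p = "proj2 (axis 1 1) (axis 2 1) :: real^3 \<Rightarrow> real^2"
  have "\<bar>?p s \<bullet> ?p v\<bar> \<le> norm (?p s) * norm (?p v)" by (rule Cauchy_Schwarz_ineq2)
  also have "\<dots> < \<bar>s$3\<bar> * \<bar>v$3\<bar>"
    using assms(1,2) unfolding timelike_nth3 by (intro mult_strict_mono') auto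
  also have "\<dots> = s$3 * v$3" using assms(3) by (simp add: abs_mult[symmetric])
  finally show ?thesis unfolding inner3 by linarith
qed

text \<open>The sign \<open>\<sigma>\<close> records on which side of the surface, along the
  vertical axis, the body lies. Supporting normals then have a third coordinate of that
  sign.\<close>

definition above :: "real \<Rightarrow> 'a \<Rightarrow> bool" where
  "above \<sigma> z \<longleftrightarrow> (\<exists>\<alpha>>0. \<phi> z + (\<sigma> * \<alpha>) *\<^sub>R axis 3 1 \<in> interior B)"

lemma above_support:
  assumes "above \<sigma> z" "s \<noteq> 0" "\<And>y. y \<in> B \<Longrightarrow> s \<bullet> \<phi> z \<le> s \<bullet> y"
  shows "\<sigma> * s$3 > 0"
proof -
  obtain \<alpha> where \<alpha>: "\<alpha> > 0" "\<phi> z + (\<sigma> * \<alpha>) *\<^sub>R axis 3 1 \<in> interior B" using assms(1) above_def by blast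
  have "s \<bullet> \<phi> z \<le> s \<bullet> (\<phi> z + (\<sigma> * \<alpha>) *\<^sub>R axis 3 1)" using assms(3) \<alpha>(2) interior_subset by blast
  then have "0 \<le> \<alpha> * (\<sigma> * s$3)" by (simp add: inner_add_right inner_axis algebra_simps)
  then have ge: "\<sigma> * s$3 \<ge> 0" using \<alpha>(1) by (simp add: zero_le_mult_iff)
  have "supports s z" using assms(2,3) surface_subset by (simp add: supports_def)
  then have "s$3 \<noteq> 0" using support_timelike timelike_nth3[of s] by (metis abs_zero norm_not_less_zero)
  moreover have "\<sigma> \<noteq> 0" using \<alpha>(2) not_interior[of z] by auto
  ultimately show ?thesis using ge by (metis less_eq_real_def mult_eq_0_iff)
qed

lemma support_exists: "\<exists>s. s \<noteq> 0 \<and> (\<forall>y\<in>B. s \<bullet> \<phi> z \<le> s \<bullet> y)"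
proof -
  have "\<phi> z \<notin> rel_interior B" "\<phi> z \<in> closure B"
    using not_interior[of z] interior_body closed_body surface_subset by (auto simp: rel_interior_nonempty_interior)
  then show ?thesis
    using supporting_hyperplane_relative_frontier[OF convex_body, of "\<phi> z"] closed_body by (metis closure_closed)
qed

text \<open>If the vertical line through the point missed the interior of the body, a plane would
  separate the two. Boundedness on the line forces the normal to be horizontal, hence not timelike,
  although the plane supports the surface.\<close>

lemma above_or_below: "above 1 z \<or> above (-1) z"
proof (rule ccontr)
  assume n: "\<not> ?thesis"
  define \<l> where "\<l> = range (\<lambda>t. \<phi> z + t *\<^sub>R (axis 3 1 :: real^3))"
  have disj: "\<l> \<inter> interior B = {}"
  proof (rule ccontr)
    assume "\<l> \<inter> interior B \<noteq> {}"
    then obtain t where t: "\<phi> z + t *\<^sub>R axis 3 1 \<in> interior B" by (auto simp: \<l>_def)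
    have "t \<noteq> 0" using t not_interior[of z] by auto
    then have "above 1 z \<or> above (-1) z"
      unfolding above_def using t by (cases "t > 0") (auto intro: exI[of _ t] exI[of _ "-t"])
    then show False using n by simp
  qed
  have "convex \<l>"
  proof -
    have "\<l> = (+) (\<phi> z) ` range (\<lambda>t. t *\<^sub>R (axis 3 1))" by (auto simp: \<l>_def)
    moreover have "convex (range (\<lambda>t. t *\<^sub>R (axis 3 1 :: real^3)))"
      by (intro convex_linear_image linear_scaleR_left convex_UNIV)
    ultimately show ?thesis by (simp add: convex_translation)
  qed
  then obtain s b where s: "s \<noteq> 0" "\<And>y. y \<in> \<l> \<Longrightarrow> s \<bullet> y \<le> b" "\<And>y. y \<in> interior B \<Longrightarrow> b \<le> s \<bullet> y"
    using separating_hyperplane_sets[of \<l> "interior B"] disj interior_body convex_body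
    by (force simp: \<l>_def)
  have s3: "s$3 = 0"
  proof (rule ccontr)
    assume "s$3 \<noteq> 0"
    then have "s \<bullet> (\<phi> z + ((b - s \<bullet> \<phi> z + 1) / s$3) *\<^sub>R axis 3 1) = b + 1"
      by (simp add: inner_add_right inner_axis)
    moreover have "\<phi> z + ((b - s \<bullet> \<phi> z + 1) / s$3) *\<^sub>R axis 3 1 \<in> \<l>" by (simp add: \<l>_def)
    ultimately show False using s(2) by fastforce
  qed
  have "B \<subseteq> {y. b \<le> s \<bullet> y}"
  proof -
    have "closure (interior B) \<subseteq> {y. b \<le> s \<bullet> y}"
      by (rule closure_minimal) (use s(3) in \<open>auto simp: closed_halfspace_ge\<close>)
    then show ?thesis using convex_closure_interior[OF convex_body interior_body] closed_body by simp
  qed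
  moreover have "\<phi> z \<in> \<l>" unfolding \<l>_def by (rule range_eqI[of _ _ 0]) simp
  ultimately have "s \<bullet> \<phi> z \<le> s \<bullet> \<phi> y" for y
    using s(2)[of "\<phi> z"] surface_subset[of y] by force
  then have "supports s z" using s(1) by (simp add: supports_def)
  then show False using support_timelike timelike_nth3[of s] s3 by (metis abs_zero norm_not_less_zero)
qed

lemma open_above: "open {z. above \<sigma> z}"
proof -
  have "{z. above \<sigma> z} = (\<Union>\<alpha>\<in>{0<..}. (\<lambda>z. \<phi> z + (\<sigma> * \<alpha>) *\<^sub>R axis 3 1) -` interior B)"
    by (auto simp: above_def)
  moreover have "open ((\<lambda>z. \<phi> z + (\<sigma> * \<alpha>) *\<^sub>R axis 3 1) -` interior B)" for \<alpha>
    by (intro open_vimage continuous_intros cont_phi) auto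
  ultimately show ?thesis by auto
qed

lemma connected_dichotomy:
  assumes "open {x::'a. P x}" "open {x. Q x}" "\<And>x. P x \<or> Q x" "\<And>x. \<not> (P x \<and> Q x)"
  shows "(\<forall>x. P x) \<or> (\<forall>x. Q x)"
  using connectedD[OF connected_UNIV assms(1,2)] assms(3,4) by blast

text \<open>The timelike cone has two components, told apart by the sign of the third coordinate,
  and the surface is connected.\<close>

lemma nappe: "\<phi> x $ 3 * \<phi> y $ 3 > 0"
proof -
  have "(\<forall>x. \<phi> x $ 3 > 0) \<or> (\<forall>x. \<phi> x $ 3 < 0)"
  proof (rule connected_dichotomy)
    show "open {x. 0 < \<phi> x $ 3}" "open {x. \<phi> x $ 3 < 0}"
      by (intro open_Collect_less continuous_intros cont_phi)+
    fix x show "\<phi> x $ 3 > 0 \<or> \<phi> x $ 3 < 0"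
      using timelike[of x] unfolding timelike_nth3 by (metis abs_zero linorder_neqE norm_not_less_zero)
  qed auto
  then show ?thesis by (auto intro: mult_pos_pos mult_neg_neg)
qed

text \<open>Compare the chords over two opposite horizontal steps: adding the inequalities for
  \<open>w\<close> and \<open>- w\<close> cancels the horizontal parts, and the sum of the two
  heights is left with the sign of both third coordinates.\<close>

lemma support_sign_at_max:
  assumes "supports s xm"
  shows "s$3 * \<phi> xm $ 3 > 0"
proof -
  let ?p = "proj2 (axis 1 1) (axis 2 1) :: real^3 \<Rightarrow> real^2"
  obtain R where R: "R > 0" "\<And>w. norm w < R \<Longrightarrow> \<exists>y K. K \<in> \<C> \<and> xm \<in> K \<and> y \<in> K \<and> ?p (\<phi> y - \<phi> xm) = w"
    using star_proj_ball[OF standard_frame, of xm] by metis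
  obtain w :: "real^2" where w: "norm w = R/2" using R(1) vector_choose_size[of "R/2"] by auto
  have *: "\<exists>k. 0 \<le> ?p s \<bullet> w' + s$3 * k \<and> ?p (\<phi> xm) \<bullet> w' - \<phi> xm $ 3 * k < 0" if w': "norm w' = R/2" for w'
  proof -
    have "norm w' < R" using w' R(1) by simp
    then obtain y K where y: "K \<in> \<C>" "xm \<in> K" "y \<in> K" "?p (\<phi> y - \<phi> xm) = w'" using R(2) by blast
    define v where "v = \<phi> y - \<phi> xm"
    have "y \<noteq> xm" using y(4) w' R(1) by (auto simp: vec_eq_iff forall_2 mink_simps)
    then have "mink v v > 0" using same_cell_spacelike[OF y(1,3,2)] by (simp add: v_def)
    moreover have "\<phi> y = \<phi> xm + v" by (simp add: v_def)
    ultimately have "mink (\<phi> xm) v < 0"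
      using xm_max[of y] mink_commute[of v "\<phi> xm"] by (simp add: mink_simps)
    moreover have "mink (\<phi> xm) v = ?p (\<phi> xm) \<bullet> ?p v - \<phi> xm $ 3 * v $ 3"
      by (simp add: inner_vec_def sum_2 mink_def axis_def)
    moreover have "0 \<le> s \<bullet> v" using assms by (simp add: supports_def v_def inner_diff_right)
    ultimately show ?thesis using y(4) unfolding inner3 v_def by (intro exI[of _ "(\<phi> y - \<phi> xm) $ 3"]) simp
  qed
  obtain k k' where k: "0 \<le> ?p s \<bullet> w + s$3 * k" "?p (\<phi> xm) \<bullet> w - \<phi> xm $ 3 * k < 0"
    "0 \<le> - (?p s \<bullet> w) + s$3 * k'" "- (?p (\<phi> xm) \<bullet> w) - \<phi> xm $ 3 * k' < 0"
    using *[OF w] *[of "- w"] w by auto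
  then have 1: "0 \<le> s$3 * (k + k')" and 2: "0 < \<phi> xm $ 3 * (k + k')"
    by (simp_all add: distrib_left)
  have "s$3 \<noteq> 0" using support_timelike[OF assms] unfolding timelike_nth3 by (metis abs_zero norm_not_less_zero)
  then show ?thesis using 1 2 by (auto simp: zero_less_mult_iff zero_le_mult_iff)
qed

text \<open>Every support plane strictly separates the origin from the body or touches the body only
  on the far side. The side on which the body lies is constant by connectedness, and is compared
  with the nappe at the single point \<open>xm\<close>.\<close>

lemma support:
  "\<exists>s. (\<forall>y\<in>B. s \<bullet> \<phi> z \<le> s \<bullet> y) \<and> (\<forall>x. s \<bullet> \<phi> x > 0)"
proof -
  have excl: "\<not> (above 1 x \<and> above (-1) x)" for x
    using support_exists[of x] above_support[of 1 x] above_support[of "-1" x] by (metis mult_1 mult_minus1 neg_0_less_iff_less order_less_asym)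
  obtain \<sigma> :: real where \<sigma>: "\<And>x. above \<sigma> x" "\<sigma> = 1 \<or> \<sigma> = -1"
    using connected_dichotomy[OF open_above open_above above_or_below excl] by blast
  have pos: "s$3 * \<sigma> > 0" if "s \<noteq> 0" "\<And>y. y \<in> B \<Longrightarrow> s \<bullet> \<phi> z \<le> s \<bullet> y" for s z
    using above_support[OF \<sigma>(1) that] by (simp add: mult.commute)
  obtain s0 where s0: "s0 \<noteq> 0" "\<And>y. y \<in> B \<Longrightarrow> s0 \<bullet> \<phi> xm \<le> s0 \<bullet> y" using support_exists[of xm] by blast
  have "s0$3 * \<phi> xm $ 3 > 0"
    by (rule support_sign_at_max) (use s0 surface_subset in \<open>auto simp: supports_def\<close>)
  then have \<sigma>m: "\<sigma> * \<phi> xm $ 3 > 0" using pos[OF s0] by (auto simp: zero_less_mult_iff)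
  obtain s where s: "s \<noteq> 0" "\<And>y. y \<in> B \<Longrightarrow> s \<bullet> \<phi> z \<le> s \<bullet> y" using support_exists[of z] by blast
  have st: "mink s s < 0"
    by (rule support_timelike[of s z]) (use s surface_subset in \<open>auto simp: supports_def\<close>)
  have "s \<bullet> \<phi> x > 0" for x
    using pos[OF s] \<sigma>m nappe[of x xm] by (intro timelike_inner_pos[OF st timelike]) (auto simp: zero_less_mult_iff)
  then show ?thesis using s by blast
qed

end

lemma proj2_0: "proj2 e1 e2 0 = 0"
  by (simp add: vec_eq_iff forall_2 mink_simps)

context spacelike_complex
begin

subsection \<open>The fan of cells around a point\<close>

text \<open>A cyclic list of sectors around \<open>x\<close>: the rays are cut at the common
  horizontal distance \<open>r\<close>, and consecutive points \<open>z j\<close>,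
  \<open>z (Suc j)\<close> lie in a common cell \<open>k j\<close>. The sequences are periodic
  rather than finite lists, and neighbouring sectors may belong to the same cell.\<close>

definition fan :: "real^3 \<Rightarrow> real^3 \<Rightarrow> 'a \<Rightarrow> nat \<Rightarrow> (nat \<Rightarrow> real) \<Rightarrow> (nat \<Rightarrow> 'a) \<Rightarrow> (nat \<Rightarrow> 'a set) \<Rightarrow> real \<Rightarrow> bool" where
  "fan e1 e2 x N \<theta> z k r \<longleftrightarrow> 0 < N \<and> 0 < r \<and>
     (\<forall>j. \<theta> (j + N) = \<theta> j + 2 * pi \<and> z (j + N) = z j \<and> k (j + N) = k j \<and>
        \<theta> j < \<theta> (Suc j) \<and> \<theta> (Suc j) < \<theta> j + 1 \<and>
        k j \<in> \<C> \<and> x \<in> k j \<and> z j \<in> k j \<and> z (Suc j) \<in> k j \<and>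
        proj2 e1 e2 (\<phi> (z j) - \<phi> x) = r *\<^sub>R cdir (\<theta> j)) \<and>
     (\<exists>W. open W \<and> x \<in> W \<and> W \<subseteq> (\<Union>j. k j))"

lemma inj_proj_diff:
  assumes "frame e1 e2 e3" "proj2 e1 e2 (\<phi> y - \<phi> x) = proj2 e1 e2 (\<phi> y' - \<phi> x)"
  shows "y = y'"
  using inj_proj[OF assms(1)] assms(2)
  by (auto simp: linear_diff[OF bounded_linear.linear[OF bounded_linear_proj2]] dest: injD)

lemma projected_cell:
  assumes "K \<in> \<C>" "x \<in> K"
  shows "closed ((\<lambda>y. proj2 e1 e2 (\<phi> y - \<phi> x)) ` K) \<and> convex ((\<lambda>y. proj2 e1 e2 (\<phi> y - \<phi> x)) ` K)
    \<and> 0 \<in> (\<lambda>y. proj2 e1 e2 (\<phi> y - \<phi> x)) ` K"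
proof (intro conjI)
  have eq: "(\<lambda>y. proj2 e1 e2 (\<phi> y - \<phi> x)) ` K = proj2 e1 e2 ` (\<lambda>v. v - \<phi> x) ` \<phi> ` K" by auto
  have "continuous_on K (\<lambda>y. proj2 e1 e2 (\<phi> y - \<phi> x))"
    by (intro bounded_linear.continuous_on[OF bounded_linear_proj2] continuous_intros continuous_on_subset[OF cont_phi]) auto
  then show "closed ((\<lambda>y. proj2 e1 e2 (\<phi> y - \<phi> x)) ` K)"
    using compact_cell[OF assms(1)] by (intro compact_imp_closed compact_continuous_image)
  show "convex ((\<lambda>y. proj2 e1 e2 (\<phi> y - \<phi> x)) ` K)"
    unfolding eq using convex_cell[OF assms(1)]
    by (intro convex_linear_image[OF bounded_linear.linear[OF bounded_linear_proj2]]) (simp add: convex_translation_subtract)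
  have "proj2 e1 e2 (\<phi> x - \<phi> x) = 0" by (simp add: vec_eq_iff forall_2 mink_simps)
  then show "0 \<in> (\<lambda>y. proj2 e1 e2 (\<phi> y - \<phi> x)) ` K" using assms(2) by force
qed

lemma fan_exists:
  assumes fr: "frame e1 e2 e3"
  shows "\<exists>N \<theta> z k r. fan e1 e2 x N \<theta> z k r"
proof -
  define P where "P y = proj2 e1 e2 (\<phi> y - \<phi> x)" for y
  have Pinj: "y = y'" if "P y = P y'" for y y'
    using inj_proj_diff[OF fr] that by (simp add: P_def)
  obtain R where R: "R > 0" "\<And>w. norm w < R \<Longrightarrow> \<exists>y K. K \<in> \<C> \<and> x \<in> K \<and> y \<in> K \<and> P y = w"
    using star_proj_ball[OF fr, of x] unfolding P_def by metis
  define \<T> where "\<T> = (\<lambda>K. P ` K) ` {K \<in> \<C>. x \<in> K}"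
  have T: "closed T \<and> convex T \<and> 0 \<in> T" if "T \<in> \<T>" for T
    using that projected_cell[of _ x e1 e2] unfolding \<T>_def P_def by auto
  have fin: "finite \<T>" unfolding \<T>_def by (intro finite_imageI finite_cells)
  have cover: "(R/2) *\<^sub>R cdir t \<in> \<Union>\<T>" for t
  proof -
    have "norm ((R/2) *\<^sub>R cdir t) < R" using R(1) by simp
    then obtain y K where "K \<in> \<C>" "x \<in> K" "y \<in> K" "P y = (R/2) *\<^sub>R cdir t" using R(2) by metis
    then show ?thesis unfolding \<T>_def by force
  qed
  \<comment> \<open>One halving stays inside the disc of radius \<open>R\<close>, the other is lost
    in \<open>circle_cyclic_subdivision\<close>.\<close>
  define r where "r = R/2/2"
  have r: "0 < r" "r < R" using R(1) by (auto simp: r_def)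
  obtain N \<theta> T where S: "0 < N" "\<And>j. \<theta> (j + N) = \<theta> j + 2 * pi" "\<And>j. T (j + N) = T j"
    "\<And>j. \<theta> j < \<theta> (Suc j)" "\<And>j. \<theta> (Suc j) < \<theta> j + 1" "\<And>j. T j \<in> \<T>"
    "\<And>j. arc_in r (\<theta> j) (\<theta> (Suc j)) (T j)" "\<theta> 0 = 0"
    by (rule circle_cyclic_subdivision[OF fin T cover]) (auto simp: r_def)
  define k where "k j = (SOME K. K \<in> \<C> \<and> x \<in> K \<and> P ` K = T j)" for j
  have k: "k j \<in> \<C> \<and> x \<in> k j \<and> P ` k j = T j" for j
  proof -
    have "\<exists>K. K \<in> \<C> \<and> x \<in> K \<and> P ` K = T j" using S(6)[of j] by (auto simp: \<T>_def)
    then show ?thesis unfolding k_def by (rule someI_ex)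
  qed
  define z where "z j = (SOME y. P y = r *\<^sub>R cdir (\<theta> j))" for j
  have z: "P (z j) = r *\<^sub>R cdir (\<theta> j)" for j
  proof -
    have "norm (r *\<^sub>R cdir (\<theta> j)) < R" using r by simp
    then have "\<exists>y. P y = r *\<^sub>R cdir (\<theta> j)" using R(2) by metis
    then show ?thesis unfolding z_def by (rule someI_ex)
  qed
  have mem: "y \<in> k j" if "P y \<in> T j" for y j
  proof -
    have "P y \<in> P ` k j" using that k[of j] by simp
    then obtain y' where "y' \<in> k j" "P y = P y'" by blast
    then show ?thesis using Pinj by auto
  qed
  have z1: "z j \<in> k j" "z (Suc j) \<in> k j" for j
    by (rule mem, use S(7)[of j] S(4)[of j] in \<open>simp add: z arc_in_def\<close>)+
  have W: "\<exists>W. open W \<and> x \<in> W \<and> W \<subseteq> (\<Union>j. k j)"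
  proof (intro exI conjI)
    have "continuous_on UNIV P" unfolding P_def
      by (intro bounded_linear.continuous_on[OF bounded_linear_proj2] continuous_intros cont_phi)
    then show "open {y. norm (P y) < r}" by (intro open_Collect_less continuous_intros)
    show "x \<in> {y. norm (P y) < r}"
      using r by (simp add: P_def vec_eq_iff forall_2 mink_simps norm_vec_def L2_set_def sum_2)
    show "{y. norm (P y) < r} \<subseteq> (\<Union>j. k j)"
    proof
      fix y assume "y \<in> {y. norm (P y) < r}"
      then have n: "norm (P y) < r" by simp
      obtain \<rho> t where t: "P y = \<rho> *\<^sub>R cdir t" "\<rho> = norm (P y)" "0 \<le> t" "t < 2 * pi" by (rule polar_real2)
      have ex: "\<exists>j. \<theta> j \<le> t \<and> t \<le> \<theta> (Suc j)" if "\<theta> 0 \<le> t" "t < \<theta> n" for n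
        using that(2)
      proof (induction n)
        case (Suc n) then show ?case by (cases "t < \<theta> n") (auto simp: not_less intro: less_imp_le)
      qed (use that in auto)
      obtain j where j: "\<theta> j \<le> t" "t \<le> \<theta> (Suc j)"
        using ex[of N] t S(8) S(2)[of 0] by auto
      then have "r *\<^sub>R cdir t \<in> T j" using S(7)[of j] by (simp add: arc_in_def)
      \<comment> \<open>A point at distance below \<open>r\<close> lies on the segment from the apex
        to the arc of its sector, which is inside the convex projected cell.\<close>
      then have "(1 - \<rho>/r) *\<^sub>R 0 + (\<rho>/r) *\<^sub>R (r *\<^sub>R cdir t) \<in> T j"
        using T[OF S(6)[of j]] n t(2) r by (intro convexD_alt) auto
      then have "P y \<in> T j" using t(1) r by simp
      then show "y \<in> (\<Union>j. k j)" using mem by blast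
    qed
  qed
  have "fan e1 e2 x N \<theta> z k r"
    unfolding fan_def using S(1-5) r k z z1 W by (auto simp: P_def[symmetric] k_def z_def)
  then show ?thesis by blast
qed

lemma fanD:
  assumes "fan e1 e2 x N \<theta> z k r"
  shows "0 < N" "0 < r" "\<theta> (j + N) = \<theta> j + 2 * pi" "z (j + N) = z j" "k (j + N) = k j"
    "\<theta> j < \<theta> (Suc j)" "\<theta> (Suc j) < \<theta> j + 1" "k j \<in> \<C>" "x \<in> k j" "z j \<in> k j" "z (Suc j) \<in> k j"
    "proj2 e1 e2 (\<phi> (z j) - \<phi> x) = r *\<^sub>R cdir (\<theta> j)" "\<exists>W. open W \<and> x \<in> W \<and> W \<subseteq> (\<Union>j. k j)"
    "sin (\<theta> (Suc j) - \<theta> j) > 0"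
proof -
  show "\<theta> j < \<theta> (Suc j)" "\<theta> (Suc j) < \<theta> j + 1" using assms unfolding fan_def by blast+
  then show "sin (\<theta> (Suc j) - \<theta> j) > 0" using pi_gt3 by (intro sin_gt_zero) auto
qed (use assms in \<open>unfold fan_def, blast\<close>)+

lemma fan_independent:
  assumes "fan e1 e2 x N \<theta> z k r"
  shows "independent {\<phi> (z j) - \<phi> x, \<phi> (z (Suc j)) - \<phi> x}" "\<phi> (z j) - \<phi> x \<noteq> \<phi> (z (Suc j)) - \<phi> x"
proof -
  let ?a = "\<phi> (z j) - \<phi> x" and ?b = "\<phi> (z (Suc j)) - \<phi> x"
  note f = fanD[OF assms]
  have pa: "proj2 e1 e2 ?a = r *\<^sub>R cdir (\<theta> j)" and pb: "proj2 e1 e2 ?b = r *\<^sub>R cdir (\<theta> (Suc j))"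
    using f(12) by auto
  have neq: "?a \<noteq> c *\<^sub>R ?b" for c
  proof
    assume "?a = c *\<^sub>R ?b"
    then have "proj2 e1 e2 ?a = c *\<^sub>R proj2 e1 e2 ?b"
      by (simp add: linear_cmul[OF bounded_linear.linear[OF bounded_linear_proj2]] del: proj2_def)
    then have "cos (\<theta> j) = c * cos (\<theta> (Suc j))" "sin (\<theta> j) = c * sin (\<theta> (Suc j))"
      using f(2) unfolding pa pb by (auto simp: vec_eq_iff forall_2)
    then have "sin (\<theta> (Suc j) - \<theta> j) = 0" by (simp add: sin_diff)
    then show False using f(14)[of j] by simp
  qed
  then show "?a \<noteq> ?b" using neq[of 1] by simp
  have p0: "proj2 e1 e2 0 = 0" by (simp add: vec_eq_iff forall_2 mink_simps)
  have "?b \<noteq> 0"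
  proof
    assume "?b = 0"
    then have "norm (r *\<^sub>R cdir (\<theta> (Suc j))) = 0"
      using pb p0 by (metis norm_zero)
    then show False using f(2) by simp
  qed
  then show "independent {?a, ?b}"
    using neq \<open>?a \<noteq> ?b\<close> by (simp add: independent_insert span_singleton) (auto simp: span_singleton)
qed

end

text \<open>Split each horizontal velocity into its radial part (\<open>A\<close>,
  \<open>A'\<close>) and its tangential part (\<open>B\<close>, \<open>B'\<close>), both scaled by
  \<open>r\<close>. Preserving the two edge lengths determines the radial parts, and preserving the
  product of the two edges then determines the difference of the tangential ones.\<close>

lemma bend_step:
  assumes "r * (cos a * q1 + sin a * q2) = - (h * v)" "r * (cos b * q1' + sin b * q2') = - (h' * v')"
    and "r * (cos b * q1 + sin b * q2) + h' * v + (r * (cos a * q1' + sin a * q2') + h * v') = 0"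
    and "sin (b - a) \<noteq> (0::real)"
  shows "r * (sin b * q1' - cos b * q2') - r * (sin a * q1 - cos a * q2)
    = (v * (h * cos (b - a) - h') + v' * (h' * cos (b - a) - h)) / sin (b - a)"
proof -
  define A B A' B' where "A = r * (cos a * q1 + sin a * q2)" and "B = r * (cos a * q2 - sin a * q1)"
    and "A' = r * (cos b * q1' + sin b * q2')" and "B' = r * (cos b * q2' - sin b * q1')"
  have id: "(r * (ca * q1 + sa * q2)) * (cb * ca + sb * sa) + (r * (ca * q2 - sa * q1)) * (sb * ca - cb * sa)
    = r * (cb * q1 + sb * q2) * (ca * ca + sa * sa)" for ca sa cb sb q1 q2
    by (simp add: algebra_simps)
  have 1: "r * (cos b * q1 + sin b * q2) = A * cos (b - a) + B * sin (b - a)"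
    using id[of "cos a" q1 "sin a" q2 "cos b" "sin b"] by (simp add: A_def B_def cos_diff sin_diff)
  have 2: "r * (cos a * q1' + sin a * q2') = A' * cos (b - a) - B' * sin (b - a)"
    using id[of "cos b" q1' "sin b" q2' "cos a" "sin a"]
    by (simp add: A'_def B'_def cos_diff sin_diff mult.commute right_diff_distrib)
  have A: "A = - (h * v)" "A' = - (h' * v')" using assms(1,2) by (auto simp: A_def A'_def)
  have "(B - B') * sin (b - a) = v * (h * cos (b - a) - h') + v' * (h' * cos (b - a) - h)"
    using assms(3) unfolding 1 2 A by (simp add: algebra_simps)
  then have "B - B' = (v * (h * cos (b - a) - h') + v' * (h' * cos (b - a) - h)) / sin (b - a)"
    using assms(4) by (simp add: field_simps)
  moreover have "r * (sin b * q1' - cos b * q2') - r * (sin a * q1 - cos a * q2) = B - B'"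
    by (simp add: B_def B'_def algebra_simps)
  ultimately show ?thesis by simp
qed

text \<open>Clearing the positive denominators turns the sign of the jump into that of a linear
  combination of three consecutive heights, the one produced by
  \<open>three_directions\<close>.\<close>

lemma slope_jump_mult:
  assumes "sin (\<theta> (Suc j) - \<theta> j) \<noteq> 0" "sin (\<theta> (Suc (Suc j)) - \<theta> (Suc j)) \<noteq> 0"
  shows "slope_jump \<theta> h j * (sin (\<theta> (Suc (Suc j)) - \<theta> (Suc j)) * sin (\<theta> (Suc j) - \<theta> j)) =
    h (Suc j) * sin (\<theta> (Suc (Suc j)) - \<theta> j) - h (Suc (Suc j)) * sin (\<theta> (Suc j) - \<theta> j)
      - h j * sin (\<theta> (Suc (Suc j)) - \<theta> (Suc j))"
proof -
  define p q where "p = \<theta> (Suc j) - \<theta> j" and "q = \<theta> (Suc (Suc j)) - \<theta> (Suc j)"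
  have "\<theta> (Suc (Suc j)) - \<theta> j = q + p" by (simp add: p_def q_def)
  then show ?thesis
    using assms unfolding slope_jump_def p_def[symmetric] q_def[symmetric]
    by (simp add: sin_add field_simps)
qed

text \<open>The sines of the pairwise angles are the coefficients of the linear relation between
  three vectors of the plane of equal length, so only the vertical component survives.\<close>

lemma three_directions:
  fixes e1 e2 e3 :: "'v::real_vector"
  assumes "\<And>i. i \<in> {a,b,c} \<Longrightarrow> y i = (r * cos (\<theta> i)) *\<^sub>R e1 + (r * sin (\<theta> i)) *\<^sub>R e2 + h i *\<^sub>R e3"
  shows "sin (\<theta> c - \<theta> b) *\<^sub>R y a + sin (\<theta> b - \<theta> a) *\<^sub>R y c - sin (\<theta> c - \<theta> a) *\<^sub>R y b =
    (sin (\<theta> c - \<theta> b) * h a + sin (\<theta> b - \<theta> a) * h c - sin (\<theta> c - \<theta> a) * h b) *\<^sub>R e3"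
proof -
  define p q where "p = \<theta> b - \<theta> a" and "q = \<theta> c - \<theta> b"
  have eq: "\<theta> a = \<theta> b - p" "\<theta> c = \<theta> b + q" "\<theta> c - \<theta> a = p + q" by (auto simp: p_def q_def)
  have 1: "sin q * (r * cos (\<theta> a)) + sin p * (r * cos (\<theta> c)) - sin (p + q) * (r * cos (\<theta> b)) = 0"
    "sin q * (r * sin (\<theta> a)) + sin p * (r * sin (\<theta> c)) - sin (p + q) * (r * sin (\<theta> b)) = 0"
    unfolding eq by (simp_all add: sin_add cos_add sin_diff cos_diff algebra_simps)
  have "sin q *\<^sub>R y a + sin p *\<^sub>R y c - sin (p + q) *\<^sub>R y b =
    (sin q * (r * cos (\<theta> a)) + sin p * (r * cos (\<theta> c)) - sin (p + q) * (r * cos (\<theta> b))) *\<^sub>R e1 +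
    (sin q * (r * sin (\<theta> a)) + sin p * (r * sin (\<theta> c)) - sin (p + q) * (r * sin (\<theta> b))) *\<^sub>R e2 +
    (sin q * h a + sin p * h c - sin (p + q) * h b) *\<^sub>R e3"
    by (simp add: assms scaleR_add_right scaleR_add_left scaleR_diff_right scaleR_diff_left)
  then show ?thesis unfolding 1 eq(3) p_def[symmetric] q_def[symmetric] by simp
qed

lemma periodic_mod:
  assumes "\<And>j. f (j + N) = f (j::nat)"
  shows "f j = f (j mod N)"
proof -
  have "f (m + d * N) = f m" for m d
    by (induction d) (use assms[of "m + _ * N"] in \<open>auto simp: algebra_simps\<close>)
  from this[of "j mod N" "j div N"] show ?thesis by (simp add: mult.commute)
qed

context convex_spacelike_complex
begin

subsection \<open>The maximum principle at a vertex\<close>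

text \<open>\<open>F\<close> stands for \<open>d\<phi>\<close> or for its negative. The tie-break
  \<open>lex\<close> is what produces a linear function that is positive at every crease whose
  vertical velocity vanishes.\<close>

lemma flat_at_maximum:
  fixes F :: "'a \<Rightarrow> real^3"
  assumes iso: "\<And>K a b. K \<in> \<C> \<Longrightarrow> a \<in> K \<Longrightarrow> b \<in> K \<Longrightarrow> mink (F a - F b) (\<phi> a - \<phi> b) = 0"
    and max: "\<And>y. mink (F y) (\<phi> y) \<le> mink (F x0) (\<phi> x0)"
    and pos: "mink (F x0) (\<phi> x0) > 0"
    and lex: "\<And>y. mink (F y) (\<phi> y) = mink (F x0) (\<phi> x0) \<Longrightarrow> mink (\<phi> y) (\<phi> y) \<le> mink (\<phi> x0) (\<phi> x0)"
  shows "flat_at \<phi> x0"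
proof -
  define M where "M = mink (F x0) (\<phi> x0)"
  define q0 where "q0 = mink (\<phi> x0) (\<phi> x0)"
  define \<tau> where "\<tau> = sqrt (- q0)"
  \<comment> \<open>With this axis, pairing with \<open>\<phi> x0\<close> is the vertical component
    up to the factor \<open>\<tau>\<close>.\<close>
  define e3 where "e3 = \<phi> x0 /\<^sub>R \<tau>"
  have q0: "q0 < 0" using timelike by (simp add: q0_def)
  have \<tau>: "\<tau> > 0" using q0 by (simp add: \<tau>_def)
  have x0: "\<phi> x0 = \<tau> *\<^sub>R e3" using \<tau> by (simp add: e3_def)
  obtain e1 e2 where fr: "frame e1 e2 e3"
    using frame_exists[OF timelike[of x0]] unfolding e3_def \<tau>_def q0_def by blast
  obtain N \<theta> z k r where fan: "fan e1 e2 x0 N \<theta> z k r" using fan_exists[OF fr] by blast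
  note f = fanD[OF fan]
  define y where "y j = \<phi> (z j) - \<phi> x0" for j
  define h where "h j = - mink (y j) e3" for j
  have ye: "mink (y j) e1 = r * cos (\<theta> j)" "mink (y j) e2 = r * sin (\<theta> j)" for j
    using f(12)[of j] by (auto simp: y_def[symmetric] vec_eq_iff forall_2)
  have y: "y j = (r * cos (\<theta> j)) *\<^sub>R e1 + (r * sin (\<theta> j)) *\<^sub>R e2 + h j *\<^sub>R e3" for j
    using frame_expand[OF fr, of "y j"] unfolding ye by (simp add: h_def)
  have zneq: "z j \<noteq> x0" for j
    using f(12)[of j] f(2) linear_0[OF bounded_linear.linear[OF bounded_linear_proj2], of e1 e2] norm_cdir[of "\<theta> j"]
    by (metis cancel_comm_monoid_add_class.diff_cancel less_irrefl norm_zero scaleR_eq_0_iff zero_neq_one)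
  have yy: "mink (y j) (y j) > 0" for j
    unfolding y_def by (rule same_cell_spacelike[OF f(8) f(10) f(9) zneq])
  obtain s where s: "\<And>y. y \<in> B \<Longrightarrow> s \<bullet> \<phi> x0 \<le> s \<bullet> y" "\<And>x. s \<bullet> \<phi> x > 0" using support[of x0] by blast
  have sy: "s \<bullet> y j \<ge> 0" for j using s(1)[OF surface_subset[of "z j"]] by (simp add: y_def inner_diff_right)
  have se: "s \<bullet> e3 > 0" using s(2)[of x0] \<tau> by (simp add: e3_def)
  \<comment> \<open>Scaled so that \<open>c * (s \<bullet> v)\<close> equals \<open>M\<close> at
    \<open>\<phi> x0\<close>. This function is then at least \<open>M\<close> on the whole surface,
    so its difference with \<open>mink (F y) (\<phi> y)\<close> has a constant sign.\<close>
  define c where "c = M / (s \<bullet> \<phi> x0)"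
  have c: "c > 0" "c * (s \<bullet> \<phi> x0) = M" using pos s(2)[of x0] by (auto simp: c_def M_def)
  text \<open>Subtracting the translation \<open>t\<close> and the infinitesimal rotation \<open>A\<close> fixes the vertex without changing
    the position of its vertical displacements with respect to the support plane.\<close>
  define t where "t = refl3 (c *\<^sub>R s)"
  have t: "mink t v = c * (s \<bullet> v)" for v
    by (simp add: t_def mink_def refl3_nth inner_vec_def sum_3 algebra_simps)
  define G where "G = F x0 - t"
  have G: "mink G (\<phi> x0) = 0" using c(2) by (simp add: G_def mink_simps t M_def)
  \<comment> \<open>The infinitesimal Lorentz rotation in the plane of \<open>G\<close> and
    \<open>\<phi> x0\<close> that sends \<open>\<phi> x0\<close> to \<open>G\<close>. Hence
    \<open>\<zeta> j\<close> below is the value at \<open>z j\<close> of \<open>F\<close> minus the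
    translation \<open>t\<close> minus the rotation, a field that vanishes at
    \<open>x0\<close>.\<close>
  define A where "A v = (mink v (\<phi> x0) *\<^sub>R G - mink v G *\<^sub>R \<phi> x0) /\<^sub>R q0" for v
  have Aw: "mink (A v) w = (mink v (\<phi> x0) * mink G w - mink v G * mink (\<phi> x0) w) / q0" for v w
    by (simp add: A_def mink_simps divide_inverse algebra_simps)
  have skew: "mink (A v) w + mink (A w) v = 0" for v w
    unfolding Aw using mink_commute[of G] mink_commute[of "\<phi> x0"] by (simp add: add_divide_distrib[symmetric])
  have Ax: "mink (A v) (\<phi> x0) = - mink v G" for v
    using q0 by (simp add: Aw G q0_def[symmetric])
  define Z where "Z j = F (z j) - F x0" for j
  define \<zeta> where "\<zeta> j = Z j - A (y j)" for j
  define v where "v j = mink (\<zeta> j) e3" for j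
  have Z1: "mink (Z j) (y j) = 0" for j
    using iso[OF f(8) f(10) f(9)] by (simp add: Z_def y_def)
  have Z2: "mink (Z j) (y (Suc j)) + mink (Z (Suc j)) (y j) = 0" for j
  proof -
    have "F (z j) - F (z (Suc j)) = Z j - Z (Suc j)" "\<phi> (z j) - \<phi> (z (Suc j)) = y j - y (Suc j)"
      by (auto simp: Z_def y_def)
    then have "mink (Z j - Z (Suc j)) (y j - y (Suc j)) = 0" using iso[OF f(8) f(10) f(11)] by metis
    then show ?thesis using Z1[of j] Z1[of "Suc j"] by (simp add: mink_simps)
  qed
  have \<zeta>1: "mink (\<zeta> j) (y j) = 0" for j
    using Z1[of j] skew[of "y j" "y j"] by (simp add: \<zeta>_def mink_simps)
  have \<zeta>2: "mink (\<zeta> j) (y (Suc j)) + mink (\<zeta> (Suc j)) (y j) = 0" for j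
    using Z2[of j] skew[of "y j" "y (Suc j)"] by (simp add: \<zeta>_def mink_simps)
  have \<zeta>y: "mink (\<zeta> i) (y j) = r * (cos (\<theta> j) * mink (\<zeta> i) e1 + sin (\<theta> j) * mink (\<zeta> i) e2) + h j * v i" for i j
    unfolding y[of j] by (simp add: mink_simps v_def algebra_simps)
  \<comment> \<open>The rotation acts here through \<open>mink (y j) G\<close> only, and the term
    \<open>mink (Z j) (y j)\<close>, which is 0, is added to complete the product.\<close>
  have v: "\<tau> * v j = mink (F (z j)) (\<phi> (z j)) - c * (s \<bullet> \<phi> (z j))" for j
  proof -
    have "\<tau> * v j = mink (\<zeta> j) (\<phi> x0)" by (simp add: v_def x0 mink_simps)
    also have "\<dots> = mink (Z j) (\<phi> x0) + mink (y j) G" by (simp add: \<zeta>_def mink_simps Ax)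
    also have "\<dots> = mink (Z j) (\<phi> x0) + mink (F x0) (y j) - c * (s \<bullet> y j)"
      unfolding mink_commute[of "y j"] by (simp add: G_def mink_simps t)
    also have "\<dots> = mink (Z j) (\<phi> x0) + mink (F x0) (y j) + mink (Z j) (y j) + M - c * (s \<bullet> \<phi> (z j))"
      using c(2) Z1[of j] by (simp add: y_def inner_diff_right algebra_simps)
    also have "\<dots> = mink (F x0 + Z j) (\<phi> x0 + y j) - c * (s \<bullet> \<phi> (z j))"
      by (simp add: M_def mink_simps)
    finally show ?thesis by (simp add: Z_def y_def)
  qed
  have cs: "M \<le> c * (s \<bullet> \<phi> (z j))" for j
    unfolding c(2)[symmetric] using s(1)[OF surface_subset[of "z j"]] c(1) by (intro mult_left_mono) auto
  have vneg: "v j \<le> 0" for j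
  proof -
    have "\<tau> * v j \<le> 0" unfolding v using max[of "z j"] cs[of j] by (simp add: M_def)
    then show ?thesis using \<tau> by (simp add: mult_le_0_iff)
  qed
  \<comment> \<open>Up to sign and the factor \<open>r\<close>, the tangential part of the
    horizontal velocity along the ray. It is periodic because it is computed from the points of the
    fan, which is how closing up after one turn enters.\<close>
  define \<beta> where "\<beta> j = r * (sin (\<theta> j) * mink (\<zeta> j) e1 - cos (\<theta> j) * mink (\<zeta> j) e2)" for j
  have \<beta>: "\<beta> (Suc j) - \<beta> j = bend \<theta> h v j" for j
    unfolding \<beta>_def bend_def
    by (rule bend_step) (use \<zeta>1[of j] \<zeta>1[of "Suc j"] \<zeta>2[of j] f(14)[of j] in \<open>simp_all add: \<zeta>y algebra_simps\<close>)
  have yper: "y (j + N) = y j" "h (j + N) = h j" "\<zeta> (j + N) = \<zeta> j" "v (j + N) = v j" "\<beta> (j + N) = \<beta> j" for j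
    using f(3,4)[of j] by (simp_all add: y_def h_def \<zeta>_def Z_def v_def \<beta>_def)
  \<comment> \<open>The height of the support plane over the ray, by \<open>sl\<close> below; it is
    linear in the direction.\<close>
  define l where "l j = (- r * (s \<bullet> e1) / (s \<bullet> e3)) * cos (\<theta> j) + (- r * (s \<bullet> e2) / (s \<bullet> e3)) * sin (\<theta> j)" for j
  have sl: "s \<bullet> y j = (s \<bullet> e3) * (h j - l j)" for j
    unfolding y[of j] l_def using se by (simp add: inner_add_right field_simps)
  have jump: "slope_jump \<theta> h j \<le> 0" for j
  proof -
    define a b d where "a = sin (\<theta> (Suc (Suc j)) - \<theta> (Suc j))" and "b = sin (\<theta> (Suc j) - \<theta> j)"
      and "d = sin (\<theta> (Suc (Suc j)) - \<theta> j)"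
    have ab: "a > 0" "b > 0" using f(14) by (auto simp: a_def b_def)
    \<comment> \<open>The support plane at the midpoint of an edge contains the edge, since both
      ends lie on its nonnegative side. The two neighbouring edges lie on that side too, which is
      the concavity at the crease.\<close>
    obtain m where m: "m \<in> k j" "\<phi> m = (1 - 1/2) *\<^sub>R \<phi> x0 + (1/2) *\<^sub>R \<phi> (z (Suc j))"
      using cell_segment[OF f(8) f(9) f(11), of "1/2"] by auto
    have m': "\<phi> m = \<phi> x0 + (1/2) *\<^sub>R y (Suc j)" unfolding m(2) by (simp add: y_def vec_eq_iff field_simps)
    obtain s' where s': "\<And>y. y \<in> B \<Longrightarrow> s' \<bullet> \<phi> m \<le> s' \<bullet> y" "\<And>x. s' \<bullet> \<phi> x > 0" using support[of m] by blast
    have "s' \<bullet> e3 > 0" using s'(2)[of x0] \<tau> by (simp add: e3_def)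
    have 1: "s' \<bullet> y (Suc j) = 0"
      using s'(1)[OF surface_subset[of x0]] s'(1)[OF surface_subset[of "z (Suc j)"]] unfolding m'
      by (simp add: inner_add_right y_def inner_diff_right field_simps)
    have 2: "s' \<bullet> y i \<ge> 0" for i
      using s'(1)[OF surface_subset[of "z i"]] 1 unfolding m' by (simp add: inner_add_right y_def inner_diff_right)
    have "0 \<le> s' \<bullet> (a *\<^sub>R y j + b *\<^sub>R y (Suc (Suc j)) - d *\<^sub>R y (Suc j))"
      using 1 2 ab by (simp add: inner_add_right inner_diff_right)
    also have "\<dots> = (a * h j + b * h (Suc (Suc j)) - d * h (Suc j)) * (s' \<bullet> e3)"
      unfolding a_def b_def d_def by (subst three_directions) (auto intro: y)
    finally have "0 \<le> a * h j + b * h (Suc (Suc j)) - d * h (Suc j)"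
      using \<open>s' \<bullet> e3 > 0\<close> by (simp add: zero_le_mult_iff)
    moreover have "slope_jump \<theta> h j * (a * b) = h (Suc j) * d - h (Suc (Suc j)) * b - h j * a"
      unfolding a_def b_def d_def using ab by (intro slope_jump_mult) (auto simp: a_def b_def)
    ultimately have "slope_jump \<theta> h j * (a * b) \<le> 0" by (simp add: mult.commute)
    then show ?thesis using ab by (simp add: mult_le_0_iff zero_less_mult_iff)
  qed
  have lpos: "l (Suc j) > 0" if "v (Suc j) = 0" for j
  proof -
    let ?z = "z (Suc j)"
    have "mink (F ?z) (\<phi> ?z) = c * (s \<bullet> \<phi> ?z)" using v[of "Suc j"] that by simp
    then have 1: "mink (F ?z) (\<phi> ?z) = M" "c * (s \<bullet> \<phi> ?z) = M"
      using max[of ?z] cs[of "Suc j"] by (auto simp: M_def)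
    have "s \<bullet> y (Suc j) = 0" using 1(2) c by (simp add: y_def inner_diff_right) (metis mult_left_cancel less_irrefl)
    then have "h (Suc j) = l (Suc j)" using sl[of "Suc j"] se by simp
    moreover have "mink (\<phi> ?z) (\<phi> ?z) \<le> q0" using lex[of ?z] 1(1) by (simp add: M_def q0_def)
    then have "mink (\<phi> x0 + y (Suc j)) (\<phi> x0 + y (Suc j)) \<le> q0" by (simp add: y_def)
    \<comment> \<open>The chord \<open>y (Suc j)\<close> is spacelike, so the tie-break makes the
      cross term strictly negative, that is, the height strictly positive.\<close>
    then have "2 * mink (\<phi> x0) (y (Suc j)) < 0"
      using yy[of "Suc j"] mink_commute[of "y (Suc j)" "\<phi> x0"] by (simp add: mink_simps q0_def)
    then have "h (Suc j) > 0" using \<tau> unfolding x0 mink_commute[of _ "y (Suc j)"]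
      by (simp add: mink_simps h_def mult_less_0_iff)
    ultimately show ?thesis by simp
  qed
  have "slope_jump \<theta> h j = 0" if "j < N" for j
    by (rule slope_jump_eq_0[where u = v and \<beta> = \<beta> and l = l and N = N,
        OF _ _ _ _ _ l_def]) (use f(1,3,14) yper \<beta> jump vneg lpos that in \<open>auto simp: less_imp_neq[symmetric]\<close>)
  moreover have "slope_jump \<theta> h (j + N) = slope_jump \<theta> h j" for j
    using f(3)[of j] f(3)[of "Suc j"] f(3)[of "Suc (Suc j)"] yper(2)[of j] yper(2)[of "Suc j"] yper(2)[of "Suc (Suc j)"]
    by (simp add: slope_jump_def)
  ultimately have zero: "slope_jump \<theta> h j = 0" for j
    using periodic_mod[of "slope_jump \<theta> h" N j] f(1) by simp
  \<comment> \<open>Without a jump three consecutive edges are linearly dependent, so all of them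
    stay in the plane of the first two.\<close>
  have step: "y (Suc (Suc j)) \<in> span {y j, y (Suc j)}" for j
  proof -
    define a b d where "a = sin (\<theta> (Suc (Suc j)) - \<theta> (Suc j))" and "b = sin (\<theta> (Suc j) - \<theta> j)"
      and "d = sin (\<theta> (Suc (Suc j)) - \<theta> j)"
    have ab: "a > 0" "b > 0" using f(14) by (auto simp: a_def b_def)
    have "slope_jump \<theta> h j * (a * b) = h (Suc j) * d - h (Suc (Suc j)) * b - h j * a"
      unfolding a_def b_def d_def using ab by (intro slope_jump_mult) (auto simp: a_def b_def)
    then have "a * h j + b * h (Suc (Suc j)) - d * h (Suc j) = 0" by (simp add: zero mult.commute)
    then have "a *\<^sub>R y j + b *\<^sub>R y (Suc (Suc j)) - d *\<^sub>R y (Suc j) = 0"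
      unfolding a_def b_def d_def by (subst three_directions) (auto intro: y)
    then have "b *\<^sub>R y (Suc (Suc j)) = d *\<^sub>R y (Suc j) - a *\<^sub>R y j" by (simp add: algebra_simps)
    then have "y (Suc (Suc j)) = (1/b) *\<^sub>R (d *\<^sub>R y (Suc j) - a *\<^sub>R y j)" using ab
      by (metis less_irrefl nonzero_divide_eq_eq scaleR_one scaleR_scaleR)
    then show ?thesis by (simp add: span_base span_diff span_scale)
  qed
  define P where "P = span {y 0, y 1}"
  have yP: "y j \<in> P \<and> y (Suc j) \<in> P" for j
  proof (induction j)
    case 0 then show ?case by (simp add: P_def span_base)
  next
    case (Suc j)
    then have "span {y j, y (Suc j)} \<subseteq> P" unfolding P_def by (intro span_minimal) auto
    then show ?case using Suc step[of j] by auto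
  qed
  have kP: "\<phi> w - \<phi> x0 \<in> P" if "w \<in> k j" for w j
  proof -
    have "\<phi> w - \<phi> x0 \<in> span {y j, y (Suc j)}"
      unfolding y_def by (rule cell_span[OF f(8) f(9) f(10) f(11) that fan_independent[OF fan]])
    moreover have "span {y j, y (Suc j)} \<subseteq> P" using yP[of j] unfolding P_def by (intro span_minimal) auto
    ultimately show ?thesis by blast
  qed
  have dimP: "dim P = 2"
    using fan_independent[OF fan, of 0] dim_eq_card_independent[of "{y 0, y 1}"] by (simp add: P_def y_def)
  obtain W where W: "open W" "x0 \<in> W" "W \<subseteq> (\<Union>j. k j)" using f(13) by blast
  show ?thesis
    unfolding flat_at_def
  proof (intro exI conjI)
    show "open W" "x0 \<in> W" by fact+
    show "affine ((+) (\<phi> x0) ` P)" unfolding P_def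
      by (simp add: affine_translation[symmetric] subspace_imp_affine)
    show "aff_dim ((+) (\<phi> x0) ` P) = 2"
      using dimP by (simp add: aff_dim_translation_eq P_def aff_dim_subspace)
    show "\<phi> ` W \<subseteq> (+) (\<phi> x0) ` P"
    proof (rule image_subsetI)
      fix w assume "w \<in> W"
      then obtain j where "w \<in> k j" using W(3) by blast
      then have "\<phi> w = \<phi> x0 + (\<phi> w - \<phi> x0)" "\<phi> w - \<phi> x0 \<in> P" using kP by auto
      then show "\<phi> w \<in> (+) (\<phi> x0) ` P" by (rule image_eqI)
    qed
  qed
qed

end

section \<open>Infinitesimal rotations of the cells and their gluing\<close>

lemma mink_skew_unique:
  fixes A A' :: "real^3 \<Rightarrow> real^3"
  assumes "linear A" "linear A'" "\<And>v w. mink (A v) w + mink v (A w) = 0" "\<And>v w. mink (A' v) w + mink v (A' w) = 0"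
    and "independent {a, b}" "a \<noteq> b" "A a = A' a" "A b = A' b"
  shows "A = A'"
proof -
  define D where "D v = A v - A' v" for v
  have lin: "linear D" unfolding D_def using assms(1,2) by (rule linear_compose_sub)
  have sk: "mink (D v) w + mink v (D w) = 0" for v w
    using assms(3)[of v w] assms(4)[of v w] by (simp add: D_def mink_simps)
  have D0: "D a = 0" "D b = 0" using assms(7,8) by (auto simp: D_def)
  have "dim {a,b} = 2" using dim_eq_card_independent[OF assms(5)] assms(6) by simp
  then have "span {a,b} \<noteq> UNIV" using dim_span[of "{a,b}"] dim_UNIV[where 'a = "real^3"] by force
  then obtain c where c: "c \<notin> span {a,b}" by blast
  have ind: "independent {c,a,b}" using c assms(5) by (rule independent_insertI)
  have "a \<in> span {a,b}" "b \<in> span {a,b}" by (auto intro: span_base)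
  then have card: "card {c,a,b} = 3" using c assms(6) by (auto simp: card_insert_if)
  \<comment> \<open>By skewness the values of \<open>D\<close> are orthogonal to its kernel. For a
    third vector \<open>c\<close>, also \<open>mink (D c) c = 0\<close>, so \<open>D c\<close> is
    orthogonal to a basis; then every value of \<open>D\<close> is orthogonal to \<open>c\<close> as
    well.\<close>
  have z: "mink (D v) a = 0" "mink (D v) b = 0" for v
    using sk[of v a] sk[of v b] D0 by (auto simp: mink_simps)
  have "D c = 0"
    by (rule mink_vanishes_independent[OF ind card])
      (use z[of c] sk[of c c] mink_commute[of c "D c"] in auto)
  have "D v = 0" for v
  proof -
    have "mink (D v) x = 0" if "x \<in> {c,a,b}" for x
      using that z[of v] sk[of v c] \<open>D c = 0\<close> by (auto simp: mink_simps)
    then show ?thesis by (rule mink_vanishes_independent[OF ind card])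
  qed
  then show ?thesis by (simp add: D_def fun_eq_iff)
qed

context spacelike_complex
begin

text \<open>The spacelike plane of a cell cannot pass through the origin, for it contains timelike
  position vectors. Adding the origin therefore raises the dimension to 3.\<close>

lemma span_cell:
  assumes timelike: "\<And>y. mink (\<phi> y) (\<phi> y) < 0" and K: "K \<in> \<C>"
  shows "span (\<phi> ` K) = UNIV"
proof -
  obtain H where H: "spacelike_plane H" "\<phi> ` K \<subseteq> H" using cell_plane[OF K] by blast
  have "K \<noteq> {}" using cell_dim[OF K] by auto
  have "0 \<notin> H"
  proof
    assume "0 \<in> H"
    obtain x where "x \<in> K" using \<open>K \<noteq> {}\<close> by blast
    then have "\<phi> x \<in> H" "\<phi> x \<noteq> 0" using H timelike[of x] by (auto simp: mink_simps)
    then have "mink (\<phi> x - 0) (\<phi> x - 0) > 0" using H(1) \<open>0 \<in> H\<close> unfolding spacelike_plane_def by blast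
    then show False using timelike[of x] by simp
  qed
  moreover have "affine hull (\<phi> ` K) \<subseteq> H" using H by (intro hull_minimal) (auto simp: spacelike_plane_def)
  ultimately have "0 \<notin> affine hull (\<phi> ` K)" by blast
  then have "aff_dim (insert 0 (\<phi> ` K)) = 3" using cell_dim[OF K] by (simp add: aff_dim_insert)
  then have "dim (insert 0 (\<phi> ` K)) = 3" using aff_dim_zero[of "insert 0 (\<phi> ` K)"] by (simp add: hull_inc)
  then have "dim (\<phi> ` K) = 3" by (simp add: dim_insert span_zero)
  then show "span (\<phi> ` K) = UNIV" by (simp add: dim_eq_full[symmetric])
qed

lemma span_surface:
  assumes "\<And>y. mink (\<phi> y) (\<phi> y) < 0"
  shows "span (range \<phi>) = UNIV"
proof -
  obtain K where K: "K \<in> \<C>" using star_nbhd by blast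
  have "span (\<phi> ` K) \<subseteq> span (range \<phi>)" by (intro span_mono) blast
  then show ?thesis using span_cell[OF assms K] by blast
qed

text \<open>Since \<open>mink (F y) (\<phi> y) = 0\<close>, the isometry condition polarises to
  skewness on pairs of points of the cell. The map defined on a basis made of such points is then
  skew, and nondegeneracy makes it agree with \<open>F\<close> on the remaining points.\<close>

lemma cell_rotation:
  assumes iso: "\<And>K a b. K \<in> \<C> \<Longrightarrow> a \<in> K \<Longrightarrow> b \<in> K \<Longrightarrow> mink (F a - F b) (\<phi> a - \<phi> b) = 0"
    and zero: "\<And>y. mink (F y) (\<phi> y) = 0" and timelike: "\<And>y. mink (\<phi> y) (\<phi> y) < 0" and K: "K \<in> \<C>"
  shows "\<exists>A. linear A \<and> (\<forall>v w. mink (A v) w + mink v (A w) = 0) \<and> (\<forall>x\<in>K. F x = A (\<phi> x))"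
proof -
  have pair: "mink (F x) (\<phi> y) + mink (\<phi> x) (F y) = 0" if "x \<in> K" "y \<in> K" for x y
    using iso[OF K that] zero[of x] zero[of y] mink_commute[of "\<phi> x" "F y"] by (simp add: mink_simps)
  have span: "span (\<phi> ` K) = UNIV" by (rule span_cell[OF timelike K])
  obtain B where B: "B \<subseteq> \<phi> ` K" "independent B" "\<phi> ` K \<subseteq> span B" using basis_exists[of "\<phi> ` K"] by metis
  have spanB: "span B = UNIV" using span span_mono[OF B(3)] unfolding span_span by blast
  obtain A where A: "linear A" "\<And>b. b \<in> B \<Longrightarrow> A b = F (inv_into UNIV \<phi> b)"
    using linear_independent_extend[OF B(2), of "\<lambda>b. F (inv_into UNIV \<phi> b)"] by blast
  have AB: "A (\<phi> x) = F x" if "\<phi> x \<in> B" for x using A(2)[OF that] inj_phi by simp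
  have BK: "\<exists>x\<in>K. b = \<phi> x" if "b \<in> B" for b using B(1) that by auto
  have sk1: "mink (A v) b + mink v (A b) = 0" if bB: "b \<in> B" for v b
  proof -
    have "v \<in> span B" using spanB by simp
    then show ?thesis
    proof (induction rule: span_induct_alt)
      case base then show ?case using linear_0[OF A(1)] by (simp add: mink_simps)
    next
      case (step c x y)
      obtain p where p: "p \<in> K" "x = \<phi> p" using BK[OF step(1)] by blast
      obtain q where q: "q \<in> K" "b = \<phi> q" using BK[OF bB] by blast
      have "A x = F p" "A b = F q" using AB step(1) bB p q by auto
      then have "mink (A x) b + mink x (A b) = 0" using pair[OF p(1) q(1)] p(2) q(2) by simp
      then have "c * (mink (A x) b + mink x (A b)) = 0" by simp
      then show ?case using step(2) linear_add[OF A(1)] linear_cmul[OF A(1)] by (simp add: mink_simps algebra_simps)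
    qed
  qed
  have sk: "mink (A v) w + mink v (A w) = 0" for v w
  proof -
    have "w \<in> span B" using spanB by simp
    then show ?thesis
    proof (induction rule: span_induct_alt)
      case base then show ?case using linear_0[OF A(1)] by (simp add: mink_simps)
    next
      case (step c x y)
      have "c * (mink (A v) x + mink v (A x)) = 0" using sk1[OF step(1), of v] by simp
      then show ?case using step(2) linear_add[OF A(1)] linear_cmul[OF A(1)] by (simp add: mink_simps algebra_simps)
    qed
  qed
  have "F x = A (\<phi> x)" if x: "x \<in> K" for x
  proof -
    have "mink (F x - A (\<phi> x)) w = 0" for w
    proof -
      have "w \<in> span B" using spanB by simp
      then show ?thesis
      proof (induction rule: span_induct_alt)
        case base then show ?case by (simp add: mink_simps)
      next
        case (step c b y)
        obtain q where q: "q \<in> K" "b = \<phi> q" using BK[OF step(1)] by blast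
        then have "A b = F q" using AB step(1) by simp
        then have "mink (F x - A (\<phi> x)) b = 0" using pair[OF x q(1)] sk[of "\<phi> x" b] q(2) by (simp add: mink_simps)
        then show ?case using step(2) by (simp add: mink_simps)
      qed
    qed
    then show ?thesis using mink_nondegenerate by fastforce
  qed
  then show ?thesis using A(1) sk by blast
qed

text \<open>If the line through the two points met the origin, their spacelike difference would be a
  multiple of a timelike vector.\<close>

lemma cell_chord_independent:
  assumes timelike: "\<And>y. mink (\<phi> y) (\<phi> y) < 0" and "K \<in> \<C>" "x \<in> K" "y \<in> K" "x \<noteq> y"
  shows "independent {\<phi> x, \<phi> y}"
proof -
  have pos: "mink (\<phi> x - \<phi> y) (\<phi> x - \<phi> y) > 0" by (rule same_cell_spacelike[OF assms(2-5)])
  have "\<phi> x \<noteq> c *\<^sub>R \<phi> y" for c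
  proof
    assume "\<phi> x = c *\<^sub>R \<phi> y"
    then have "\<phi> x - \<phi> y = (c - 1) *\<^sub>R \<phi> y" by (simp add: algebra_simps)
    then have "mink (\<phi> x - \<phi> y) (\<phi> x - \<phi> y) = (c - 1)\<^sup>2 * mink (\<phi> y) (\<phi> y)"
      by (simp only: mink_simps) (simp add: power2_eq_square)
    also have "\<dots> \<le> 0" using timelike[of y] by (simp add: mult_nonneg_nonpos)
    finally show False using pos by simp
  qed
  moreover have "\<phi> y \<noteq> 0" "\<phi> x \<noteq> \<phi> y" using timelike[of y] pos by (auto simp: mink_simps)
  ultimately show ?thesis by (simp add: independent_insert) (auto simp: span_singleton)
qed

lemma locally_rotation:
  assumes iso: "\<And>K a b. K \<in> \<C> \<Longrightarrow> a \<in> K \<Longrightarrow> b \<in> K \<Longrightarrow> mink (F a - F b) (\<phi> a - \<phi> b) = 0"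
    and zero: "\<And>y. mink (F y) (\<phi> y) = 0" and timelike: "\<And>y. mink (\<phi> y) (\<phi> y) < 0"
  shows "\<exists>A W. linear A \<and> (\<forall>v w. mink (A v) w + mink v (A w) = 0) \<and> open W \<and> x \<in> W \<and> (\<forall>y\<in>W. F y = A (\<phi> y))"
proof -
  obtain N \<theta> z k r where fan: "fan (axis 1 1) (axis 2 1) x N \<theta> z k r" using fan_exists[OF standard_frame] by blast
  note f = fanD[OF fan]
  have "\<exists>A. linear A \<and> (\<forall>v w. mink (A v) w + mink v (A w) = 0) \<and> (\<forall>y\<in>k j. F y = A (\<phi> y))" for j
    by (rule cell_rotation[OF _ zero timelike f(8)]) (rule iso)
  then obtain A where A: "\<And>j. linear (A j)" "\<And>j v w. mink (A j v) w + mink v (A j w) = 0"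
    "\<And>j y. y \<in> k j \<Longrightarrow> F y = A j (\<phi> y)" by metis
  have "A (Suc j) = A j" for j
  proof (rule mink_skew_unique[OF A(1) A(1) A(2) A(2)])
    have "z (Suc j) \<noteq> x" using fan_independent(1)[OF fan, of j] dependent_zero[of "{\<phi> (z j) - \<phi> x, \<phi> (z (Suc j)) - \<phi> x}"] by auto
    then show "independent {\<phi> x, \<phi> (z (Suc j))}" "\<phi> x \<noteq> \<phi> (z (Suc j))"
      using cell_chord_independent[OF timelike f(8) f(9) f(11)] inj_phi by (auto dest: injD)
    show "A (Suc j) (\<phi> x) = A j (\<phi> x)" using A(3) f(9) by metis
    show "A (Suc j) (\<phi> (z (Suc j))) = A j (\<phi> (z (Suc j)))" using A(3) f(10) f(11) by metis
  qed
  then have "A j = A 0" for j by (induction j) auto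
  then have eq: "F y = A 0 (\<phi> y)" if "y \<in> (\<Union>j. k j)" for y using A(3) that by (metis UN_E)
  obtain W where W: "open W" "x \<in> W" "W \<subseteq> (\<Union>j. k j)" using f(13) by blast
  show ?thesis
  proof (intro exI[of _ "A 0"] exI[of _ W] conjI)
    show "\<forall>y\<in>W. F y = A 0 (\<phi> y)" using W(3) eq by blast
  qed (simp_all add: A(1,2) W)
qed

lemma global_rotation:
  assumes iso: "\<And>K a b. K \<in> \<C> \<Longrightarrow> a \<in> K \<Longrightarrow> b \<in> K \<Longrightarrow> mink (F a - F b) (\<phi> a - \<phi> b) = 0"
    and zero: "\<And>y. mink (F y) (\<phi> y) = 0" and timelike: "\<And>y. mink (\<phi> y) (\<phi> y) < 0"
  shows "\<exists>A. linear A \<and> (\<forall>v w. mink (A v) w + mink v (A w) = 0) \<and> (\<forall>y. F y = A (\<phi> y))"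
proof -
  have "\<forall>x. \<exists>A W. linear A \<and> (\<forall>v w. mink (A v) w + mink v (A w) = 0) \<and> open W \<and> x \<in> W \<and> (\<forall>y\<in>W. F y = A (\<phi> y))"
    by (intro allI locally_rotation[OF _ zero timelike]) (rule iso)
  then obtain A W where A: "\<And>x. linear (A x)" "\<And>x v w. mink (A x v) w + mink v (A x w) = 0"
    "\<And>x. open (W x)" "\<And>x. x \<in> W x" "\<And>x y. y \<in> W x \<Longrightarrow> F y = A x (\<phi> y)" by metis
  have same: "A y = A x" if "y \<in> W x" for x y
  proof -
    \<comment> \<open>Intersecting with the star of \<open>y\<close> puts the second point into a
      common cell with \<open>y\<close>, which makes the two position vectors independent.\<close>
    let ?U = "W x \<inter> W y \<inter> interior (star y)"
    have U: "open ?U" "y \<in> ?U" using A(3,4) that interior_star by auto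
    obtain R where R: "R > 0" "\<And>w. norm w < R \<Longrightarrow> \<exists>u\<in>?U. proj2 (axis 1 1) (axis 2 1) (\<phi> u - \<phi> y) = w"
      using proj_ball[OF standard_frame U] by metis
    obtain w :: "real^2" where w: "norm w = R/2" using R(1) vector_choose_size[of "R/2"] by auto
    then have "norm w < R" using R(1) by simp
    then obtain u where u: "u \<in> ?U" "proj2 (axis 1 1) (axis 2 1) (\<phi> u - \<phi> y) = w" using R(2) by metis
    have "u \<noteq> y" using u(2) w R(1) proj2_0 by auto
    obtain K where K: "K \<in> \<C>" "y \<in> K" "u \<in> K" using u(1) interior_subset[of "star y"] by (auto simp: star_def)
    show ?thesis
    proof (rule mink_skew_unique[OF A(1) A(1) A(2) A(2)])
      show "independent {\<phi> y, \<phi> u}" "\<phi> y \<noteq> \<phi> u"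
        using cell_chord_independent[OF timelike K] \<open>u \<noteq> y\<close> inj_phi by (auto dest: injD)
      show "A y (\<phi> y) = A x (\<phi> y)" "A y (\<phi> u) = A x (\<phi> u)" using A(5) U(2) u(1) by (metis IntE)+
    qed
  qed
  obtain x0 :: 'a where True by blast
  have "open {x. A x = A x0}" "open {x. A x \<noteq> A x0}"
    by (subst open_subopen, use A(3,4) same in \<open>simp, metis (mono_tags) mem_Collect_eq subsetI\<close>)+
  then have "(\<forall>x. A x = A x0) \<or> (\<forall>x. A x \<noteq> A x0)"
    using connectedD[OF connected_UNIV, of "{x. A x = A x0}" "{x. A x \<noteq> A x0}"] by blast
  then have "A x = A x0" for x by blast
  then have "F y = A x0 (\<phi> y)" for y using A(5)[OF A(4)] by metis
  then show ?thesis using A(1,2) by (intro exI[of _ "A x0"]) simp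
qed

end

section \<open>Lengths of polygonal paths\<close>

lemma mlen_scale: "mlen (c *\<^sub>R v) = \<bar>c\<bar> * mlen v"
  by (simp add: mlen_def mink_simps mult.assoc[symmetric] real_sqrt_mult flip: power2_eq_square)

lemma continuous_mlen: "continuous_on S f \<Longrightarrow> continuous_on S (\<lambda>x. mlen (f x))"
  unfolding mlen_def by (intro continuous_intros mink.continuous_on)

definition polygonal :: "('a \<Rightarrow> real^3) \<Rightarrow> nat \<Rightarrow> (nat \<Rightarrow> 'a) \<Rightarrow> bool" where
  "polygonal \<Phi> n z \<longleftrightarrow> (\<forall>i<n. closed_segment (\<Phi> (z i)) (\<Phi> (z (Suc i))) \<subseteq> range \<Phi>)"

lemma polygonal_trans:
  assumes "polygonal \<Phi> n z" "polygonal \<Phi> m w" "z n = w 0"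
  shows "\<exists>v. polygonal \<Phi> (n + m) v \<and> v 0 = z 0 \<and> v (n + m) = w m"
proof (intro exI conjI)
  define v where "v i = (if i \<le> n then z i else w (i - n))" for i
  have v: "v i = w (i - n)" if "n \<le> i" for i using that assms(3) by (cases "i = n") (auto simp: v_def)
  show "polygonal \<Phi> (n + m) v"
    unfolding polygonal_def
  proof (intro allI impI)
    fix i assume i: "i < n + m"
    show "closed_segment (\<Phi> (v i)) (\<Phi> (v (Suc i))) \<subseteq> range \<Phi>"
    proof (cases "i < n")
      case True then show ?thesis using assms(1) unfolding polygonal_def v_def by auto
    next
      case False then show ?thesis
        using assms(2) i v[of i] v[of "Suc i"] unfolding polygonal_def by (auto simp: Suc_diff_le)
    qed
  qed
  show "v 0 = z 0" "v (n + m) = w m" using v[of "n + m"] by (auto simp: v_def)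
qed

lemma polygonal_segment:
  assumes "closed_segment (\<Phi> x) (\<Phi> y) \<subseteq> range \<Phi>"
  shows "\<exists>z. polygonal \<Phi> 1 z \<and> z 0 = x \<and> z 1 = y"
  by (rule exI[of _ "\<lambda>i. if i = 0 then x else y"]) (use assms in \<open>auto simp: polygonal_def\<close>)

definition plen :: "('a \<Rightarrow> real^3) \<Rightarrow> nat \<Rightarrow> (nat \<Rightarrow> 'a) \<Rightarrow> real" where
  "plen \<Phi> n z = (\<Sum>i<n. mlen (\<Phi> (z (Suc i)) - \<Phi> (z i)))"

lemma induced_dist_cover_eq:
  "induced_dist_cover \<Phi> x y = Inf {plen \<Phi> n z | n z. z 0 = x \<and> z n = y \<and> polygonal \<Phi> n z}"
  unfolding induced_dist_cover_def plen_def polygonal_def mlen_def ..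

lemma plen_nonneg:
  assumes "\<And>u v. mink (\<Phi> u - \<Phi> v) (\<Phi> u - \<Phi> v) \<ge> 0"
  shows "plen \<Phi> n z \<ge> 0"
  unfolding plen_def mlen_def by (intro sum_nonneg real_sqrt_ge_zero assms)

lemma induced_dist_le:
  assumes nn: "\<And>u v. mink (\<Phi> u - \<Phi> v) (\<Phi> u - \<Phi> v) \<ge> 0"
    and seg: "closed_segment (\<Phi> x) (\<Phi> y) \<subseteq> range \<Phi>"
  shows "induced_dist p \<Phi> (p x) (p y) \<le> mlen (\<Phi> y - \<Phi> x)"
proof -
  obtain z where z: "polygonal \<Phi> 1 z" "z 0 = x" "z 1 = y" using polygonal_segment[OF seg] by blast
  have "induced_dist_cover \<Phi> x y \<le> plen \<Phi> 1 z"
    unfolding induced_dist_cover_eq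
    by (rule cInf_lower) (use z plen_nonneg[OF nn] in \<open>auto intro!: bdd_belowI[of _ 0]\<close>)
  also have "\<dots> = mlen (\<Phi> y - \<Phi> x)" using z by (simp add: plen_def)
  finally have 1: "induced_dist_cover \<Phi> x y \<le> mlen (\<Phi> y - \<Phi> x)" .
  \<comment> \<open>The infimum of the empty set is an unspecified real; this common lower bound
    allows for it, so that the outer infimum is bounded below without knowing that paths
    exist.\<close>
  have lb: "min 0 (Inf {}) \<le> induced_dist_cover \<Phi> u v" for u v
  proof (cases "{plen \<Phi> n z | n z. z 0 = u \<and> z n = v \<and> polygonal \<Phi> n z} = {}")
    case True then show ?thesis unfolding induced_dist_cover_eq True by simp
  next
    case False
    then have "0 \<le> induced_dist_cover \<Phi> u v"
      unfolding induced_dist_cover_eq using plen_nonneg[OF nn] by (intro cInf_greatest) auto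
    then show ?thesis by simp
  qed
  have "induced_dist p \<Phi> (p x) (p y) \<le> induced_dist_cover \<Phi> x y"
    unfolding induced_dist_def by (rule cInf_lower) (use lb in \<open>auto intro!: bdd_belowI[of _ "min 0 (Inf {})"]\<close>)
  with 1 show ?thesis by simp
qed

lemma Bolzano_constant:
  fixes f :: "real \<Rightarrow> 'b"
  assumes "\<And>s. 0 \<le> s \<Longrightarrow> s \<le> 1 \<Longrightarrow> \<exists>d>0. \<forall>s'. 0 \<le> s' \<and> s' \<le> 1 \<and> \<bar>s' - s\<bar> < d \<longrightarrow> f s' = f s"
  shows "f 0 = f 1"
proof -
  have "0 \<le> (0::real) \<and> (1::real) \<le> 1 \<longrightarrow> f 0 = f 1"
  proof (rule Bolzano[where P = "\<lambda>a b. 0 \<le> a \<and> b \<le> 1 \<longrightarrow> f a = f b"])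
    fix s :: real assume "0 \<le> s" "s \<le> 1"
    then obtain d where d: "d > 0" "\<And>s'. 0 \<le> s' \<Longrightarrow> s' \<le> 1 \<Longrightarrow> \<bar>s' - s\<bar> < d \<Longrightarrow> f s' = f s"
      using assms[of s] by blast
    show "\<exists>d>0. \<forall>a b. a \<le> s \<and> s \<le> b \<and> b - a < d \<longrightarrow> 0 \<le> a \<and> b \<le> 1 \<longrightarrow> f a = f b"
    proof (intro exI[of _ d] conjI allI impI d(1))
      fix a b assume ab: "a \<le> s \<and> s \<le> b \<and> b - a < d" "0 \<le> a \<and> b \<le> 1"
      have "f a = f s" "f b = f s" using ab by (auto intro!: d(2))
      then show "f a = f b" by simp
    qed
  qed auto
  then show ?thesis by simp
qed

lemma in_span_of_cross3_orthogonal: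
  assumes "independent {a, b}" "a \<noteq> b" "D \<bullet> cross3 a b = 0"
  shows "D \<in> span {a, b}"
proof -
  let ?S = "{x. cross3 a b \<bullet> x = 0}"
  have "cross3 a b \<noteq> 0"
  proof
    assume "cross3 a b = 0"
    then have "collinear {0, a, b}" by (simp add: cross_eq_0)
    moreover have "a \<noteq> 0" "b \<noteq> 0" using assms(1) dependent_zero by blast+
    ultimately obtain c where "b = c *\<^sub>R a" by (auto simp: collinear_lemma)
    then have "b \<in> span {a}" by (simp add: span_base span_scale)
    moreover have "independent (insert b {a})" using assms(1) by (simp add: insert_commute)
    ultimately show False using assms(2) by (auto simp: independent_insert)
  qed
  then have "dim ?S = 2" by (simp add: dim_hyperplane)
  then have "?S \<subseteq> span {a, b}"
    using assms by (intro card_ge_dim_independent) (auto simp: dot_cross_self inner_commute)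
  then show ?thesis using assms(3) by (auto simp: inner_commute)
qed

lemma bounded_bilinear_cross3: "bounded_bilinear cross3"
proof -
  have "bilinear cross3"
    unfolding bilinear_def by (auto intro!: linearI simp: cross_add_left cross_add_right cross_mult_left cross_mult_right)
  then show ?thesis by (simp add: bilinear_conv_bounded_bilinear)
qed

section \<open>The induced distance near a point\<close>

context convex_spacelike_complex
begin

text \<open>A support plane at a relative interior point of the cell contains the whole cell, hence
  is its plane \<open>H\<close>. Both ends of the segment lie on the same side of \<open>H\<close>
  and an inner point lies on it, so both ends do.\<close>

lemma segment_in_plane:
  assumes "K \<in> \<C>" "m \<in> K" "\<phi> m = (1 - s) *\<^sub>R \<phi> a + s *\<^sub>R \<phi> b" "0 < s" "s < 1"
    and H: "spacelike_plane H" "\<phi> ` K \<subseteq> H"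
  shows "\<phi> a \<in> H" "\<phi> b \<in> H"
proof -
  let ?Q = "\<phi> ` K"
  have "?Q \<noteq> {}" using assms by auto
  then obtain i where i: "i \<in> K" "\<phi> i \<in> rel_interior ?Q"
    using rel_interior_eq_empty[OF convex_cell[OF assms(1)]] rel_interior_subset[of ?Q] by blast
  obtain t where t: "t \<noteq> 0" "\<And>y. y \<in> B \<Longrightarrow> t \<bullet> \<phi> i \<le> t \<bullet> y" using support_exists[of i] by blast
  have const: "t \<bullet> \<phi> y = t \<bullet> \<phi> i" if y: "y \<in> K" for y
  proof -
    obtain e where e: "e > 1" "(1 - e) *\<^sub>R \<phi> y + e *\<^sub>R \<phi> i \<in> ?Q"
      using convex_rel_interior_if[OF convex_cell[OF assms(1)] i(2)] y hull_inc[of "\<phi> y" ?Q] by blast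
    have "t \<bullet> \<phi> i \<le> t \<bullet> ((1 - e) *\<^sub>R \<phi> y + e *\<^sub>R \<phi> i)" using e(2) surface_subset t(2) by auto
    then have "(e - 1) * (t \<bullet> \<phi> y) \<le> (e - 1) * (t \<bullet> \<phi> i)" by (simp add: inner_add_right algebra_simps)
    then have "t \<bullet> \<phi> y \<le> t \<bullet> \<phi> i" using e(1) by simp
    then show ?thesis using t(2)[OF surface_subset[of y]] by simp
  qed
  let ?P = "{v. t \<bullet> v = t \<bullet> \<phi> i}"
  have P: "affine ?P" "aff_dim ?P = 2" using t(1) by (auto simp: affine_hyperplane aff_dim_hyperplane)
  have h: "affine hull ?Q \<subseteq> ?P" using const by (intro hull_minimal) (auto simp: affine_hyperplane)
  have h2: "affine hull ?Q \<subseteq> H" using H by (intro hull_minimal) (auto simp: spacelike_plane_def)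
  have "affine hull ?Q = ?P"
    by (rule affine_dim_equal) (use P h cell_dim[OF assms(1)] \<open>?Q \<noteq> {}\<close> in auto)
  moreover have "affine hull ?Q = H"
    by (rule affine_dim_equal) (use H h2 cell_dim[OF assms(1)] \<open>?Q \<noteq> {}\<close> in \<open>auto simp: spacelike_plane_def\<close>)
  ultimately have HP: "H = ?P" by simp
  have a: "t \<bullet> \<phi> i \<le> t \<bullet> \<phi> a" "t \<bullet> \<phi> i \<le> t \<bullet> \<phi> b" using t(2) surface_subset by auto
  have e: "(1 - s) * (t \<bullet> \<phi> a - t \<bullet> \<phi> i) + s * (t \<bullet> \<phi> b - t \<bullet> \<phi> i) = 0"
    using const[OF assms(2)] unfolding assms(3) by (simp add: inner_add_right algebra_simps)
  have nn: "(1 - s) * (t \<bullet> \<phi> a - t \<bullet> \<phi> i) \<ge> 0" "s * (t \<bullet> \<phi> b - t \<bullet> \<phi> i) \<ge> 0"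
    using a assms(4,5) by auto
  then have "(1 - s) * (t \<bullet> \<phi> a - t \<bullet> \<phi> i) = 0" "s * (t \<bullet> \<phi> b - t \<bullet> \<phi> i) = 0" using e by linarith+
  then show "\<phi> a \<in> H" "\<phi> b \<in> H" unfolding HP using assms(4,5) by auto
qed

lemma mlen_chord_pos: "K \<in> \<C> \<Longrightarrow> x \<in> K \<Longrightarrow> y \<in> K \<Longrightarrow> x \<noteq> y \<Longrightarrow> mlen (\<phi> y - \<phi> x) > 0"
  using same_cell_spacelike[of K y x] by (simp add: mlen_def)

text \<open>Chord lengths from \<open>x\<close> are positive and continuous on the compact part of
  the star outside \<open>U\<close>, so they have a positive minimum there.\<close>

lemma star_radius:
  assumes "open U" "x \<in> U"
  shows "\<exists>\<epsilon>>0. \<forall>z\<in>star x. mlen (\<phi> z - \<phi> x) < \<epsilon> \<longrightarrow> z \<in> U"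
proof (cases "star x - U = {}")
  case True then show ?thesis by (intro exI[of _ 1]) auto
next
  case False
  have c: "compact (star x - U)" using compact_star assms(1) by (simp add: compact_diff)
  have cont: "continuous_on (star x - U) (\<lambda>z. mlen (\<phi> z - \<phi> x))"
    by (intro continuous_mlen continuous_intros continuous_on_subset[OF cont_phi]) auto
  obtain w where w: "w \<in> star x - U" "\<And>z. z \<in> star x - U \<Longrightarrow> mlen (\<phi> w - \<phi> x) \<le> mlen (\<phi> z - \<phi> x)"
    using continuous_attains_inf[OF c False cont] by blast
  have "mlen (\<phi> w - \<phi> x) > 0" using w(1) assms(2) mlen_chord_pos by (auto simp: star_def)
  then show ?thesis using w(2) by (intro exI[of _ "mlen (\<phi> w - \<phi> x)"]) force
qed

text \<open>A midpoint in the star forces both ends into the plane of a cell through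
  \<open>x\<close>, where the form is positive and the triangle inequality holds.\<close>

lemma star_triangle:
  assumes "closed_segment (\<phi> a) (\<phi> b) \<subseteq> range \<phi>" "\<phi> m = (1/2) *\<^sub>R \<phi> a + (1/2) *\<^sub>R \<phi> b" "m \<in> star x"
  shows "mlen (\<phi> b - \<phi> x) \<le> mlen (\<phi> a - \<phi> x) + mlen (\<phi> b - \<phi> a)"
proof -
  obtain K where K: "K \<in> \<C>" "x \<in> K" "m \<in> K" using assms(3) by (auto simp: star_def)
  obtain H where H: "spacelike_plane H" "\<phi> ` K \<subseteq> H" using cell_plane[OF K(1)] by blast
  have "\<phi> a \<in> H" "\<phi> b \<in> H"
    using segment_in_plane[OF K(1,3), of "1/2" a b] assms(2) H by auto
  then show ?thesis using spacelike_plane_triangle[OF H(1)] H(2) K(2) by blast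
qed

text \<open>The chord length from \<open>x\<close>, truncated at \<open>\<epsilon>\<close>.
  Truncation makes it meaningful on the whole surface, and it grows along a segment by no more than
  the length of that segment.\<close>

definition sdist :: "real \<Rightarrow> 'a \<Rightarrow> 'a \<Rightarrow> real" where
  "sdist \<epsilon> x z = (if z \<in> star x then min \<epsilon> (mlen (\<phi> z - \<phi> x)) else \<epsilon>)"

text \<open>A segment that stays in the star is handled by \<open>star_triangle\<close>. Otherwise
  it reaches a last point \<open>c\<close> before leaving; this point is not interior to the star,
  hence already at length at least \<open>\<epsilon>\<close>, and the part up to \<open>c\<close> is
  handled in the same way.\<close>

lemma sdist_step:
  assumes \<epsilon>: "0 < \<epsilon>" "\<And>z. z \<in> star x \<Longrightarrow> mlen (\<phi> z - \<phi> x) < \<epsilon> \<Longrightarrow> z \<in> interior (star x)"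
    and seg: "closed_segment (\<phi> a) (\<phi> b) \<subseteq> range \<phi>"
  shows "sdist \<epsilon> x b \<le> sdist \<epsilon> x a + mlen (\<phi> b - \<phi> a)"
proof -
  have nn: "mlen (\<phi> u - \<phi> v) \<ge> 0" for u v
    unfolding mlen_def using not_timelike_diff[OF proj_inj, of "\<phi> u" "\<phi> v"] by simp
  have le: "sdist \<epsilon> x b \<le> \<epsilon>" by (simp add: sdist_def)
  show ?thesis
  proof (cases "a \<in> star x \<and> mlen (\<phi> a - \<phi> x) < \<epsilon>")
    case False
    then have "sdist \<epsilon> x a = \<epsilon>" by (auto simp: sdist_def)
    then show ?thesis using le nn[of b a] by simp
  next
    case True
    then have Da: "sdist \<epsilon> x a = mlen (\<phi> a - \<phi> x)" by (simp add: sdist_def)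
    define \<gamma> where "\<gamma> s = (1 - s) *\<^sub>R \<phi> a + s *\<^sub>R \<phi> b" for s
    have \<gamma>seg: "\<gamma> s \<in> closed_segment (\<phi> a) (\<phi> b)" if "0 \<le> s" "s \<le> 1" for s
      unfolding \<gamma>_def closed_segment_def using that by auto
    have \<gamma>: "\<exists>u. \<phi> u = \<gamma> s" if "0 \<le> s" "s \<le> 1" for s
      using \<gamma>seg[OF that] seg by (metis imageE subsetD)
    have \<gamma>cont: "continuous_on UNIV \<gamma>" unfolding \<gamma>_def by (intro continuous_intros)
    define S where "S = \<phi> ` star x"
    have S: "closed S"
      unfolding S_def by (intro compact_imp_closed compact_continuous_image compact_star continuous_on_subset[OF cont_phi]) auto
    show ?thesis
    proof (cases "\<exists>s. 0 \<le> s \<and> s \<le> 1 \<and> \<gamma> s \<notin> S")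
      case False
      then have all: "\<gamma> s \<in> S" if "0 \<le> s" "s \<le> 1" for s using that by blast
      obtain m where m: "m \<in> star x" "\<phi> m = \<gamma> (1/2)" using all[of "1/2"] by (auto simp: S_def)
      have "\<phi> b \<in> S" using all[of 1] by (simp add: \<gamma>_def)
      then have "b \<in> star x" using inj_phi by (auto simp: S_def inj_image_mem_iff)
      moreover have "mlen (\<phi> b - \<phi> x) \<le> mlen (\<phi> a - \<phi> x) + mlen (\<phi> b - \<phi> a)"
        by (rule star_triangle[OF seg _ m(1)]) (simp add: m(2) \<gamma>_def)
      ultimately show ?thesis using Da by (simp add: sdist_def)
    next
      case True
      define T where "T = {s. 0 \<le> s \<and> s \<le> 1 \<and> \<gamma> s \<notin> S}"
      have T: "T \<noteq> {}" "bdd_below T" using True by (auto simp: T_def intro!: bdd_belowI[of _ 0])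
      \<comment> \<open>The parameter at which the segment first leaves the star; as the star is
        closed, the point itself still belongs to it.\<close>
      define s where "s = Inf T"
      obtain s1 where s1: "s1 \<in> T" using T(1) by blast
      have s01: "0 \<le> s" "s \<le> 1"
      proof -
        show "0 \<le> s" unfolding s_def by (rule cInf_greatest[OF T(1)]) (simp add: T_def)
        have "s \<le> s1" unfolding s_def by (rule cInf_lower[OF s1 T(2)])
        then show "s \<le> 1" using s1 by (simp add: T_def)
      qed
      have below: "\<gamma> s' \<in> S" if "0 \<le> s'" "s' < s" for s'
        using that s01 cInf_lower[OF _ T(2), of s'] unfolding s_def[symmetric] by (force simp: T_def)
      have aS: "\<gamma> 0 \<in> S" using \<open>a \<in> star x \<and> _\<close> by (auto simp: \<gamma>_def S_def)
      have sS: "\<gamma> s \<in> S"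
      proof (cases "s = 0")
        case True then show ?thesis using aS by simp
      next
        case False
        have "s \<in> closure {0..<s}" using False s01 by simp
        moreover have "\<gamma> ` closure {0..<s} \<subseteq> closure (\<gamma> ` {0..<s})"
          by (rule continuous_image_closure_subset[OF \<gamma>cont]) auto
        moreover have "closure (\<gamma> ` {0..<s}) \<subseteq> S" using below S by (intro closure_minimal) auto
        ultimately show ?thesis by blast
      qed
      obtain c where c: "c \<in> star x" "\<phi> c = \<gamma> s" using sS by (auto simp: S_def)
      \<comment> \<open>Were \<open>c\<close> interior, the interior of the star would cover a disc
        around its projection, and points of the segment just beyond \<open>c\<close>, having their
        projections in that disc, would still belong to the star.\<close>
      have "c \<notin> interior (star x)"
      proof
        assume ci: "c \<in> interior (star x)"
        obtain R where R: "R > 0" "\<And>w. norm w < R \<Longrightarrow> \<exists>y\<in>interior (star x). proj2 (axis 1 1) (axis 2 1) (\<phi> y - \<phi> c) = w"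
          using proj_ball[OF standard_frame open_interior ci] by metis
        have "continuous_on UNIV (\<lambda>t. norm (proj2 (axis 1 1) (axis 2 1) (\<gamma> t - \<gamma> s)))"
          by (intro continuous_intros bounded_linear.continuous_on[OF bounded_linear_proj2] \<gamma>cont)
        then have "open {t. norm (proj2 (axis 1 1) (axis 2 1) (\<gamma> t - \<gamma> s)) < R}"
          by (intro open_Collect_less continuous_on_const)
        moreover have "s \<in> {t. norm (proj2 (axis 1 1) (axis 2 1) (\<gamma> t - \<gamma> s)) < R}"
          using R(1) by (simp add: proj2_0)
        ultimately obtain \<delta> where \<delta>1: "\<delta> > 0"
          "ball s \<delta> \<subseteq> {t. norm (proj2 (axis 1 1) (axis 2 1) (\<gamma> t - \<gamma> s)) < R}"
          by (rule openE)
        have \<delta>: "norm (proj2 (axis 1 1) (axis 2 1) (\<gamma> t - \<gamma> s)) < R" if "\<bar>t - s\<bar> < \<delta>" for t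
        proof -
          have "t \<in> ball s \<delta>" using that by (simp add: dist_real_def abs_minus_commute)
          then show ?thesis using \<delta>1(2) by blast
        qed
        obtain t where t: "t \<in> T" "t < s + \<delta>" using cInf_lessD[OF T(1), of "s + \<delta>"] \<delta>1(1) by (auto simp: s_def)
        have "s \<le> t" using cInf_lower[OF t(1) T(2)] by (simp add: s_def)
        then have "norm (proj2 (axis 1 1) (axis 2 1) (\<gamma> t - \<gamma> s)) < R" using t(2) \<open>s \<le> t\<close> by (intro \<delta>) simp
        then obtain y where y: "y \<in> interior (star x)" "proj2 (axis 1 1) (axis 2 1) (\<phi> y - \<phi> c) = proj2 (axis 1 1) (axis 2 1) (\<gamma> t - \<gamma> s)"
          using R(2) by blast
        obtain u where u: "\<phi> u = \<gamma> t" using \<gamma>[of t] t(1) by (auto simp: T_def)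
        have "y = u" by (rule inj_proj_diff[OF standard_frame, of _ c]) (use y(2) in \<open>simp add: u c(2)\<close>)
        then have "\<phi> u \<in> S" using y(1) interior_subset[of "star x"] by (auto simp: S_def)
        then have "\<gamma> t \<in> S" by (simp add: u)
        then show False using t(1) by (simp add: T_def)
      qed
      then have big: "\<epsilon> \<le> mlen (\<phi> c - \<phi> x)" using \<epsilon>(2)[OF c(1)] by force
      show ?thesis
      proof (cases "s = 0")
        case True
        then have "\<phi> c = \<phi> a" using c(2) by (simp add: \<gamma>_def)
        then show ?thesis using big \<open>a \<in> star x \<and> _\<close> by simp
      next
        case False
        obtain m where m: "m \<in> star x" "\<phi> m = \<gamma> (s/2)" using below[of "s/2"] False s01 by (auto simp: S_def)
        have "mlen (\<phi> c - \<phi> x) \<le> mlen (\<phi> a - \<phi> x) + mlen (\<phi> c - \<phi> a)"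
        proof (rule star_triangle[OF _ _ m(1)])
          have "closed_segment (\<phi> a) (\<phi> c) \<subseteq> closed_segment (\<phi> a) (\<phi> b)"
            using \<gamma>seg[OF s01] c(2) by (intro closed_segment_subset) auto
          then show "closed_segment (\<phi> a) (\<phi> c) \<subseteq> range \<phi>" using seg by (rule subset_trans)
          show "\<phi> m = (1/2) *\<^sub>R \<phi> a + (1/2) *\<^sub>R \<phi> c"
            unfolding m(2) c(2) \<gamma>_def by (simp add: scaleR_diff_left scaleR_add_right scaleR_diff_right)
        qed
        also have "mlen (\<phi> c - \<phi> a) \<le> mlen (\<phi> b - \<phi> a)"
        proof -
          have "\<phi> c - \<phi> a = s *\<^sub>R (\<phi> b - \<phi> a)" by (simp add: c(2) \<gamma>_def algebra_simps)
          then have "mlen (\<phi> c - \<phi> a) = s * mlen (\<phi> b - \<phi> a)" using s01 by (simp add: mlen_scale)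
          then show ?thesis using s01 nn[of b a] by (simp add: mult_left_le_one_le)
        qed
        finally show ?thesis using big Da le by simp
      qed
    qed
  qed
qed

lemma sdist_le_plen:
  assumes \<epsilon>: "0 < \<epsilon>" "\<And>z. z \<in> star x \<Longrightarrow> mlen (\<phi> z - \<phi> x) < \<epsilon> \<Longrightarrow> z \<in> interior (star x)"
    and "polygonal \<phi> n z" "z 0 = x"
  shows "sdist \<epsilon> x (z n) \<le> plen \<phi> n z"
  using assms(3)
proof (induction n)
  case 0
  have "x \<in> star x" using interior_star interior_subset by blast
  then show ?case using \<epsilon>(1) assms(4) by (simp add: sdist_def plen_def mlen_def mink_simps)
next
  case (Suc n)
  then have "sdist \<epsilon> x (z n) \<le> plen \<phi> n z" by (simp add: polygonal_def)
  moreover have "sdist \<epsilon> x (z (Suc n)) \<le> sdist \<epsilon> x (z n) + mlen (\<phi> (z (Suc n)) - \<phi> (z n))"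
    using Suc.prems by (intro sdist_step[OF \<epsilon>]) (auto simp: polygonal_def)
  ultimately show ?case by (simp add: plen_def)
qed

lemma cell_segment_range:
  assumes "K \<in> \<C>" "x \<in> K" "y \<in> K"
  shows "closed_segment (\<phi> x) (\<phi> y) \<subseteq> range \<phi>"
proof -
  have "closed_segment (\<phi> x) (\<phi> y) \<subseteq> \<phi> ` K"
    using assms convex_cell by (intro closed_segment_subset) auto
  then show ?thesis by blast
qed

lemma polygonal_connected: "\<exists>n z. z 0 = x \<and> z n = y \<and> polygonal \<phi> n z"
proof -
  define C where "C = {y. \<exists>n z. z 0 = x \<and> z n = y \<and> polygonal \<phi> n z}"
  have ext: "v \<in> C" if uv: "u \<in> C" "closed_segment (\<phi> u) (\<phi> v) \<subseteq> range \<phi>" for u v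
  proof -
    obtain n z where z: "z 0 = x" "z n = u" "polygonal \<phi> n z" using uv(1) by (auto simp: C_def)
    obtain w where w: "polygonal \<phi> 1 w" "w 0 = u" "w 1 = v" using polygonal_segment[OF uv(2)] by blast
    show ?thesis using polygonal_trans[OF z(3) w(1)] z w unfolding C_def by fastforce
  qed
  have st: "closed_segment (\<phi> u) (\<phi> v) \<subseteq> range \<phi>" if "v \<in> interior (star u)" for u v
  proof -
    have "v \<in> star u" using that interior_subset by blast
    then show ?thesis using cell_segment_range unfolding star_def by blast
  qed
  have "open C"
    by (subst open_subopen) (use ext st interior_star in \<open>meson open_interior subsetI\<close>)
  moreover have "open (- C)"
  proof (subst open_subopen, intro ballI)
    fix u assume u: "u \<in> - C"
    have "v \<notin> C" if "v \<in> interior (star u)" for v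
      using u ext[of v u] st[OF that] by (auto simp: closed_segment_commute)
    then show "\<exists>T. open T \<and> u \<in> T \<and> T \<subseteq> - C" using interior_star[of u] open_interior by blast
  qed
  moreover have "x \<in> C" unfolding C_def polygonal_def by (auto intro!: exI[of _ 0])
  ultimately have "- C = {}" using connectedD[OF connected_UNIV, of C "- C"] by blast
  then show ?thesis unfolding C_def by blast
qed

text \<open>A polygonal path between any lifts of the two points is moved by a deck isometry so as
  to start at \<open>x\<close>, and \<open>sdist\<close> bounds its length from below. Its end is
  either close to \<open>x\<close>, where injectivity of \<open>p\<close> identifies it with
  \<open>y\<close>, or so far that the bound \<open>\<epsilon>\<close> exceeds the chord.\<close>

lemma induced_dist_eq:
  assumes deck: "\<And>x'. p x' = p x \<Longrightarrow> \<exists>\<gamma> A. surj \<gamma> \<and> \<gamma> x' = x \<and> (\<forall>u. p (\<gamma> u) = p u) \<and> linear A \<and>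
      (\<forall>v. mink (A v) (A v) = mink v v) \<and> (\<forall>u. \<phi> (\<gamma> u) = A (\<phi> u))"
    and inj: "open U" "x \<in> U" "inj_on p U"
  shows "\<exists>\<epsilon>>0. \<forall>y\<in>star x. mlen (\<phi> y - \<phi> x) < \<epsilon> \<longrightarrow> induced_dist p \<phi> (p x) (p y) = mlen (\<phi> y - \<phi> x)"
proof -
  obtain \<epsilon> where \<epsilon>: "0 < \<epsilon>" "\<And>z. z \<in> star x \<Longrightarrow> mlen (\<phi> z - \<phi> x) < \<epsilon> \<Longrightarrow> z \<in> U \<inter> interior (star x)"
    using star_radius[of "U \<inter> interior (star x)" x] inj interior_star by auto
  show ?thesis
  proof (intro exI[of _ \<epsilon>] conjI ballI impI \<epsilon>(1))
    fix y assume y: "y \<in> star x" "mlen (\<phi> y - \<phi> x) < \<epsilon>"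
    obtain K where K: "K \<in> \<C>" "x \<in> K" "y \<in> K" using y(1) by (auto simp: star_def)
    have nn: "mink (\<phi> u - \<phi> v) (\<phi> u - \<phi> v) \<ge> 0" for u v
      using not_timelike_diff[OF proj_inj, of "\<phi> u" "\<phi> v"] by simp
    have low: "mlen (\<phi> y - \<phi> x) \<le> plen \<phi> n z" if z: "p (z 0) = p x" "p (z n) = p y" "polygonal \<phi> n z" for n z
    proof -
      obtain \<gamma> A where \<gamma>: "surj \<gamma>" "\<gamma> (z 0) = x" "\<And>u. p (\<gamma> u) = p u" "linear A"
        "\<And>v. mink (A v) (A v) = mink v v" "\<And>u. \<phi> (\<gamma> u) = A (\<phi> u)"
        using deck[OF z(1)] by blast
      have "plen \<phi> n (\<gamma> \<circ> z) = plen \<phi> n z"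
        unfolding plen_def mlen_def by (simp add: \<gamma>(6) linear_diff[OF \<gamma>(4), symmetric] \<gamma>(5))
      moreover have "polygonal \<phi> n (\<gamma> \<circ> z)"
        unfolding polygonal_def
      proof (intro allI impI)
        fix i assume "i < n"
        then have "A ` closed_segment (\<phi> (z i)) (\<phi> (z (Suc i))) \<subseteq> A ` range \<phi>"
          using z(3) by (intro image_mono) (auto simp: polygonal_def)
        also have "\<dots> \<subseteq> range \<phi>" using \<gamma>(6) by (metis (no_types, lifting) image_subsetI range_eqI rangeE)
        finally show "closed_segment (\<phi> ((\<gamma> \<circ> z) i)) (\<phi> ((\<gamma> \<circ> z) (Suc i))) \<subseteq> range \<phi>"
          by (simp add: \<gamma>(6) closed_segment_linear_image[OF \<gamma>(4)])
      qed
      ultimately have le: "sdist \<epsilon> x (\<gamma> (z n)) \<le> plen \<phi> n z"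
        using sdist_le_plen[OF \<epsilon>(1), of x n "\<gamma> \<circ> z"] \<epsilon>(2) \<gamma>(2) by simp
      show ?thesis
      proof (cases "\<gamma> (z n) \<in> star x \<and> mlen (\<phi> (\<gamma> (z n)) - \<phi> x) < \<epsilon>")
        case True
        then have "\<gamma> (z n) \<in> U" "y \<in> U" using \<epsilon>(2) y by auto
        then have "\<gamma> (z n) = y" using inj_onD[OF inj(3), of "\<gamma> (z n)" y] \<gamma>(3) z(2) by simp
        then show ?thesis using le True by (simp add: sdist_def)
      next
        case False
        then have "sdist \<epsilon> x (\<gamma> (z n)) = \<epsilon>" by (auto simp: sdist_def)
        then show ?thesis using le y(2) by simp
      qed
    qed
    have "mlen (\<phi> y - \<phi> x) \<le> induced_dist_cover \<phi> x' y'" if "p x' = p x" "p y' = p y" for x' y'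
      unfolding induced_dist_cover_eq
    proof (rule cInf_greatest)
      show "{plen \<phi> n z |n z. z 0 = x' \<and> z n = y' \<and> polygonal \<phi> n z} \<noteq> {}"
        using polygonal_connected[of x' y'] by auto
    qed (use low that in auto)
    then have "mlen (\<phi> y - \<phi> x) \<le> induced_dist p \<phi> (p x) (p y)"
      unfolding induced_dist_def by (intro cInf_greatest) auto
    then show "induced_dist p \<phi> (p x) (p y) = mlen (\<phi> y - \<phi> x)"
      using induced_dist_le[of \<phi> x y p, OF nn cell_segment_range[OF K]] by simp
  qed
qed

end

section \<open>First-order isometric deformations of a face\<close>

text \<open>Chord length minus distance is nonnegative for all small \<open>t\<close> and zero at 0,
  so its derivative vanishes there. No formula for the distance at other times enters.\<close>

lemma isometric_if_metric_variation_vanishes: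
  fixes \<Phi> :: "real \<Rightarrow> 'a \<Rightarrow> real^3"
  assumes "0 < \<epsilon>"
    and nn: "\<And>t u v. \<bar>t\<bar> < \<epsilon> \<Longrightarrow> mink (\<Phi> t u - \<Phi> t v) (\<Phi> t u - \<Phi> t v) \<ge> 0"
    and seg: "\<And>t. \<bar>t\<bar> < \<epsilon> \<Longrightarrow> closed_segment (\<Phi> t x) (\<Phi> t y) \<subseteq> range (\<Phi> t)"
    and var: "((\<lambda>t. induced_dist p (\<Phi> t) (p x) (p y)) has_real_derivative 0) (at 0)"
    and eq: "induced_dist p (\<Phi> 0) (p x) (p y) = mlen (\<Phi> 0 y - \<Phi> 0 x)"
    and pos: "mink (\<Phi> 0 y - \<Phi> 0 x) (\<Phi> 0 y - \<Phi> 0 x) > 0"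
    and d: "((\<lambda>t. \<Phi> t x) has_vector_derivative dx) (at 0)" "((\<lambda>t. \<Phi> t y) has_vector_derivative dy) (at 0)"
  shows "mink (dy - dx) (\<Phi> 0 y - \<Phi> 0 x) = 0"
proof -
  define \<Delta> where "\<Delta> t = \<Phi> t y - \<Phi> t x" for t
  define w where "w t = mink (\<Delta> t) (\<Delta> t)" for t
  have "(\<Delta> has_vector_derivative (dy - dx)) (at 0)"
    unfolding \<Delta>_def by (intro has_vector_derivative_diff d)
  from mink.has_vector_derivative[OF this this]
  have "(w has_real_derivative (2 * mink (dy - dx) (\<Delta> 0))) (at 0)"
    unfolding w_def has_real_derivative_iff_has_vector_derivative by (simp add: mink_commute[of "\<Delta> 0"])
  note w' = this
  have w0: "0 < w 0" using pos by (simp add: w_def \<Delta>_def)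
  have g: "((\<lambda>t. sqrt (w t)) has_real_derivative (mink (dy - dx) (\<Delta> 0) / sqrt (w 0))) (at 0)"
    by (rule DERIV_cong[OF DERIV_chain2[OF DERIV_real_sqrt[OF w0] w']]) (simp add: field_simps)
  define f where "f t = induced_dist p (\<Phi> t) (p x) (p y)" for t
  have fg: "f t \<le> sqrt (w t)" if "\<bar>t\<bar> < \<epsilon>" for t
    using induced_dist_le[of "\<Phi> t" x y p, OF nn[OF that] seg[OF that]] by (simp add: f_def mlen_def w_def \<Delta>_def)
  have f0: "f 0 = sqrt (w 0)" using eq by (simp add: f_def mlen_def w_def \<Delta>_def)
  have "((\<lambda>t. sqrt (w t) - f t) has_real_derivative (mink (dy - dx) (\<Delta> 0) / sqrt (w 0) - 0)) (at 0)"
    using g var unfolding f_def by (rule DERIV_diff)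
  then have "mink (dy - dx) (\<Delta> 0) / sqrt (w 0) - 0 = 0"
    by (rule DERIV_local_min[OF _ \<open>0 < \<epsilon>\<close>]) (use fg f0 in auto)
  then show ?thesis using pos by (simp add: w_def \<Delta>_def)
qed

lemma coplanar_imp_dot_cross3_eq_0:
  assumes "affine H" "aff_dim H = 2" "x \<in> H" "y \<in> H" "z \<in> H" "m \<in> H"
  shows "(y - x) \<bullet> cross3 (z - x) (m - x) = (0::real)"
proof -
  have "aff_dim H = int (DIM(real^3) - 1)" using assms(2) by simp
  then have "\<exists>n b. n \<noteq> 0 \<and> affine hull H = {v. n \<bullet> v = b}"
    by (subst (asm) aff_dim_eq_hyperplane)
  then obtain n b where n: "n \<noteq> 0" "affine hull H = {v. n \<bullet> v = b}" by blast
  then have H: "H = {v. n \<bullet> v = b}" using assms(1) by (simp add: hull_same)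
  define u v w where "u = y - x" and "v = z - x" and "w = m - x"
  have 0: "n \<bullet> u = 0" "n \<bullet> v = 0" "n \<bullet> w = 0"
    using assms(3-6) unfolding H u_def v_def w_def by (auto simp: inner_diff_right)
  \<comment> \<open>Cramer's rule written as a vector identity: a nonzero \<open>n\<close>
    orthogonal to all three vectors forces their determinant to vanish.\<close>
  have "(u \<bullet> cross3 v w) *\<^sub>R n = (n \<bullet> u) *\<^sub>R cross3 v w + (n \<bullet> v) *\<^sub>R cross3 w u + (n \<bullet> w) *\<^sub>R cross3 u v"
    by (simp add: vec_eq_iff forall_3 cross3_def inner_vec_def sum_3 algebra_simps)
  then have "u \<bullet> cross3 v w = 0" using n(1) 0 by simp
  then show ?thesis by (simp add: u_def v_def w_def)
qed

text \<open>The derivative at 0 of the determinant of three edge vectors, which vanishes at all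
  small times.\<close>

lemma coplanar_deformation:
  fixes \<Phi> :: "real \<Rightarrow> 'a \<Rightarrow> real^3"
  assumes "0 < \<epsilon>" and H: "\<And>t. \<bar>t\<bar> < \<epsilon> \<Longrightarrow> \<exists>H. affine H \<and> aff_dim H = 2 \<and> {\<Phi> t x, \<Phi> t y, \<Phi> t z, \<Phi> t m} \<subseteq> H"
    and d: "\<And>x. ((\<lambda>t. \<Phi> t x) has_vector_derivative F x) (at 0)"
  shows "(F y - F x) \<bullet> cross3 (\<Phi> 0 z - \<Phi> 0 x) (\<Phi> 0 m - \<Phi> 0 x) +
    (\<Phi> 0 y - \<Phi> 0 x) \<bullet> (cross3 (F z - F x) (\<Phi> 0 m - \<Phi> 0 x) + cross3 (\<Phi> 0 z - \<Phi> 0 x) (F m - F x)) = 0"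
    (is "?D = 0")
proof -
  define T where "T t = (\<Phi> t y - \<Phi> t x) \<bullet> cross3 (\<Phi> t z - \<Phi> t x) (\<Phi> t m - \<Phi> t x)" for t
  have "(T has_vector_derivative ?D) (at 0)"
    unfolding T_def
    by (rule has_vector_derivative_eq_rhs[OF bounded_bilinear.has_vector_derivative[OF bounded_bilinear_inner
        has_vector_derivative_diff[OF d d] bounded_bilinear.has_vector_derivative[OF bounded_bilinear_cross3
        has_vector_derivative_diff[OF d d] has_vector_derivative_diff[OF d d]]]]) (simp add: algebra_simps)
  moreover have "(T has_vector_derivative 0) (at 0)"
  proof (rule has_vector_derivative_transform_within[OF has_vector_derivative_const \<open>0 < \<epsilon>\<close>])
    fix t :: real assume "dist t 0 < \<epsilon>"
    then obtain H where "affine H" "aff_dim H = 2" "{\<Phi> t x, \<Phi> t y, \<Phi> t z, \<Phi> t m} \<subseteq> H" using H[of t] by auto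
    then show "0 = T t" using coplanar_imp_dot_cross3_eq_0[of H "\<Phi> t x" "\<Phi> t y" "\<Phi> t z" "\<Phi> t m"] by (simp add: T_def)
  qed auto
  ultimately show ?thesis by (rule vector_derivative_unique_at)
qed

section \<open>The velocity field on a face\<close>

context spacelike_complex
begin

text \<open>The local hypothesis propagates along the segment from \<open>x\<close> to
  \<open>y\<close>, which stays in the cell: the product of the velocity with the direction
  \<open>v\<close> is locally constant on it.\<close>

lemma cell_isometric:
  assumes loc: "\<And>x. \<exists>\<epsilon>>0. \<forall>y\<in>star x. mlen (\<phi> y - \<phi> x) < \<epsilon> \<longrightarrow> mink (F y - F x) (\<phi> y - \<phi> x) = 0"
    and K: "K \<in> \<C>" "x \<in> K" "y \<in> K"
  shows "mink (F x - F y) (\<phi> x - \<phi> y) = 0"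
proof -
  define v where "v = \<phi> y - \<phi> x"
  have "\<forall>s. \<exists>m. 0 \<le> s \<and> s \<le> 1 \<longrightarrow> m \<in> K \<and> \<phi> m = \<phi> x + s *\<^sub>R v"
  proof
    fix s show "\<exists>m. 0 \<le> s \<and> s \<le> 1 \<longrightarrow> m \<in> K \<and> \<phi> m = \<phi> x + s *\<^sub>R v"
    proof (cases "0 \<le> s \<and> s \<le> 1")
      case True
      then obtain m where "m \<in> K" "\<phi> m = (1 - s) *\<^sub>R \<phi> x + s *\<^sub>R \<phi> y"
        using cell_segment[OF K, of s] by blast
      then show ?thesis by (intro exI[of _ m]) (simp add: v_def algebra_simps)
    qed auto
  qed
  then obtain m where m: "\<And>s. 0 \<le> s \<Longrightarrow> s \<le> 1 \<Longrightarrow> m s \<in> K \<and> \<phi> (m s) = \<phi> x + s *\<^sub>R v" by metis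
  have ends: "m 0 = x" "m 1 = y" using m[of 0] m[of 1] inj_phi by (auto simp: v_def dest: injD)
  have "(\<lambda>s. mink (F (m s)) v) 0 = (\<lambda>s. mink (F (m s)) v) 1"
  proof (rule Bolzano_constant)
    fix s :: real assume s: "0 \<le> s" "s \<le> 1"
    obtain \<epsilon> where \<epsilon>: "\<epsilon> > 0" "\<And>y. y \<in> star (m s) \<Longrightarrow> mlen (\<phi> y - \<phi> (m s)) < \<epsilon> \<Longrightarrow> mink (F y - F (m s)) (\<phi> y - \<phi> (m s)) = 0"
      using loc[of "m s"] by blast
    define d where "d = \<epsilon> / (\<bar>mlen v\<bar> + 1)"
    have d: "d > 0" using \<epsilon>(1) by (simp add: d_def)
    show "\<exists>d>0. \<forall>s'. 0 \<le> s' \<and> s' \<le> 1 \<and> \<bar>s' - s\<bar> < d \<longrightarrow> mink (F (m s')) v = mink (F (m s)) v"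
    proof (intro exI[of _ d] conjI allI impI d)
      fix s' assume s': "0 \<le> s' \<and> s' \<le> 1 \<and> \<bar>s' - s\<bar> < d"
      have diff: "\<phi> (m s') - \<phi> (m s) = (s' - s) *\<^sub>R v" using m[of s] m[of s'] s s' by (simp add: algebra_simps)
      have "\<bar>s' - s\<bar> * mlen v \<le> \<bar>s' - s\<bar> * (\<bar>mlen v\<bar> + 1)" by (intro mult_left_mono) auto
      also have "\<dots> < d * (\<bar>mlen v\<bar> + 1)" using s' by (intro mult_strict_right_mono) auto
      also have "\<dots> = \<epsilon>" by (simp add: d_def)
      finally have "mlen (\<phi> (m s') - \<phi> (m s)) < \<epsilon>" unfolding diff mlen_scale .
      moreover have "m s' \<in> star (m s)" using m[of s] m[of s'] s s' K(1) by (auto simp: star_def)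
      ultimately have "mink (F (m s') - F (m s)) ((s' - s) *\<^sub>R v) = 0" using \<epsilon>(2)[of "m s'"] diff by simp
      then show "mink (F (m s')) v = mink (F (m s)) v" by (cases "s' = s") (auto simp: mink_simps)
    qed
  qed
  then have "mink (F x) v = mink (F y) v" using ends by simp
  then show ?thesis by (simp add: v_def mink_simps)
qed

text \<open>Let \<open>D\<close> be the deviation from the affine value. The isometry condition
  makes \<open>D\<close> orthogonal to the directions of the face, but leaves its normal component
  free; the differentiated coplanarity places \<open>D\<close> in the span of those directions. A
  spacelike plane contains no nonzero isotropic direction.\<close>

lemma cell_affine:
  assumes iso: "\<And>a b. a \<in> K \<Longrightarrow> b \<in> K \<Longrightarrow> mink (F a - F b) (\<phi> a - \<phi> b) = 0"
    and cop: "\<And>x y z m. {x, y, z, m} \<subseteq> K \<Longrightarrow> (F y - F x) \<bullet> cross3 (\<phi> z - \<phi> x) (\<phi> m - \<phi> x) +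
      (\<phi> y - \<phi> x) \<bullet> (cross3 (F z - F x) (\<phi> m - \<phi> x) + cross3 (\<phi> z - \<phi> x) (F m - F x)) = 0"
    and K: "K \<in> \<C>" "x \<in> K" "y \<in> K" "m \<in> K" "\<phi> m = (1 - s) *\<^sub>R \<phi> x + s *\<^sub>R \<phi> y"
  shows "F m = (1 - s) *\<^sub>R F x + s *\<^sub>R F y"
proof (cases "x = y")
  case True
  then have "\<phi> m = \<phi> x" using K(5) by (simp add: algebra_simps)
  then have "m = x" using inj_phi by (auto dest: injD)
  then show ?thesis using True by (simp add: algebra_simps)
next
  case False
  define a where "a = \<phi> y - \<phi> x"
  define D where "D = F m - (1 - s) *\<^sub>R F x - s *\<^sub>R F y"
  have a0: "a \<noteq> 0" using False inj_phi by (auto simp: a_def dest: injD)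
  have ma: "\<phi> m - \<phi> x = s *\<^sub>R a" unfolding K(5) by (simp add: a_def algebra_simps)
  obtain z where z: "z \<in> K" "\<phi> z - \<phi> x \<notin> span {a}"
  proof (rule ccontr)
    assume "\<not> thesis"
    then have "(\<lambda>v. v - \<phi> x) ` \<phi> ` K \<subseteq> span {a}" using that by blast
    then have "dim ((\<lambda>v. v - \<phi> x) ` \<phi> ` K) \<le> card {a}" by (intro dim_le_card) auto
    moreover have "aff_dim (\<phi> ` K) = int (dim ((\<lambda>v. v - \<phi> x) ` \<phi> ` K))"
      by (rule aff_dim_eq_dim_subtract) (use K in \<open>auto intro: hull_inc\<close>)
    ultimately show False using cell_dim[OF K(1)] by simp
  qed
  define b where "b = \<phi> z - \<phi> x"
  have ab: "a \<noteq> b" using z(2) span_base[of a "{a}"] by (auto simp: b_def)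
  have ind: "independent {a, b}"
    using independent_insertI[of b "{a}"] z(2) a0 by (simp add: b_def insert_commute)
  have orth: "mink D (\<phi> m - \<phi> w) = 0" if w: "w \<in> K" for w
  proof -
    define p where "p = \<phi> x - \<phi> w"
    define f g where "f = F x - F w" and "g = F y - F x"
    have ga: "mink g a = 0" using iso[OF K(3,2)] by (simp add: g_def a_def)
    have fp: "mink f p = 0" using iso[OF K(2) w] by (simp add: f_def p_def)
    have "mink (f + g) (p + a) = 0" using iso[OF K(3) w] by (simp add: f_def g_def p_def a_def)
    then have "mink f a = - mink g p" using ga fp by (simp add: mink_simps)
    then have 1: "mink (f + s *\<^sub>R g) (p + s *\<^sub>R a) = 0" by (simp add: mink_simps ga fp)
    have 2: "\<phi> m - \<phi> w = p + s *\<^sub>R a" unfolding p_def ma[symmetric] by simp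
    have "mink (F m - F w) (p + s *\<^sub>R a) = 0" using iso[OF K(4) w] 2 by simp
    moreover have "D = (F m - F w) - (f + s *\<^sub>R g)" by (simp add: D_def f_def g_def algebra_simps)
    ultimately show ?thesis using 1 unfolding 2 by (simp add: mink_diff_left)
  qed
  have "mink D (\<phi> w - \<phi> x) = 0" if "w \<in> K" for w
    using orth[OF that] orth[OF K(2)] by (simp add: mink_simps)
  then have Dab: "mink D a = 0" "mink D b = 0" using K(3) z(1) by (auto simp: a_def b_def)
  have "D \<bullet> cross3 a b = 0"
  proof -
    define f where "f = F m - F x"
    have "(F y - F x) \<bullet> cross3 b (s *\<^sub>R a) + a \<bullet> (cross3 (F z - F x) (s *\<^sub>R a) + cross3 b f) = 0"
      using cop[of x y z m] K z(1) unfolding ma f_def by (simp add: a_def b_def)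
    moreover have "(F y - F x) \<bullet> cross3 b (s *\<^sub>R a) = - (s *\<^sub>R (F y - F x)) \<bullet> cross3 a b"
      by (simp add: cross3_def inner_vec_def sum_3 algebra_simps)
    moreover have "a \<bullet> cross3 (F z - F x) (s *\<^sub>R a) = 0" by (simp add: cross3_def inner_vec_def sum_3 algebra_simps)
    moreover have "a \<bullet> cross3 b f = f \<bullet> cross3 a b" by (simp add: cross3_def inner_vec_def sum_3 algebra_simps)
    ultimately have "(f - s *\<^sub>R (F y - F x)) \<bullet> cross3 a b = 0" by (simp add: inner_add_right inner_diff_left)
    moreover have "D = f - s *\<^sub>R (F y - F x)" by (simp add: D_def f_def algebra_simps)
    ultimately show ?thesis by simp
  qed
  then have Dspan: "D \<in> span {a, b}" by (rule in_span_of_cross3_orthogonal[OF ind ab])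
  then have DD: "mink D D = 0"
  proof -
    have "D' \<in> span {a, b} \<Longrightarrow> mink D D' = 0" for D'
      by (induction rule: span_induct_alt) (use Dab in \<open>auto simp: mink_simps\<close>)
    then show ?thesis using Dspan by blast
  qed
  obtain H where H: "spacelike_plane H" "\<phi> ` K \<subseteq> H" using cell_plane[OF K(1)] by blast
  have "subspace ((\<lambda>v. v - \<phi> x) ` H)"
    using H K(2) by (intro affine_diffs_subspace_subtract) (auto simp: spacelike_plane_def)
  moreover have "{a, b} \<subseteq> (\<lambda>v. v - \<phi> x) ` H" using H(2) K(3) z(1) by (auto simp: a_def b_def)
  ultimately have "span {a, b} \<subseteq> (\<lambda>v. v - \<phi> x) ` H" by (intro span_minimal)
  then obtain h where h: "h \<in> H" "D = h - \<phi> x" using Dspan by blast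
  have "D = 0"
  proof (rule ccontr)
    assume "D \<noteq> 0"
    then have "mink (h - \<phi> x) (h - \<phi> x) > 0"
      using H h K(2) unfolding spacelike_plane_def by auto
    then show False using DD h(2) by simp
  qed
  then show ?thesis by (simp add: D_def algebra_simps)
qed

end

section \<open>Corners of cells are not inside edges\<close>

lemma cdir_eq_imp:
  assumes "cdir a = cdir b" "0 < b - a" "b - a < 2 * pi"
  shows False
proof -
  have "cos a = cos b" "sin a = sin b" using assms(1) by (auto simp: vec_eq_iff forall_2)
  then have "cos (b - a) = 1" using sin_cos_squared_add3[of b] by (simp add: cos_diff)
  then obtain n :: int where n: "b - a = of_int n * 2 * pi" by (auto simp: cos_one_2pi_int)
  then have "0 < of_int n * (2 * pi)" "of_int n * (2 * pi) < 1 * (2 * pi)" using assms(2,3) by auto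
  then have "0 < n" "n < 1" by (auto simp: zero_less_mult_iff mult_less_cancel_right)
  then show False by simp
qed

context spacelike_complex
begin

definition open_cell :: "'a set \<Rightarrow> 'a set" where
  "open_cell K = {y \<in> K. \<phi> y \<in> rel_interior (\<phi> ` K)}"

text \<open>Three boundary rays leave a point which is a corner of all its cells, but the line does not contain a
  triod.\<close>

lemma corner_not_on_arc:
  fixes g :: "'a \<Rightarrow> real"
  assumes uniq: "\<And>K K' y. K \<in> \<C> \<Longrightarrow> K' \<in> \<C> \<Longrightarrow> y \<in> open_cell K \<Longrightarrow> y \<in> K' \<Longrightarrow> K' = K"
    and op: "\<And>K. K \<in> \<C> \<Longrightarrow> open (open_cell K)"
    and W: "open W" "x0 \<in> W" "\<And>y. y \<in> W \<Longrightarrow> y \<in> E \<or> (\<exists>K\<in>\<C>. y \<in> open_cell K)"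
    and g: "continuous_on E g" "inj_on g E" "x0 \<in> E"
    and corner: "\<And>K a b s. K \<in> \<C> \<Longrightarrow> a \<in> K \<Longrightarrow> b \<in> K \<Longrightarrow> 0 < s \<Longrightarrow> s < 1 \<Longrightarrow>
      \<phi> x0 = (1 - s) *\<^sub>R \<phi> a + s *\<^sub>R \<phi> b \<Longrightarrow> a = b"
  shows False
proof -
  define P where "P y = proj2 (axis 1 1) (axis 2 1) (\<phi> y - \<phi> x0)" for y
  have Plin: "P m = (1 - s) *\<^sub>R P a + s *\<^sub>R P b" if "\<phi> m = (1 - s) *\<^sub>R \<phi> a + s *\<^sub>R \<phi> b" for a b m s
    unfolding P_def that by (simp add: vec_eq_iff forall_2 mink_simps algebra_simps)
  have P0: "P x0 = 0" by (simp add: P_def proj2_0)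
  have Pinj: "inj P" unfolding P_def by (rule injI) (rule inj_proj_diff[OF standard_frame])
  have Pcont: "continuous_on UNIV P" unfolding P_def
    by (intro bounded_linear.continuous_on[OF bounded_linear_proj2] continuous_intros cont_phi)
  define Y where "Y = inv_into UNIV P"
  have YP: "Y (P y) = y" for y using Pinj by (simp add: Y_def)
  have Ycont: "continuous_on (range P) Y"
  proof (rule continuous_on_inverse_open_map[where f = P and S = UNIV])
    fix U :: "'a set" assume "openin (top_of_set UNIV) U"
    then have "open (P ` U)" by (intro open_map Pcont Pinj) simp
    then show "openin (top_of_set (range P)) (P ` U)" by (intro open_subset) auto
  qed (use Pcont YP in auto)
  have "open (W \<inter> interior (star x0))" "x0 \<in> W \<inter> interior (star x0)" using W interior_star by auto
  then obtain R where R: "R > 0" "\<And>w. norm w < R \<Longrightarrow> \<exists>y\<in>W \<inter> interior (star x0). P y = w"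
    using proj_ball[OF standard_frame, of "W \<inter> interior (star x0)" x0] unfolding P_def by metis
  \<comment> \<open>A third of \<open>R\<close>, so that rays extend to radius \<open>2 * r\<close>
    and the points at radius \<open>r\<close> are inner points of them.\<close>
  define r where "r = R / 3"
  have r: "0 < r" "2 * r < R" using R(1) by (auto simp: r_def)
  define Z where "Z \<rho> t = Y (\<rho> *\<^sub>R cdir t)" for \<rho> t
  have PZ: "P (Z \<rho> t) = \<rho> *\<^sub>R cdir t" "Z \<rho> t \<in> W" "Z \<rho> t \<in> star x0" "\<rho> *\<^sub>R cdir t \<in> range P"
    if "0 \<le> \<rho>" "\<rho> \<le> 2 * r" for \<rho> t
  proof -
    have "norm (\<rho> *\<^sub>R cdir t) < R" using that r by simp
    then obtain y where y: "y \<in> W \<inter> interior (star x0)" "P y = \<rho> *\<^sub>R cdir t" using R(2) by metis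
    have "Z \<rho> t = y" unfolding Z_def y(2)[symmetric] by (rule YP)
    then show "P (Z \<rho> t) = \<rho> *\<^sub>R cdir t" "Z \<rho> t \<in> W" "Z \<rho> t \<in> star x0" "\<rho> *\<^sub>R cdir t \<in> range P"
      using y interior_subset[of "star x0"] by auto (metis rangeI)
  qed
  have Z0: "Z 0 t = x0" for t unfolding Z_def using YP[of x0] P0 by simp
  have Zcont: "continuous_on {0..r} (\<lambda>\<rho>. Z \<rho> t)" for t
    unfolding Z_def using PZ(4) r
    by (intro continuous_on_compose2[OF Ycont] continuous_intros) (auto intro!: PZ(4))
  have Zarc: "continuous_on UNIV (\<lambda>t. Z r t)"
    unfolding Z_def using PZ(4)[of r] r
    by (intro continuous_on_compose2[OF Ycont] continuous_intros continuous_cdir) auto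
  define IC where "IC y \<longleftrightarrow> (\<exists>K\<in>\<C>. y \<in> open_cell K)" for y
  \<comment> \<open>Interiority to a cell propagates outwards along a ray up to radius
    \<open>r\<close>. Conversely, a ray whose point at radius \<open>r\<close> is in no open cell
    lies in \<open>E\<close> from the apex up to that radius.\<close>
  have ray: "IC (Z r t)" if t: "IC (Z \<rho> t)" "0 < \<rho>" "\<rho> \<le> r" for \<rho> t
  proof -
    obtain K where K: "K \<in> \<C>" "x0 \<in> K" "Z (2 * r) t \<in> K" using PZ(3)[of "2 * r" t] r by (auto simp: star_def)
    have seg: "Z \<sigma> t \<in> K \<and> \<phi> (Z \<sigma> t) = (1 - \<sigma>/(2*r)) *\<^sub>R \<phi> x0 + (\<sigma>/(2*r)) *\<^sub>R \<phi> (Z (2*r) t)"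
      if "0 \<le> \<sigma>" "\<sigma> \<le> 2 * r" for \<sigma>
    proof -
      have "0 \<le> \<sigma>/(2*r)" "\<sigma>/(2*r) \<le> 1" using that r by auto
      then obtain m where m: "m \<in> K" "\<phi> m = (1 - \<sigma>/(2*r)) *\<^sub>R \<phi> x0 + (\<sigma>/(2*r)) *\<^sub>R \<phi> (Z (2*r) t)"
        using cell_segment[OF K] by blast
      have "P m = P (Z \<sigma> t)" using Plin[OF m(2)] PZ(1)[of "2*r" t] PZ(1)[OF that] r P0 by simp
      then have "m = Z \<sigma> t" using Pinj by (auto dest: injD)
      then show ?thesis using m by simp
    qed
    obtain K' where K': "K' \<in> \<C>" "Z \<rho> t \<in> open_cell K'" using t(1) by (auto simp: IC_def)
    have "K = K'" using uniq[OF K'(1) K(1) K'(2)] seg[of \<rho>] t r by simp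
    then have ri: "\<phi> (Z \<rho> t) \<in> rel_interior (\<phi> ` K)" using K'(2) by (simp add: open_cell_def)
    have "\<phi> (Z r t) \<in> rel_interior (\<phi> ` K)"
    proof (cases "\<rho> = r")
      case False
      then have \<rho>: "\<rho> < r" using t(3) by simp
      define a b where "a = \<phi> x0" and "b = \<phi> (Z (2*r) t)"
      \<comment> \<open>The position of \<open>Z r t\<close> on the segment from
        \<open>Z \<rho> t\<close> to the end of the ray at radius \<open>2 * r\<close>.\<close>
      define u where "u = (r - \<rho>) / (2*r - \<rho>)"
      have d: "2*r - \<rho> > 0" using \<rho> r by simp
      have u: "0 < u" "u < 1" using \<rho> r by (auto simp: u_def field_simps)
      have eq: "\<phi> (Z r t) = (1 - u) *\<^sub>R \<phi> (Z \<rho> t) + u *\<^sub>R b"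
      proof -
        have 1: "(1 - u) * (1 - \<rho>/(2*r)) = 1 - r/(2*r)" "(1 - u) * (\<rho>/(2*r)) + u = r/(2*r)"
        proof -
          define d where "d = 2 * r - \<rho>"
          have d: "d > 0" "\<rho>/(2*r) = 1 - d/(2*r)" "u = 1 - r/d" using \<open>2*r - \<rho> > 0\<close> r
            by (auto simp: d_def u_def field_simps)
          show "(1 - u) * (1 - \<rho>/(2*r)) = 1 - r/(2*r)" "(1 - u) * (\<rho>/(2*r)) + u = r/(2*r)"
            unfolding d(2,3) using d(1) r by (auto simp: field_simps)
        qed
        have "(1 - u) *\<^sub>R \<phi> (Z \<rho> t) + u *\<^sub>R b = ((1 - u) * (1 - \<rho>/(2*r))) *\<^sub>R a + ((1 - u) * (\<rho>/(2*r)) + u) *\<^sub>R b"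
          using seg[of \<rho>] t r by (simp add: a_def b_def scaleR_add_right scaleR_add_left)
        also have "\<dots> = \<phi> (Z r t)" unfolding 1 using seg[of r] r by (simp add: a_def b_def)
        finally show ?thesis by simp
      qed
      have "b \<in> \<phi> ` K" using K(3) by (simp add: b_def)
      have "\<phi> (Z \<rho> t) \<noteq> b"
      proof
        assume "\<phi> (Z \<rho> t) = b"
        then have "Z \<rho> t = Z (2*r) t" using inj_phi by (auto simp: b_def dest: injD)
        then have "norm (\<rho> *\<^sub>R cdir t) = norm ((2*r) *\<^sub>R cdir t)" using PZ(1)[of \<rho> t] PZ(1)[of "2*r" t] t r by simp
        then show False using \<rho> r t by simp
      qed
      then have "\<phi> (Z r t) \<in> open_segment (\<phi> (Z \<rho> t)) b" using u eq by (auto simp: in_segment)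
      moreover have "b \<in> closure (\<phi> ` K)" using \<open>b \<in> \<phi> ` K\<close> closure_subset by (rule rev_subsetD)
      ultimately show ?thesis
        using subsetD[OF rel_interior_closure_convex_segment[OF convex_cell[OF K(1)] ri]] by blast
    qed (use ri in simp)
    then show ?thesis using seg[of r] r K(1) by (auto simp: IC_def open_cell_def)
  qed
  \<comment> \<open>An open half circle covered by open cells lies in one of them by connectedness.
    The two ends are then in the closed cell and \<open>x0\<close> is their midpoint, which the
    corner condition excludes.\<close>
  have halfcircle: "\<exists>t. t0 < t \<and> t < t0 + pi \<and> \<not> IC (Z r t)" for t0
  proof (rule ccontr)
    assume "\<not> ?thesis"
    then have all: "IC (Z r t)" if "t0 < t" "t < t0 + pi" for t using that by blast
    let ?A = "Z r ` {t0<..<t0+pi}"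
    have conn: "connected ?A"
      by (intro connected_continuous_image continuous_on_subset[OF Zarc]) auto
    obtain K where K: "K \<in> \<C>" "Z r (t0 + pi/2) \<in> open_cell K" using all[of "t0 + pi/2"] pi_gt_zero by (auto simp: IC_def)
    let ?O = "\<Union>(open_cell ` (\<C> - {K}))"
    have o1: "open (open_cell K)" and o2: "open ?O" using op K(1) by auto
    have dis: "open_cell K \<inter> ?O \<inter> ?A = {}" using uniq K(1) by (auto simp: open_cell_def)
    have cov: "?A \<subseteq> open_cell K \<union> ?O"
    proof
      fix y assume "y \<in> ?A"
      then obtain t where "t0 < t" "t < t0 + pi" "y = Z r t" by auto
      then have "IC y" using all by simp
      then obtain K' where "K' \<in> \<C>" "y \<in> open_cell K'" unfolding IC_def by blast
      then show "y \<in> open_cell K \<union> ?O" by (cases "K' = K") auto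
    qed
    have "Z r (t0 + pi/2) \<in> ?A" using pi_gt_zero by (intro imageI) simp
    moreover have "open_cell K \<inter> ?A = {} \<or> ?O \<inter> ?A = {}" by (rule connectedD[OF conn o1 o2 dis cov])
    ultimately have "?O \<inter> ?A = {}" using K(2) by blast
    then have "?A \<subseteq> open_cell K" using cov by blast
    also have "open_cell K \<subseteq> K" by (auto simp: open_cell_def)
    finally have sub: "?A \<subseteq> K" .
    have cl: "Z r ` closure {t0<..<t0+pi} \<subseteq> K"
    proof -
      have "Z r ` closure {t0<..<t0+pi} \<subseteq> closure ?A"
        by (rule continuous_image_closure_subset[OF Zarc]) auto
      then show ?thesis using closure_minimal[OF sub closed_cell[OF K(1)]] by blast
    qed
    have ends: "Z r t0 \<in> K" "Z r (t0 + pi) \<in> K" using cl by auto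
    obtain m where m: "m \<in> K" "\<phi> m = (1 - 1/2) *\<^sub>R \<phi> (Z r t0) + (1/2) *\<^sub>R \<phi> (Z r (t0 + pi))"
      using cell_segment[OF K(1) ends, of "1/2"] by auto
    have "P m = P x0" using Plin[OF m(2)] PZ(1)[of r t0] PZ(1)[of r "t0 + pi"] r P0 by (simp add: cdir_pi)
    then have "m = x0" using Pinj by (auto dest: injD)
    then have "Z r t0 = Z r (t0 + pi)" using corner[OF K(1) ends, of "1/2"] m(2) by simp
    then have "r *\<^sub>R cdir t0 = r *\<^sub>R cdir (t0 + pi)" using PZ(1)[of r t0] PZ(1)[of r "t0 + pi"] r by simp
    then have "cdir t0 = cdir (t0 + pi)" using r by simp
    then show False by (rule cdir_eq_imp) auto
  qed
  \<comment> \<open>Three directions without open cells, any two of them less than a full turn apart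
    and hence distinct.\<close>
  obtain b1 where b1: "0 < b1" "\<not> IC (Z r b1)" using halfcircle[of 0] by auto
  obtain b2 where b2: "b1 < b2" "b2 < b1 + pi" "\<not> IC (Z r b2)" using halfcircle[of b1] by auto
  obtain b3 where b3: "b1 - pi < b3" "b3 < b1" "\<not> IC (Z r b3)" using halfcircle[of "b1 - pi"] by auto
  have distinct: "cdir b1 \<noteq> cdir b2" "cdir b1 \<noteq> cdir b3" "cdir b2 \<noteq> cdir b3"
    using cdir_eq_imp[of b1 b2] cdir_eq_imp[of b3 b1] cdir_eq_imp[of b3 b2] b2 b3 pi_gt_zero by auto
  define f where "f b \<rho> = g (Z \<rho> b)" for b \<rho>
  have ZE: "Z \<rho> b \<in> E" if "\<not> IC (Z r b)" "0 \<le> \<rho>" "\<rho> \<le> r" for \<rho> b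
  proof (cases "\<rho> = 0")
    case True then show ?thesis using Z0 g(3) by simp
  next
    case False
    then have "\<not> IC (Z \<rho> b)" using ray that by force
    then show ?thesis using W(3)[OF PZ(2)[of \<rho> b]] that r by (auto simp: IC_def)
  qed
  have fcont: "continuous_on {0..r} (f b)" if "\<not> IC (Z r b)" for b
    unfolding f_def using ZE[OF that] by (intro continuous_on_compose2[OF g(1) Zcont]) auto
  have f0: "f b 0 = g x0" for b by (simp add: f_def Z0)
  have meet: False if b: "\<not> IC (Z r b)" "\<not> IC (Z r b')" "cdir b \<noteq> cdir b'"
    and v: "v \<noteq> g x0" "v \<in> f b ` {0..r}" "v \<in> f b' ` {0..r}" for b b' v
  proof -
    obtain \<rho> \<rho>' where \<rho>: "0 \<le> \<rho>" "\<rho> \<le> r" "f b \<rho> = v" "0 \<le> \<rho>'" "\<rho>' \<le> r" "f b' \<rho>' = v" using v by auto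
    then have "Z \<rho> b = Z \<rho>' b'" using inj_onD[OF g(2)] ZE b by (simp add: f_def)
    then have eq: "\<rho> *\<^sub>R cdir b = \<rho>' *\<^sub>R cdir b'" using PZ(1)[of \<rho> b] PZ(1)[of \<rho>' b'] \<rho> r by simp
    then have "norm (\<rho> *\<^sub>R cdir b) = norm (\<rho>' *\<^sub>R cdir b')" by simp
    then have "\<rho> = \<rho>'" using \<rho> by simp
    moreover have "\<rho> \<noteq> 0" using \<rho>(3) v(1) f0 by auto
    ultimately show False using eq b(3) by simp
  qed
  have hit: "v \<in> f b ` {0..r}" if "\<not> IC (Z r b)" "v \<in> closed_segment (g x0) (f b r)" for b v
  proof -
    have "connected (f b ` {0..r})" by (intro connected_continuous_image fcont that) auto
    moreover have "g x0 \<in> f b ` {0..r}" "f b r \<in> f b ` {0..r}"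
      using imageI[of 0 "{0..r}" "f b"] f0[of b] r by auto
    ultimately show ?thesis
      using that(2) by (metis connected_convex_1 closed_segment_subset subsetD)
  qed
  have ne: "f b r \<noteq> g x0" if "\<not> IC (Z r b)" for b
  proof
    assume "f b r = g x0"
    then have "Z r b = x0" using inj_onD[OF g(2)] ZE[OF that, of r] g(3) r by (simp add: f_def)
    then show False using PZ(1)[of r b] P0 r norm_cdir[of b] by auto
  qed
  \<comment> \<open>By the intermediate value theorem, two rays whose ends fall on the same side of
    \<open>g x0\<close> share a value of \<open>g\<close> other than \<open>g x0\<close>.
    Injectivity of \<open>g\<close> makes them share a point other than the apex.\<close>
  have same: False if b: "\<not> IC (Z r b)" "\<not> IC (Z r b')" "cdir b \<noteq> cdir b'"
    and s: "(f b r > g x0 \<and> f b' r > g x0) \<or> (f b r < g x0 \<and> f b' r < g x0)" for b b'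
  proof -
    define v where "v = (if f b r > g x0 then min (f b r) (f b' r) else max (f b r) (f b' r))"
    have v: "v \<noteq> g x0" "v \<in> closed_segment (g x0) (f b r)" "v \<in> closed_segment (g x0) (f b' r)"
      using s by (auto simp: v_def closed_segment_eq_real_ivl)
    show False by (rule meet[OF b v(1) hit[OF b(1) v(2)] hit[OF b(2) v(3)]])
  qed
  \<comment> \<open>Three rays and two sides of \<open>g x0\<close>: two rays fall on the same
    side.\<close>
  show False
    using same[OF b1(2) b2(3) distinct(1)] same[OF b1(2) b3(3) distinct(2)] same[OF b2(3) b3(3) distinct(3)]
      ne[OF b1(2)] ne[OF b2(3)] ne[OF b3(3)] by linarith
qed

end

section \<open>Lifting through the universal cover\<close>

lemma smooth_atlas_chart:
  assumes "smooth_atlas A"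
  shows "\<exists>U \<psi>. (U, \<psi>) \<in> A \<and> open U \<and> x \<in> U \<and> open (\<psi> ` U) \<and> homeomorphism U (\<psi> ` U) \<psi> (inv_into U \<psi>)"
proof -
  have "x \<in> \<Union>(fst ` A)" using assms by (simp add: smooth_atlas_def)
  then obtain U \<psi> where U: "(U, \<psi>) \<in> A" "x \<in> U" by auto
  then have "open U \<and> open (\<psi> ` U) \<and> homeomorphism U (\<psi> ` U) \<psi> (inv_into U \<psi>)"
    using assms unfolding smooth_atlas_def by (auto dest: bspec[of A])
  then show ?thesis using U by blast
qed

text \<open>The pair of a bump function and of its product with the chart extends continuously by 0.
  Where the bump is positive it can be divided out, which recovers the chart and hence the
  point.\<close>

lemma chart_bump:
  fixes A :: "'b::t2_space atlas"
  assumes "smooth_atlas A"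
  shows "\<exists>(f :: 'b \<Rightarrow> (real^2) \<times> real) V. continuous_on UNIV f \<and> open V \<and> x \<in> V \<and>
    (\<forall>y\<in>V. \<forall>y'. f y' = f y \<longrightarrow> y' = y)"
proof -
  obtain U and \<psi> :: "'b \<Rightarrow> real^2" where U: "open U" "x \<in> U" "open (\<psi> ` U)" and h: "homeomorphism U (\<psi> ` U) \<psi> (inv_into U \<psi>)"
    using smooth_atlas_chart[OF assms] by blast
  obtain e where e: "e > 0" "cball (\<psi> x) e \<subseteq> \<psi> ` U" using U open_contains_cball by blast
  let ?C = "inv_into U \<psi> ` cball (\<psi> x) e"
  have inj: "inj_on \<psi> U" using h by (metis homeomorphism_def inj_on_inverseI)
  have C: "compact ?C"
    using h e(2) by (intro compact_continuous_image) (auto simp: homeomorphism_def intro: continuous_on_subset)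
  have CU: "?C \<subseteq> U" using e(2) by (auto intro: inv_into_into)
  have inC: "y \<in> ?C" if "y \<in> U" "dist (\<psi> y) (\<psi> x) \<le> e" for y
    using that inv_into_f_f[OF inj that(1)] by (intro image_eqI[of _ _ "\<psi> y"]) (auto simp: dist_commute)
  define b where "b y = (if y \<in> U then max 0 (e - dist (\<psi> y) (\<psi> x)) else 0)" for y
  define f where "f y = (if y \<in> U then (b y *\<^sub>R \<psi> y, b y) else 0)" for y
  have fz: "f y = 0" if "y \<notin> ?C" for y
    using inC[of y] that by (cases "dist (\<psi> y) (\<psi> x) \<le> e") (auto simp: f_def b_def zero_prod_def)
  have "continuous_on (U \<union> - ?C) f"
  proof (rule continuous_on_open_Un)
    show "open U" by fact
    show "open (- ?C)" using C by (simp add: compact_imp_closed open_Compl)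
    have "continuous_on U (\<lambda>y. (max 0 (e - dist (\<psi> y) (\<psi> x)) *\<^sub>R \<psi> y, max 0 (e - dist (\<psi> y) (\<psi> x))))"
      using h by (intro continuous_intros) (auto simp: homeomorphism_def)
    then show "continuous_on U f" by (rule continuous_on_eq) (auto simp: f_def b_def)
    show "continuous_on (- ?C) f" using fz by (intro continuous_on_eq[OF continuous_on_const[of _ 0]]) auto
  qed
  moreover have "U \<union> - ?C = UNIV" using CU by auto
  ultimately have "continuous_on UNIV f" by simp
  moreover have "open (U \<inter> \<psi> -` ball (\<psi> x) e)"
    using h U(1) by (intro continuous_open_preimage) (auto simp: homeomorphism_def)
  moreover have "y' = y" if "y \<in> U \<inter> \<psi> -` ball (\<psi> x) e" "f y' = f y" for y y'
  proof -
    have y: "y \<in> U" "b y > 0" using that(1) by (auto simp: b_def dist_commute)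
    then have "y' \<in> U" using that(2) by (auto simp: f_def zero_prod_def split: if_splits)
    then have "b y' = b y" "b y' *\<^sub>R \<psi> y' = b y *\<^sub>R \<psi> y" using that(2) y by (auto simp: f_def)
    then have "\<psi> y' = \<psi> y" using y(2) by auto
    then show ?thesis using inj y(1) \<open>y' \<in> U\<close> by (auto dest: inj_onD)
  qed
  moreover have "x \<in> U \<inter> \<psi> -` ball (\<psi> x) e" using U e by auto
  ultimately show ?thesis by (intro exI[of _ f] exI[of _ "U \<inter> \<psi> -` ball (\<psi> x) e"]) blast
qed

text \<open>The lifting theorems of the library are stated for normed spaces, hence the following embedding.\<close>

lemma compact_surface_embedding:
  fixes A :: "'b::t2_space atlas"
  assumes "smooth_atlas A" "compact (UNIV :: 'b set)"
  shows "\<exists>j :: 'b \<Rightarrow> (nat \<Rightarrow>\<^sub>C ((real^2) \<times> real)). continuous_on UNIV j \<and> inj j"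
proof -
  have "\<forall>x. \<exists>(f :: 'b \<Rightarrow> (real^2) \<times> real) V. continuous_on UNIV f \<and> open V \<and> x \<in> V \<and>
    (\<forall>y\<in>V. \<forall>y'. f y' = f y \<longrightarrow> y' = y)"
    using chart_bump[OF assms(1)] by blast
  then obtain f :: "'b \<Rightarrow> 'b \<Rightarrow> (real^2) \<times> real" and V where f: "\<And>x. continuous_on UNIV (f x)" "\<And>x. open (V x)" "\<And>x. x \<in> V x"
    "\<And>x y y'. y \<in> V x \<Longrightarrow> f x y' = f x y \<Longrightarrow> y' = y" by metis
  have VU: "UNIV \<subseteq> \<Union> (V ` UNIV)" using f(3) by blast
  obtain X where X: "finite X" "UNIV \<subseteq> (\<Union>x\<in>X. V x)"
    by (rule compactE_image[OF assms(2) f(2) VU])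
  obtain n and e :: "nat \<Rightarrow> 'b" where e: "X = e ` {..<n}"
    using X(1) by (metis finite_imp_nat_seg_image_inj_on lessThan_def)
  define G where "G y k = (if k < n then f (e k) y else 0)" for y k
  define j where "j y = Bcontfun (G y)" for y
  have Gb: "G y \<in> bcontfun" for y
  proof (rule bcontfun_normI)
    show "norm (G y k) \<le> (\<Sum>i<n. norm (G y i))" for k
    proof (cases "k < n")
      case True then show ?thesis by (intro member_le_sum) auto
    next
      case False then show ?thesis by (simp add: G_def sum_nonneg)
    qed
  qed simp
  have j: "apply_bcontfun (j y) = G y" for y unfolding j_def by (rule Bcontfun_inverse[OF Gb])
  have "inj j"
  proof (rule injI)
    fix y y' assume "j y = j y'"
    then have G: "G y = G y'" using j by metis
    obtain x where "x \<in> X" "y \<in> V x" using X(2) by blast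
    then obtain k where k: "k < n" "y \<in> V (e k)" using e by blast
    then have "f (e k) y' = f (e k) y" using fun_cong[OF G, of k] by (simp add: G_def)
    then show "y = y'" using f(4)[OF k(2)] by metis
  qed
  moreover have "continuous_on UNIV j"
    unfolding continuous_on_def
  proof (intro ballI tendstoI)
    fix x and r :: real assume r: "0 < r"
    have "\<forall>\<^sub>F y in at x. \<forall>k\<in>{..<n}. dist (f (e k) y) (f (e k) x) < r/2"
    proof (intro eventually_ball_finite ballI)
      fix k assume "k \<in> {..<n}"
      have "(f (e k) \<longlongrightarrow> f (e k) x) (at x)" using f(1)[of "e k"] by (simp add: continuous_on_def)
      then show "\<forall>\<^sub>F y in at x. dist (f (e k) y) (f (e k) x) < r/2" using r by (intro tendstoD) auto
    qed simp
    then show "\<forall>\<^sub>F y in at x. dist (j y) (j x) < r"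
    proof eventually_elim
      case (elim y)
      have "dist (j y) (j x) \<le> r/2"
        by (rule dist_bound) (use elim r in \<open>auto simp: j G_def intro: less_imp_le\<close>)
      then show ?case using r by simp
    qed
  qed
  ultimately show ?thesis by (intro exI[of _ j]) simp
qed

text \<open>The set where the two lifts agree is open by local injectivity of \<open>p\<close>, and
  its complement is open by the Hausdorff property.\<close>

lemma unique_lift:
  fixes p :: "'a::t2_space \<Rightarrow> 'b" and g g' :: "'c::topological_space \<Rightarrow> 'a"
  assumes loc: "\<And>x. \<exists>U. open U \<and> x \<in> U \<and> inj_on p U"
    and T: "connected T" "continuous_on T g" "continuous_on T g'" "\<And>y. y \<in> T \<Longrightarrow> p (g y) = p (g' y)"
    and "a \<in> T" "g a = g' a" "y \<in> T"
  shows "g y = g' y"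
proof (rule ccontr)
  assume ne: "g y \<noteq> g' y"
  define E N where "E = {y\<in>T. g y = g' y}" and "N = {y\<in>T. g y \<noteq> g' y}"
  have "openin (top_of_set T) E"
  proof (subst openin_subopen, intro ballI)
    fix u assume u: "u \<in> E"
    obtain U where U: "open U" "g u \<in> U" "inj_on p U" using loc by blast
    let ?W = "T \<inter> g -` U \<inter> (T \<inter> g' -` U)"
    have "openin (top_of_set T) ?W"
      using continuous_openin_preimage_gen[OF T(2) U(1)] continuous_openin_preimage_gen[OF T(3) U(1)] by blast
    moreover have "u \<in> ?W" using u U by (auto simp: E_def)
    moreover have "?W \<subseteq> E" using U(3) T(4) by (auto simp: E_def dest: inj_onD)
    ultimately show "\<exists>W. openin (top_of_set T) W \<and> u \<in> W \<and> W \<subseteq> E" by blast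
  qed
  moreover have "openin (top_of_set T) N"
  proof (subst openin_subopen, intro ballI)
    fix u assume u: "u \<in> N"
    then obtain U V where U: "open U" "open V" "g u \<in> U" "g' u \<in> V" "U \<inter> V = {}"
      using hausdorff[of "g u" "g' u"] by (auto simp: N_def)
    let ?W = "T \<inter> g -` U \<inter> (T \<inter> g' -` V)"
    have "openin (top_of_set T) ?W"
      using continuous_openin_preimage_gen[OF T(2) U(1)] continuous_openin_preimage_gen[OF T(3) U(2)] by blast
    moreover have "u \<in> ?W" using u U by (auto simp: N_def)
    moreover have "?W \<subseteq> N" using U(5) by (auto simp: N_def)
    ultimately show "\<exists>W. openin (top_of_set T) W \<and> u \<in> W \<and> W \<subseteq> N" by blast
  qed
  moreover have "T \<subseteq> E \<union> N" "E \<inter> N = {}" "E \<noteq> {}" "N \<noteq> {}" using assms ne by (auto simp: E_def N_def)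
  ultimately show False using T(1) unfolding connected_openin by blast
qed

text \<open>The injective map \<open>f0\<close> will be the projection of the surface to the
  horizontal plane. By invariance of domain it identifies the universal cover with an open set of
  the plane, where lifting becomes available.\<close>

locale surface_cover =
  fixes p :: "'a::t2_space \<Rightarrow> 'b::t2_space" and A :: "'b atlas" and f0 :: "'a \<Rightarrow> real^2"
  assumes atlas: "smooth_atlas A" and compact_base: "compact (UNIV :: 'b set)"
    and cover: "universal_cover p"
    and cont_f0: "continuous_on UNIV f0" and inj_f0: "inj f0"
begin

lemma covering: "covering_space UNIV p UNIV"
  using cover by (simp add: universal_cover_def)

lemma cont_p: "continuous_on S p"
  using covering_space_imp_continuous[OF covering] by (rule continuous_on_subset) simp

lemma surj_p: "surj p"
  using covering_space_imp_surjective[OF covering] by simp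

lemma sheet: "\<exists>T q. open T \<and> x \<in> T \<and> open (p ` T) \<and> homeomorphism T (p ` T) p q"
proof -
  obtain T u q where "x \<in> T" "openin (top_of_set UNIV) T" "p x \<in> u" "openin (top_of_set UNIV) u" "homeomorphism T u p q"
    by (rule covering_space_local_homeomorphism[OF covering UNIV_I])
  then show ?thesis by (metis homeomorphism_def open_openin subtopology_UNIV)
qed

lemma local_inj: "\<exists>U. open U \<and> x \<in> U \<and> inj_on p U"
  using sheet[of x] by (metis homeomorphism_def inj_on_inverseI)

lemma chart_cover: "\<exists>W g q. open W \<and> x \<in> W \<and> open (g ` W) \<and> homeomorphism W (g ` W) (g :: 'a \<Rightarrow> real^2) q"
proof -
  obtain T q where T: "open T" "x \<in> T" "open (p ` T)" "homeomorphism T (p ` T) p q" using sheet by blast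
  obtain U and \<psi> :: "'b \<Rightarrow> real^2" where U: "open U" "p x \<in> U" "open (\<psi> ` U)" "homeomorphism U (\<psi> ` U) \<psi> (inv_into U \<psi>)"
    using smooth_atlas_chart[OF atlas] by blast
  let ?W = "T \<inter> p -` U"
  have "open ?W" using T(1) U(1) by (intro continuous_open_preimage cont_p)
  have h1: "homeomorphism ?W (p ` T \<inter> U) p q"
    by (rule homeomorphism_of_subsets[OF T(4)]) auto
  have h2: "homeomorphism (p ` T \<inter> U) (\<psi> ` (p ` T \<inter> U)) \<psi> (inv_into U \<psi>)"
    by (rule homeomorphism_of_subsets[OF U(4)]) auto
  have "openin (top_of_set U) (p ` T \<inter> U)" using T(3) by (simp add: openin_open_Int Int_commute)
  then have "openin (top_of_set (\<psi> ` U)) (\<psi> ` (p ` T \<inter> U))"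
    by (rule homeomorphism_imp_open_map[OF U(4)])
  then have o: "open (\<psi> ` (p ` T \<inter> U))" using U(3) openin_open_eq by blast
  have h: "homeomorphism ?W (\<psi> ` (p ` T \<inter> U)) (\<psi> \<circ> p) (q \<circ> inv_into U \<psi>)"
    by (rule homeomorphism_compose[OF h1 h2])
  then have "(\<psi> \<circ> p) ` ?W = \<psi> ` (p ` T \<inter> U)" by (simp add: homeomorphism_def)
  then show ?thesis using h o \<open>open ?W\<close> T(2) U(2) by (metis IntI vimageI)
qed

lemma invariance_of_domain_cover:
  fixes f :: "'a \<Rightarrow> real^2"
  assumes "continuous_on UNIV f" "inj f" "open S"
  shows "open (f ` S)"
proof (subst open_subopen, intro ballI)
  fix y assume "y \<in> f ` S"
  then obtain x where x: "x \<in> S" "y = f x" by blast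
  obtain W g q where W: "open W" "x \<in> W" "open (g ` W)" "homeomorphism W (g ` W) (g :: 'a \<Rightarrow> real^2) q"
    using chart_cover by blast
  have "openin (top_of_set W) (W \<inter> S)" using assms(3) by (simp add: openin_open_Int)
  then have "openin (top_of_set (g ` W)) (g ` (W \<inter> S))" by (rule homeomorphism_imp_open_map[OF W(4)])
  then have o: "open (g ` (W \<inter> S))" using W(3) openin_open_eq by blast
  have qg: "q (g u) = u" if "u \<in> W" for u using W(4) that by (simp add: homeomorphism_def)
  have "continuous_on (g ` (W \<inter> S)) (f \<circ> q)"
    using W(4) by (intro continuous_on_compose continuous_on_subset[OF assms(1)])
      (auto simp: homeomorphism_def intro: continuous_on_subset)
  moreover have "inj_on (f \<circ> q) (g ` (W \<inter> S))"
    using assms(2) by (auto intro!: inj_onI simp: qg dest: injD)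
  ultimately have "open ((f \<circ> q) ` g ` (W \<inter> S))"
    using o by (intro Further_Topology.invariance_of_domain)
  moreover have "(f \<circ> q) ` g ` (W \<inter> S) = f ` (W \<inter> S)" by (force simp: image_comp qg)
  ultimately show "\<exists>T. open T \<and> y \<in> T \<and> T \<subseteq> f ` S" using x W(2) by (intro exI[of _ "f ` (W \<inter> S)"]) auto
qed

lemma embedding_cover: "\<exists>g. homeomorphism UNIV (range f0) f0 g" and open_range_f0: "open (range f0)"
proof -
  show "open (range f0)" by (rule invariance_of_domain_cover[OF cont_f0 inj_f0]) simp
  have "homeomorphism UNIV (range f0) f0 (inv_into UNIV f0)"
    unfolding homeomorphism_def
  proof (intro conjI)
    show "continuous_on (range f0) (inv_into UNIV f0)"
    proof (rule continuous_on_inverse_open_map[where f = f0 and S = UNIV])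
      fix U assume "openin (top_of_set (UNIV::'a set)) U"
      then have "open (f0 ` U)" by (intro invariance_of_domain_cover[OF cont_f0 inj_f0]) simp
      then show "openin (top_of_set (range f0)) (f0 ` U)" by (intro open_subset) auto
    qed (use cont_f0 inj_f0 in auto)
  qed (use cont_f0 inj_f0 in \<open>auto simp: image_iff\<close>)
  then show "\<exists>g. homeomorphism UNIV (range f0) f0 g" by blast
qed

text \<open>The covering is transported to one between subsets of normed spaces, through
  \<open>f0\<close> above and an embedding \<open>j\<close> of the compact base below; the lift is
  then transported back.\<close>

lemma lift:
  fixes f :: "'c::real_normed_vector \<Rightarrow> 'b"
  assumes S: "simply_connected S" "locally path_connected S" and f: "continuous_on S f"
    and z: "z \<in> S" "f z = p x"
  shows "\<exists>g. continuous_on S g \<and> g z = x \<and> (\<forall>y\<in>S. p (g y) = f y)"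
proof -
  obtain j :: "'b \<Rightarrow> (nat \<Rightarrow>\<^sub>C ((real^2) \<times> real))" where j: "continuous_on UNIV j" "inj j"
    using compact_surface_embedding[OF atlas compact_base] by blast
  obtain j' where j': "homeomorphism UNIV (range j) j j'"
    using homeomorphism_compact[OF compact_base j(1) refl j(2)] by blast
  obtain g0 where g0: "homeomorphism UNIV (range f0) f0 g0" using embedding_cover by blast
  define P where "P = j \<circ> p \<circ> g0"
  have g0f: "g0 (f0 u) = u" for u using g0 by (simp add: homeomorphism_def)
  have "covering_space (range f0) P (range j)"
  proof
    show "continuous_on (range f0) P"
      unfolding P_def using g0 cont_p j(1)
      by (intro continuous_on_compose) (auto simp: homeomorphism_def intro: continuous_on_subset)
    have "g0 ` range f0 = UNIV" using g0 by (simp add: homeomorphism_def)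
    then show "P ` range f0 = range j" unfolding P_def image_comp[symmetric] by (simp only: surj_p)
    fix s assume "s \<in> range j"
    then obtain b where b: "s = j b" by blast
    obtain T v where T: "b \<in> T" "openin (top_of_set UNIV) T" "\<Union>v = UNIV \<inter> p -` T"
      "\<And>u. u \<in> v \<Longrightarrow> openin (top_of_set UNIV) u" "pairwise disjnt v" "\<And>u. u \<in> v \<Longrightarrow> \<exists>q. homeomorphism u T p q"
      using covering unfolding covering_space_def by (metis UNIV_I)
    show "\<exists>T. s \<in> T \<and> openin (top_of_set (range j)) T \<and>
           (\<exists>v. \<Union> v = range f0 \<inter> P -` T \<and> (\<forall>u\<in>v. openin (top_of_set (range f0)) u) \<and>
                pairwise disjnt v \<and> (\<forall>u\<in>v. \<exists>q. homeomorphism u T P q))"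
    proof (intro exI conjI)
      show "s \<in> j ` T" using b T(1) by simp
      show "openin (top_of_set (range j)) (j ` T)" by (rule homeomorphism_imp_open_map[OF j' T(2)])
      show "\<Union> ((`) f0 ` v) = range f0 \<inter> P -` (j ` T)"
      proof -
        have "\<Union> ((`) f0 ` v) = f0 ` (p -` T)" using T(3) by (metis Int_UNIV_left image_Union)
        also have "\<dots> = range f0 \<inter> P -` (j ` T)"
          by (auto simp: P_def g0f inj_eq[OF j(2)])
        finally show ?thesis .
      qed
      show "\<forall>u\<in>(`) f0 ` v. openin (top_of_set (range f0)) u"
        using homeomorphism_imp_open_map[OF g0] T(4) by blast
      show "pairwise disjnt ((`) f0 ` v)"
        unfolding pairwise_def
      proof (intro ballI impI)
        fix x y assume "x \<in> (`) f0 ` v" "y \<in> (`) f0 ` v" "x \<noteq> y"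
        then obtain u w where uw: "u \<in> v" "w \<in> v" "x = f0 ` u" "y = f0 ` w" "u \<noteq> w" by blast
        then have "disjnt u w" using T(5) by (auto simp: pairwise_def)
        then show "disjnt x y" using inj_f0 uw by (auto simp: disjnt_def dest: injD)
      qed
      show "\<forall>u\<in>(`) f0 ` v. \<exists>q. homeomorphism u (j ` T) P q"
      proof
        fix u' assume "u' \<in> (`) f0 ` v"
        then obtain u where u: "u \<in> v" "u' = f0 ` u" by blast
        obtain q where q: "homeomorphism u T p q" using T(6)[OF u(1)] by blast
        have h1: "homeomorphism u' u g0 f0"
          using homeomorphism_of_subsets[OF homeomorphism_symD[OF g0], of u' u] u(2) by (auto simp: image_comp g0f)
        have h2: "homeomorphism T (j ` T) j j'"
          by (rule homeomorphism_of_subsets[OF j']) auto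
        show "\<exists>q. homeomorphism u' (j ` T) P q"
          using homeomorphism_compose[OF homeomorphism_compose[OF h1 q] h2] unfolding P_def comp_assoc by blast
      qed
    qed
  qed
  note cov = this
  have cont: "continuous_on S (j \<circ> f)" by (intro continuous_on_compose f continuous_on_subset[OF j(1)]) auto
  have im: "j \<circ> f \<in> S \<rightarrow> range j" by auto
  have eq: "(j \<circ> f) z = P (f0 x)" using z(2) by (simp add: P_def g0f)
  obtain g where g: "continuous_on S g" "g \<in> S \<rightarrow> range f0" "g z = f0 x" "\<And>y. y \<in> S \<Longrightarrow> P (g y) = (j \<circ> f) y"
    by (rule covering_space_lift_strong[OF cov rangeI z(1) S cont im eq]) blast
  have "continuous_on S (g0 \<circ> g)"
  proof (rule continuous_on_compose[OF g(1) continuous_on_subset])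
    show "continuous_on (range f0) g0" using g0 by (simp add: homeomorphism_def)
    show "g ` S \<subseteq> range f0" using g(2) by auto
  qed
  moreover have "(g0 \<circ> g) z = x" using g(3) by (simp add: g0f)
  moreover have "p ((g0 \<circ> g) y) = f y" if "y \<in> S" for y
    using g(4)[OF that] j(2) by (simp add: P_def inj_eq)
  ultimately show ?thesis by (intro exI[of _ "g0 \<circ> g"]) simp
qed

lemma simply_connected_range_f0: "simply_connected (range f0)"
proof -
  have "(UNIV :: 'a set) homeomorphic range f0"
    using embedding_cover unfolding homeomorphic_def by blast
  then show ?thesis
    by (rule homeomorphic_simply_connected) (use cover in \<open>simp add: universal_cover_def\<close>)
qed

lemma connected_cover: "connected (UNIV :: 'a set)"
proof -
  obtain g where g: "homeomorphism UNIV (range f0) f0 g" using embedding_cover by blast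
  then have c: "continuous_on (range f0) g" and im: "g ` range f0 = UNIV" by (simp_all add: homeomorphism_def)
  show ?thesis
    using connected_continuous_image[OF c simply_connected_imp_connected[OF simply_connected_range_f0]]
    by (simp only: im)
qed

text \<open>The map sought is the lift of \<open>p\<close> itself through \<open>p\<close>, starting
  at \<open>y\<close> over the point \<open>x\<close>; the cover is simply connected.\<close>

lemma deck_exists:
  assumes "p x = p y"
  shows "\<exists>\<gamma>. continuous_on UNIV \<gamma> \<and> p \<circ> \<gamma> = p \<and> \<gamma> x = y"
proof -
  obtain g0 where g0: "homeomorphism UNIV (range f0) f0 g0" using embedding_cover by blast
  have g0f: "g0 (f0 u) = u" for u using g0 by (simp add: homeomorphism_def)
  note simply_connected_range_f0
  moreover have "locally path_connected (range f0)" by (rule open_imp_locally_path_connected[OF open_range_f0])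
  moreover have "continuous_on (range f0) (p \<circ> g0)"
    using g0 by (intro continuous_on_compose cont_p) (auto simp: homeomorphism_def)
  moreover have "(p \<circ> g0) (f0 x) = p y" using assms by (simp add: g0f)
  ultimately obtain g where g: "continuous_on (range f0) g" "g (f0 x) = y" "\<forall>u\<in>range f0. p (g u) = (p \<circ> g0) u"
    using lift[of "range f0" "p \<circ> g0" "f0 x" y] by blast
  have "continuous_on UNIV (g \<circ> f0)" using g(1) cont_f0 by (intro continuous_on_compose)
  moreover have "p \<circ> (g \<circ> f0) = p" using g(3) by (auto simp: g0f)
  ultimately show ?thesis using g(2) by (intro exI[of _ "g \<circ> f0"]) auto
qed

text \<open>The lift with the roles of \<open>x\<close> and \<open>y\<close> exchanged is the
  inverse: both composites fix a point and cover the identity, so they are the identity by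
  uniqueness.\<close>

lemma deck:
  assumes "p x = p y"
  shows "\<exists>\<gamma>\<in>carrier (pi1 p). \<gamma> x = y"
proof -
  obtain \<gamma> where g: "continuous_on UNIV \<gamma>" "p \<circ> \<gamma> = p" "\<gamma> x = y" using deck_exists[OF assms] by blast
  obtain \<delta> where d: "continuous_on UNIV \<delta>" "p \<circ> \<delta> = p" "\<delta> y = x" using deck_exists[OF assms[symmetric]] by blast
  have id: "(\<alpha> \<circ> \<beta>) u = id u" if "continuous_on UNIV \<alpha>" "continuous_on UNIV \<beta>" "p \<circ> \<alpha> = p" "p \<circ> \<beta> = p" "\<alpha> (\<beta> z) = z" for \<alpha> \<beta> z u
  proof (rule unique_lift[OF local_inj connected_cover, where g = "\<alpha> \<circ> \<beta>" and g' = id and a = z])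
    show "continuous_on UNIV (\<alpha> \<circ> \<beta>)" using that(1,2) by (metis continuous_on_compose continuous_on_subset subset_UNIV)
    show "p ((\<alpha> \<circ> \<beta>) v) = p (id v)" for v using fun_cong[OF that(3), of "\<beta> v"] fun_cong[OF that(4), of v] by simp
    show "(\<alpha> \<circ> \<beta>) z = id z" using that(5) by simp
  qed (auto simp: continuous_on_id)
  have "\<gamma> (\<delta> u) = u" "\<delta> (\<gamma> u) = u" for u
    using id[OF g(1) d(1) g(2) d(2), of y u] id[OF d(1) g(1) d(2) g(2), of x u] g(3) d(3) by auto
  then have "homeomorphism UNIV UNIV \<gamma> \<delta>"
    using g(1) d(1) by (intro homeomorphismI) auto
  then show ?thesis using g(2,3) by (auto simp: pi1_def)
qed

end

section \<open>Cells of the universal cover\<close>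

lemma finite_Union_closed_empty_interior:
  assumes "finite \<F>" "\<And>S. S \<in> \<F> \<Longrightarrow> closed S \<and> interior S = {}"
  shows "interior (\<Union>\<F>) = {}"
  using assms
proof (induction \<F> rule: finite_induct)
  case (insert S \<F>)
  then have "closed S" "interior S = {}" "interior (\<Union>\<F>) = {}" by auto
  then show ?case using interior_closed_Un_empty_interior[of S "\<Union>\<F>"] by simp
qed simp

locale decomposed_cover = surface_cover p A f0
  for p :: "'a::t2_space \<Rightarrow> 'b::t2_space" and A :: "'b atlas" and f0 :: "'a \<Rightarrow> real^2" +
  fixes D :: "nat \<Rightarrow> 'b set set"
  assumes decomposition: "cell_decomposition A D"
begin

lemma finite_D: "finite (D k)" and D_empty: "k > 2 \<Longrightarrow> D k = {}"
  and disjoint_D: "disjoint (\<Union>k. D k)" and Union_D: "\<Union>(\<Union>k. D k) = UNIV"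
  using decomposition by (auto simp: cell_decomposition_def)

definition char_map :: "nat \<Rightarrow> 'b set \<Rightarrow> (real^2) set \<Rightarrow> (real^2 \<Rightarrow> 'b) \<Rightarrow> bool" where
  "char_map k C P h \<longleftrightarrow> polytope P \<and> aff_dim P = int k \<and> continuous_on P h \<and>
     (\<exists>h'. homeomorphism (rel_interior P) C h h') \<and> h ` rel_frontier P \<subseteq> \<Union>(\<Union>j<k. D j)"

lemma char_map_exists: "C \<in> D k \<Longrightarrow> \<exists>P h. char_map k C P h"
  using decomposition unfolding cell_decomposition_def char_map_def by blast

lemma char_mapD:
  assumes "char_map k C P h"
  shows "compact P" "convex P" "P \<noteq> {}" "rel_interior P \<noteq> {}" "closure (rel_interior P) = P" "continuous_on P h"
    "h ` rel_interior P = C" "inj_on h (rel_interior P)" "rel_interior P \<subseteq> P" "h ` P \<subseteq> C \<union> \<Union>(\<Union>j<k. D j)"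
    "compact (h ` P)" "C \<subseteq> h ` P"
proof -
  show 1: "compact P" "convex P" using assms by (auto simp: char_map_def polytope_imp_compact polytope_imp_convex)
  have "aff_dim P \<noteq> -1" using assms by (auto simp: char_map_def)
  then show 2: "P \<noteq> {}" by auto
  then show "rel_interior P \<noteq> {}" using 1 by (simp add: rel_interior_eq_empty)
  show "closure (rel_interior P) = P"
    using 1 convex_closure_rel_interior[of P] by (simp add: compact_imp_closed)
  show 3: "continuous_on P h" using assms by (simp add: char_map_def)
  obtain h' where h': "homeomorphism (rel_interior P) C h h'" using assms by (auto simp: char_map_def)
  show 4: "h ` rel_interior P = C" using h' by (simp add: homeomorphism_def)
  show "inj_on h (rel_interior P)" using h' by (metis homeomorphism_def inj_on_inverseI)
  show 5: "rel_interior P \<subseteq> P" by (rule rel_interior_subset)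
  have "P = rel_interior P \<union> rel_frontier P" using 1 5 by (auto simp: rel_frontier_def compact_imp_closed)
  then have eq: "h ` P = C \<union> h ` rel_frontier P" using 4 by (metis image_Un)
  have "h ` rel_frontier P \<subseteq> \<Union>(\<Union>j<k. D j)" using assms by (simp add: char_map_def)
  then show "h ` P \<subseteq> C \<union> \<Union>(\<Union>j<k. D j)" unfolding eq by (rule Un_mono[OF subset_refl])
  show "compact (h ` P)" using 1 3 by (simp add: compact_continuous_image)
  show "C \<subseteq> h ` P" using 4 5 by blast
qed

lemma D0_singleton:
  assumes "C \<in> D 0" shows "\<exists>b. C = {b}"
proof -
  obtain P h where P: "char_map 0 C P h" using char_map_exists[OF assms] by blast
  then obtain a where "P = {a}" by (auto simp: char_map_def aff_dim_eq_0)
  then show ?thesis using char_mapD(7)[OF P] by auto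
qed

lemma finite_D0: "finite (\<Union>(D 0))"
  using finite_D D0_singleton by (intro finite_Union) (auto dest!: D0_singleton)

lemma open_D2: "C \<in> D 2 \<Longrightarrow> open C"
  using decomposition unfolding cell_decomposition_def diffeomorphism_onto_def by blast

lemma infinite_open_base:
  assumes "open W" "b \<in> W" shows "infinite (W :: 'b set)"
proof
  assume fin: "finite W"
  obtain U and \<psi> :: "'b \<Rightarrow> real^2" where U: "open U" "b \<in> U" "open (\<psi> ` U)" "homeomorphism U (\<psi> ` U) \<psi> (inv_into U \<psi>)"
    using smooth_atlas_chart[OF atlas] by blast
  have "openin (top_of_set U) (U \<inter> W)" using assms(1) by (simp add: openin_open_Int)
  then have "openin (top_of_set (\<psi> ` U)) (\<psi> ` (U \<inter> W))" by (rule homeomorphism_imp_open_map[OF U(4)])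
  then have "open (\<psi> ` (U \<inter> W))" using U(3) openin_open_eq by blast
  moreover have "finite (\<psi> ` (U \<inter> W))" "\<psi> ` (U \<inter> W) \<noteq> {}" using fin U(2) assms(2) by auto
  ultimately show False using finite_imp_not_open by blast
qed

text \<open>Nonempty open sets are infinite, so removing the finitely many vertices from the
  interior would leave a nonempty open part of the cell. By invariance of domain it would correspond
  to an open set of the plane inside a segment.\<close>

lemma low_cell_empty_interior:
  assumes "C \<in> D k" "k < 2" "char_map k C P h"
  shows "interior (h ` P) = {}"
proof (rule ccontr)
  assume "interior (h ` P) \<noteq> {}"
  then obtain b where b: "b \<in> interior (h ` P)" by blast
  define W where "W = interior (h ` P) - \<Union>(D 0)"
  have oW: "open W" unfolding W_def using finite_D0 by (intro open_Diff) (auto simp: finite_imp_closed)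
  have "W \<noteq> {}"
    using infinite_open_base[OF open_interior b] finite_D0 unfolding W_def by (metis Diff_eq_empty_iff finite_subset)
  then obtain w where w: "w \<in> W" by blast
  have "(\<Union>j<k. D j) \<subseteq> D 0"
  proof
    fix E assume "E \<in> (\<Union>j<k. D j)"
    then obtain j where j: "j < k" "E \<in> D j" by blast
    then have "j = 0" using assms(2) by linarith
    then show "E \<in> D 0" using j(2) by simp
  qed
  then have sub: "\<Union>(\<Union>j<k. D j) \<subseteq> \<Union>(D 0)" by (rule Union_mono)
  have WC: "W \<subseteq> C"
  proof
    fix y assume "y \<in> W"
    then have "y \<in> h ` P" "y \<notin> \<Union>(D 0)" using interior_subset[of "h ` P"] unfolding W_def by auto
    then show "y \<in> C" using subsetD[OF char_mapD(10)[OF assms(3)], of y] subsetD[OF sub, of y] by (metis UnE)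
  qed
  have "k \<noteq> 0"
  proof
    assume "k = 0"
    then have "w \<in> \<Union>(D 0)" using WC w assms(1) by blast
    then show False using w by (simp add: W_def)
  qed
  then have k: "k = 1" using assms(2) by simp
  obtain h' where h': "homeomorphism (rel_interior P) C h h'" using assms(3) by (auto simp: char_map_def)
  obtain U and \<psi> :: "'b \<Rightarrow> real^2" where U: "open U" "w \<in> U" "open (\<psi> ` U)" "homeomorphism U (\<psi> ` U) \<psi> (inv_into U \<psi>)"
    using smooth_atlas_chart[OF atlas] by blast
  have "openin (top_of_set U) (U \<inter> W)" using oW by (simp add: openin_open_Int)
  then have "openin (top_of_set (\<psi> ` U)) (\<psi> ` (U \<inter> W))" by (rule homeomorphism_imp_open_map[OF U(4)])
  then have o: "open (\<psi> ` (U \<inter> W))" using U(3) openin_open_eq by blast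
  let ?q = "inv_into U \<psi>"
  have q: "?q (\<psi> u) = u" if "u \<in> U" for u using U(4) that by (simp add: homeomorphism_def)
  have hh: "h' u \<in> rel_interior P" "h (h' u) = u" if "u \<in> C" for u using h' that by (auto simp: homeomorphism_def)
  have "continuous_on (\<psi> ` (U \<inter> W)) (h' \<circ> ?q)"
  proof (rule continuous_on_compose)
    show "continuous_on (\<psi> ` (U \<inter> W)) ?q"
      using U(4) by (auto simp: homeomorphism_def intro: continuous_on_subset)
    have "?q ` \<psi> ` (U \<inter> W) \<subseteq> C" using q WC by auto
    moreover have "continuous_on C h'" using h' by (simp add: homeomorphism_def)
    ultimately show "continuous_on (?q ` \<psi> ` (U \<inter> W)) h'" by (rule continuous_on_subset[rotated])
  qed
  moreover have "inj_on (h' \<circ> ?q) (\<psi> ` (U \<inter> W))"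
  proof (rule inj_onI)
    fix x y assume "x \<in> \<psi> ` (U \<inter> W)" "y \<in> \<psi> ` (U \<inter> W)" "(h' \<circ> ?q) x = (h' \<circ> ?q) y"
    then obtain u v where uv: "u \<in> U" "v \<in> U" "u \<in> W" "v \<in> W" "x = \<psi> u" "y = \<psi> v" by blast
    have "h' u = h' v" using \<open>(h' \<circ> ?q) x = (h' \<circ> ?q) y\<close> q uv by simp
    then have "u = v" using hh(2) WC uv(3,4) by (metis subsetD)
    then show "x = y" using uv by simp
  qed
  ultimately have "open ((h' \<circ> ?q) ` \<psi> ` (U \<inter> W))" by (intro Further_Topology.invariance_of_domain o)
  moreover have "(h' \<circ> ?q) ` \<psi> ` (U \<inter> W) \<subseteq> P" using q WC hh rel_interior_subset[of P] by fastforce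
  moreover have "(h' \<circ> ?q) ` \<psi> ` (U \<inter> W) \<noteq> {}" using U(2) w by blast
  ultimately have "interior P \<noteq> {}" using interior_maximal by blast
  then have "aff_dim P = 2" using aff_dim_nonempty_interior[of P] by simp
  then show False using assms(3) k by (simp add: char_map_def)
qed

lemma Union_D_cases: "b \<in> \<Union>(D 0) \<or> b \<in> \<Union>(D 1) \<or> b \<in> \<Union>(D 2)"
proof -
  have "b \<in> \<Union>(\<Union>k. D k)" unfolding Union_D by simp
  then obtain k C where kC: "C \<in> D k" "b \<in> C" by blast
  have "k \<le> 2" using D_empty[of k] kC by force
  then have "k = 0 \<or> k = 1 \<or> k = 2" by auto
  then show ?thesis using kC by blast
qed

text \<open>The complement of the finitely many closed 2-cells is open, and it is contained in a
  finite union of closed sets with empty interior, the closed cells of lower dimension.\<close>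

lemma base_covered:
  assumes "\<And>C. C \<in> D 2 \<Longrightarrow> char_map 2 C (P C) (h C)"
  shows "(\<Union>C\<in>D 2. h C ` P C) = UNIV"
proof (rule ccontr)
  let ?F = "\<Union>C\<in>D 2. h C ` P C"
  assume "?F \<noteq> UNIV"
  then have ne: "- ?F \<noteq> {}" by blast
  have "closed (h C ` P C)" if "C \<in> D 2" for C
    using char_mapD(11)[OF assms[OF that]] by (rule compact_imp_closed)
  then have "closed ?F" using finite_D by (intro closed_UN) auto
  then have op: "open (- ?F)" by (rule open_Compl)
  have "\<forall>x \<in> {0,1} \<times> UNIV. \<exists>S. snd x \<in> D (fst x) \<longrightarrow> (snd x \<subseteq> S \<and> closed S \<and> interior S = {})"
  proof clarify
    fix k :: nat and C :: "'b set" assume "k \<in> {0,1}"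
    show "\<exists>S. snd (k, C) \<in> D (fst (k, C)) \<longrightarrow> (snd (k, C) \<subseteq> S \<and> closed S \<and> interior S = {})"
    proof (cases "C \<in> D k")
      case True
      then obtain P h where P: "char_map k C P h" using char_map_exists by blast
      have "interior (h ` P) = {}" using \<open>k \<in> {0,1}\<close> by (intro low_cell_empty_interior[OF True _ P]) auto
      then show ?thesis using char_mapD(11,12)[OF P] by (auto simp: compact_imp_closed)
    qed auto
  qed
  then obtain S where S: "\<And>k C. k \<in> {0,1} \<Longrightarrow> C \<in> D k \<Longrightarrow> C \<subseteq> S (k, C) \<and> closed (S (k, C)) \<and> interior (S (k, C)) = {}"
    by (metis (no_types, lifting) SigmaI UNIV_I fst_conv snd_conv)
  define \<F> where "\<F> = (\<lambda>C. S (0, C)) ` D 0 \<union> (\<lambda>C. S (1, C)) ` D 1"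
  have "finite \<F>" using finite_D by (simp add: \<F>_def)
  then have "interior (\<Union>\<F>) = {}" by (rule finite_Union_closed_empty_interior) (use S in \<open>auto simp: \<F>_def\<close>)
  moreover have "- ?F \<subseteq> \<Union>\<F>"
  proof
    fix b assume b: "b \<in> - ?F"
    have "b \<notin> \<Union>(D 2)"
    proof
      assume "b \<in> \<Union>(D 2)"
      then obtain C where C: "C \<in> D 2" "b \<in> C" by blast
      then have "b \<in> h C ` P C" using subsetD[OF char_mapD(12)[OF assms[OF C(1)]]] by blast
      then show False using b C(1) by simp
    qed
    then have "(\<exists>C\<in>D 0. b \<in> C) \<or> (\<exists>C\<in>D 1. b \<in> C)" using Union_D_cases[of b] by blast
    then show "b \<in> \<Union>\<F>"
    proof (elim disjE bexE)
      fix C assume "C \<in> D 0" "b \<in> C"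
      then have "b \<in> S (0, C)" "S (0, C) \<in> \<F>" using S[of 0 C] by (auto simp: \<F>_def)
      then show ?thesis by blast
    next
      fix C assume "C \<in> D 1" "b \<in> C"
      then have "b \<in> S (1, C)" "S (1, C) \<in> \<F>" using S[of 1 C] by (auto simp: \<F>_def)
      then show ?thesis by blast
    qed
  qed
  ultimately show False using interior_maximal[OF _ op] ne by blast
qed

subsection \<open>Lifted cells\<close>

definition is_lift :: "(real^2) set \<Rightarrow> (real^2 \<Rightarrow> 'b) \<Rightarrow> (real^2 \<Rightarrow> 'a) \<Rightarrow> bool" where
  "is_lift P h g \<longleftrightarrow> continuous_on P g \<and> (\<forall>k\<in>P. p (g k) = h k)"

lemma lift_through:
  assumes "char_map n C P h" "k \<in> P" "h k = p x"
  shows "\<exists>g. is_lift P h g \<and> g k = x"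
  unfolding is_lift_def
  using lift[OF convex_imp_simply_connected[OF char_mapD(2)[OF assms(1)]]
      convex_imp_locally_path_connected[OF char_mapD(2)[OF assms(1)]] char_mapD(6)[OF assms(1)] assms(2,3)]
  by (elim exE) auto

lemma lift_eq:
  assumes "char_map n C P h" "is_lift P h g" "is_lift P h g'" "k \<in> P" "g k = g' k" "l \<in> P"
  shows "g l = g' l"
proof (rule unique_lift[OF local_inj, where T = P and a = k])
  show "connected P" using char_mapD(2)[OF assms(1)] by (rule convex_connected)
qed (use assms in \<open>auto simp: is_lift_def\<close>)

lemma lift_image_eq:
  assumes "char_map n C P h" "is_lift P h g" "is_lift P h g'" "k \<in> P" "g k = g' k"
  shows "g ` P = g' ` P"
  using lift_eq[OF assms] by (intro image_cong) auto

lemma lift_interior_open: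
  assumes "char_map 2 C P h" "C \<in> D 2" "is_lift P h g"
  shows "open (g ` rel_interior P)"
proof (subst open_subopen, intro ballI)
  let ?I = "rel_interior P"
  fix x assume "x \<in> g ` ?I"
  then obtain k where k: "k \<in> ?I" "x = g k" by blast
  obtain U where U: "open U" "x \<in> U" "inj_on p U" using local_inj by blast
  obtain h' where h': "homeomorphism ?I C h h'" using assms(1) by (auto simp: char_map_def)
  have IP: "?I \<subseteq> P" by (rule rel_interior_subset)
  have "continuous_on ?I g" using assms(3) IP by (auto simp: is_lift_def intro: continuous_on_subset)
  then have "openin (top_of_set ?I) (?I \<inter> g -` U)" using U(1) by (rule continuous_openin_preimage_gen)
  then have "openin (top_of_set C) (h ` (?I \<inter> g -` U))" by (rule homeomorphism_imp_open_map[OF h'])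
  then have oh: "open (h ` (?I \<inter> g -` U))" using open_D2[OF assms(2)] openin_open_eq by blast
  let ?W = "U \<inter> p -` (h ` (?I \<inter> g -` U))"
  have "open ?W" using U(1) oh by (intro continuous_open_preimage cont_p)
  moreover have "x \<in> ?W" using k U IP assms(3) by (auto simp: is_lift_def)
  moreover have "?W \<subseteq> g ` ?I"
  proof
    fix w assume "w \<in> ?W"
    then obtain l where l: "w \<in> U" "l \<in> ?I" "g l \<in> U" "p w = h l" by auto
    then have "p (g l) = p w" using assms(3) IP by (auto simp: is_lift_def)
    then have "g l = w" by (rule inj_onD[OF U(3) _ l(3) l(1)])
    then show "w \<in> g ` ?I" using l by blast
  qed
  ultimately show "\<exists>T. open T \<and> x \<in> T \<and> T \<subseteq> g ` ?I" by blast
qed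

lemma lift_interior_cases:
  assumes "char_map 2 C P h" "is_lift P h g" "is_lift P h g'" "g ` rel_interior P \<inter> g' ` rel_interior P \<noteq> {}"
  shows "g ` rel_interior P = g' ` rel_interior P" "g ` P = g' ` P"
proof -
  note c = char_mapD[OF assms(1)]
  obtain k l where kl: "k \<in> rel_interior P" "l \<in> rel_interior P" "g k = g' l" using assms(4) by auto
  then have "h k = h l" using assms(2,3) c(9) by (metis is_lift_def subsetD)
  then have "k = l" using c(8) kl by (auto dest: inj_onD)
  then have eq: "g m = g' m" if "m \<in> P" for m using lift_eq[OF assms(1-3), of k] kl c(9) that by auto
  then show "g ` rel_interior P = g' ` rel_interior P" "g ` P = g' ` P" using c(9) by (auto intro!: image_cong)
qed

text \<open>The images of the open polygon under the lifts of the characteristic map are open and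
  connected, cover the preimage of the cell, and are pairwise equal or disjoint.\<close>

lemma lift_component:
  assumes C: "char_map 2 C P h" "C \<in> D 2"
  shows "components (p -` C) = {g ` rel_interior P | g. is_lift P h g}"
proof -
  let ?I = "rel_interior P"
  note c = char_mapD[OF C(1)]
  have conn: "connected (g ` ?I)" if "is_lift P h g" for g
    using that c by (intro connected_continuous_image)
      (auto simp: is_lift_def intro: continuous_on_subset convex_connected convex_rel_interior)
  have sub: "g ` ?I \<subseteq> p -` C" if "is_lift P h g" for g using that c(7,9) by (auto simp: is_lift_def)
  have through: "\<exists>g. is_lift P h g \<and> x \<in> g ` ?I" if x: "x \<in> p -` C" for x
  proof -
    have "p x \<in> h ` ?I" using x c(7) by simp
    then obtain k where k: "k \<in> ?I" "h k = p x" by (metis imageE)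
    then obtain g where "is_lift P h g" "g k = x" using lift_through[OF C(1) subsetD[OF c(9)]] by metis
    then show ?thesis using k(1) by blast
  qed
  have one: "T = g ` ?I" if T: "T \<in> components (p -` C)" and g: "is_lift P h g" and meet: "g ` ?I \<inter> T \<noteq> {}" for T g
  proof
    show "g ` ?I \<subseteq> T"
      by (rule components_maximal[OF T conn[OF g] sub[OF g]]) (use meet in auto)
    \<comment> \<open>The union of all the other lifted interiors: an open set disjoint from the
      chosen one, so that a connected component cannot meet both.\<close>
    define N where "N = \<Union>{g' ` ?I | g'. is_lift P h g' \<and> g' ` ?I \<noteq> g ` ?I}"
    have o1: "open N" unfolding N_def using lift_interior_open[OF C] by (intro open_Union) auto
    have o2: "open (g ` ?I)" by (rule lift_interior_open[OF C g])
    have dis: "g ` ?I \<inter> N \<inter> T = {}" unfolding N_def using lift_interior_cases(1)[OF C(1) g] by blast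
    have cov: "T \<subseteq> g ` ?I \<union> N"
    proof
      fix x assume "x \<in> T"
      then have "x \<in> p -` C" using in_components_subset[OF T] by blast
      then obtain g' where g': "is_lift P h g'" "x \<in> g' ` ?I" using through by blast
      then show "x \<in> g ` ?I \<union> N"
        by (cases "g' ` ?I = g ` ?I") (auto simp: N_def intro!: exI[of _ "g' ` ?I"])
    qed
    have "g ` ?I \<inter> T = {} \<or> N \<inter> T = {}"
      by (rule connectedD[OF in_components_connected[OF T] o2 o1 dis cov])
    then show "T \<subseteq> g ` ?I" using cov meet by blast
  qed
  show ?thesis
  proof (intro equalityI subsetI)
    fix T assume T: "T \<in> components (p -` C)"
    then obtain x where x: "x \<in> T" using in_components_nonempty by blast
    then obtain g where "is_lift P h g" "x \<in> g ` ?I" using through in_components_subset[OF T] by blast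
    then have "T = g ` ?I" "is_lift P h g" using one[OF T] x by blast+
    then show "T \<in> {g ` ?I | g. is_lift P h g}" by blast
  next
    fix T assume "T \<in> {g ` ?I | g. is_lift P h g}"
    then obtain g where g: "is_lift P h g" "T = g ` ?I" by blast
    obtain k where k: "k \<in> ?I" using c(4) by blast
    then have "g k \<in> p -` C" using sub[OF g(1)] by blast
    then obtain S where S: "S \<in> components (p -` C)" "g k \<in> S" by (metis UnionE Union_components)
    then have "S = g ` ?I" using one[OF S(1) g(1)] k by blast
    then show "T \<in> components (p -` C)" using S(1) g(2) by simp
  qed
qed

lemma lift_closure:
  assumes "char_map 2 C P h" "is_lift P h g"
  shows "closure (g ` rel_interior P) = g ` P" "compact (g ` P)"
proof -
  note c = char_mapD[OF assms(1)]
  have g: "continuous_on P g" using assms(2) by (simp add: is_lift_def)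
  show cp: "compact (g ` P)" using g c(1) by (rule compact_continuous_image)
  have "g ` closure (rel_interior P) \<subseteq> closure (g ` rel_interior P)"
    by (rule image_closure_subset) (use g c in \<open>auto simp: closure_subset\<close>)
  moreover have "closure (g ` rel_interior P) \<subseteq> g ` P"
    using cp c(9) by (intro closure_minimal) (auto simp: compact_imp_closed)
  ultimately show "closure (g ` rel_interior P) = g ` P" using c(5) by auto
qed

definition cells :: "'a set set" where
  "cells = {closure T | C T. C \<in> D 2 \<and> T \<in> components (p -` C)}"

definition char_dom :: "'b set \<Rightarrow> (real^2) set" where
  "char_dom C = fst (SOME Ph. char_map 2 C (fst Ph) (snd Ph))"

definition char_fun :: "'b set \<Rightarrow> real^2 \<Rightarrow> 'b" where
  "char_fun C = snd (SOME Ph. char_map 2 C (fst Ph) (snd Ph))"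

lemma char_map_choice: "C \<in> D 2 \<Longrightarrow> char_map 2 C (char_dom C) (char_fun C)"
  unfolding char_dom_def char_fun_def by (rule someI_ex) (use char_map_exists[of C 2] in auto)

lemma cells_eq: "cells = {g ` char_dom C | C g. C \<in> D 2 \<and> is_lift (char_dom C) (char_fun C) g}"
proof (intro equalityI subsetI)
  fix K assume "K \<in> cells"
  then obtain C T where T: "K = closure T" "C \<in> D 2" "T \<in> components (p -` C)" unfolding cells_def by blast
  then obtain g where g: "is_lift (char_dom C) (char_fun C) g" "T = g ` rel_interior (char_dom C)"
    using lift_component[OF char_map_choice[OF T(2)] T(2)] by auto
  then have "K = g ` char_dom C" using lift_closure(1)[OF char_map_choice[OF T(2)] g(1)] T(1) by simp
  then show "K \<in> {g ` char_dom C | C g. C \<in> D 2 \<and> is_lift (char_dom C) (char_fun C) g}" using T(2) g(1) by blast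
next
  fix K assume "K \<in> {g ` char_dom C | C g. C \<in> D 2 \<and> is_lift (char_dom C) (char_fun C) g}"
  then obtain C g where g: "K = g ` char_dom C" "C \<in> D 2" "is_lift (char_dom C) (char_fun C) g" by blast
  have "g ` rel_interior (char_dom C) \<in> components (p -` C)" unfolding lift_component[OF char_map_choice[OF g(2)] g(2)] using g(3) by blast
  then show "K \<in> cells" unfolding cells_def using lift_closure(1)[OF char_map_choice[OF g(2)] g(3)] g(1,2) by blast
qed

lemma compact_cells: "K \<in> cells \<Longrightarrow> compact K"
  using lift_closure(2)[OF char_map_choice] by (auto simp: cells_eq)

lemma cells_cover: "\<exists>K\<in>cells. x \<in> K"
proof -
  have "p x \<in> (\<Union>C\<in>D 2. char_fun C ` char_dom C)" using base_covered[of char_dom char_fun] char_map_choice by simp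
  then obtain C k where C: "C \<in> D 2" "k \<in> char_dom C" "char_fun C k = p x" by auto
  then obtain g where "is_lift (char_dom C) (char_fun C) g" "g k = x" using lift_through[OF char_map_choice] by blast
  then show ?thesis using C by (auto simp: cells_eq intro!: bexI[of _ "g ` char_dom C"])
qed

text \<open>If \<open>h k\<close> differs from \<open>p x\<close>, disjoint neighbourhoods keep all
  lifts away from \<open>x\<close>. Otherwise take an evenly covered neighbourhood of
  \<open>p x\<close>: a small connected piece of the lift that meets the sheet of \<open>x\<close>
  lies in this sheet, so two such lifts agree at \<open>k\<close>.\<close>

lemma lifts_separated:
  assumes "char_map n C P h" "k \<in> P"
  shows "\<exists>B U. open B \<and> k \<in> B \<and> open U \<and> x \<in> U \<and>
    (\<forall>g g'. is_lift P h g \<and> is_lift P h g' \<and> g ` (P \<inter> B) \<inter> U \<noteq> {} \<and> g' ` (P \<inter> B) \<inter> U \<noteq> {} \<longrightarrow> g ` P = g' ` P)"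
proof (cases "h k = p x")
  case False
  then obtain V V' where V: "open V" "open V'" "h k \<in> V" "p x \<in> V'" "V \<inter> V' = {}" using hausdorff by metis
  obtain B where B: "open B" "k \<in> B" "h ` (P \<inter> B) \<subseteq> V"
    using char_mapD(6)[OF assms(1)] assms(2) V(1,3) unfolding continuous_on_topological by (metis IntE image_subsetI)
  have "g ` (P \<inter> B) \<inter> p -` V' = {}" if "is_lift P h g" for g
    using that B(3) V(5) by (fastforce simp: is_lift_def)
  moreover have "open (p -` V')" using V(2) cont_p by (simp add: open_vimage)
  ultimately show ?thesis using B V(4) by (intro exI[of _ B] exI[of _ "p -` V'"]) auto
next
  case True
  obtain T v where T: "p x \<in> T" "openin (top_of_set UNIV) T" "\<Union>v = UNIV \<inter> p -` T"
    "\<And>u. u \<in> v \<Longrightarrow> openin (top_of_set UNIV) u" "pairwise disjnt v" "\<And>u. u \<in> v \<Longrightarrow> \<exists>q. homeomorphism u T p q"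
    using covering unfolding covering_space_def by (metis UNIV_I)
  obtain U where U: "U \<in> v" "x \<in> U" using T(1,3) by blast
  have oU: "open U" "open (\<Union>(v - {U}))" using T(4) U(1) by auto
  have injU: "inj_on p U" using T(6)[OF U(1)] by (metis homeomorphism_def inj_on_inverseI)
  have "open T" using T(2) by simp
  then obtain B' where B': "open B'" "k \<in> B'" "h ` (P \<inter> B') \<subseteq> T"
    using char_mapD(6)[OF assms(1)] assms(2) T(1) True unfolding continuous_on_topological by (metis IntE image_subsetI)
  then obtain e where e: "e > 0" "ball k e \<subseteq> B'" using openE by blast
  have inU: "g k \<in> U" if g: "is_lift P h g" "g ` (P \<inter> ball k e) \<inter> U \<noteq> {}" for g
  proof -
    let ?S = "g ` (P \<inter> ball k e)"
    have "connected (P \<inter> ball k e)" using char_mapD(2)[OF assms(1)] by (intro convex_connected convex_Int) auto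
    then have conn: "connected ?S"
      using g(1) by (intro connected_continuous_image) (auto simp: is_lift_def intro: continuous_on_subset)
    have cov: "?S \<subseteq> U \<union> \<Union>(v - {U})"
    proof -
      have "?S \<subseteq> p -` T" using g(1) B'(3) e(2) by (fastforce simp: is_lift_def)
      then show ?thesis using T(3) by blast
    qed
    have dis: "U \<inter> \<Union>(v - {U}) \<inter> ?S = {}" using T(5) U(1) by (auto simp: pairwise_def disjnt_def)
    have "U \<inter> ?S = {} \<or> \<Union>(v - {U}) \<inter> ?S = {}" by (rule connectedD[OF conn oU dis cov])
    moreover have "g k \<in> ?S" using assms(2) e(1) by auto
    ultimately show ?thesis using cov g(2) by blast
  qed
  have "g ` P = g' ` P" if "is_lift P h g" "is_lift P h g'" "g ` (P \<inter> ball k e) \<inter> U \<noteq> {}" "g' ` (P \<inter> ball k e) \<inter> U \<noteq> {}" for g g'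
  proof (rule lift_image_eq[OF assms(1) that(1,2) assms(2)])
    have "p (g k) = p (g' k)" using that(1,2) assms(2) by (simp add: is_lift_def)
    then show "g k = g' k" using injU inU that by (auto dest: inj_onD)
  qed
  then show ?thesis using e(1) oU(1) U(2) by (intro exI[of _ "ball k e"] exI[of _ U]) auto
qed

lemma finite_at_most_one: "(\<And>x y. x \<in> S \<Longrightarrow> y \<in> S \<Longrightarrow> x = y) \<Longrightarrow> finite S"
  by (metis finite.emptyI finite.insertI finite_subset insert_iff subsetI)

text \<open>By compactness of the polygon, finitely many pieces from \<open>lifts_separated\<close>
  suffice, and each of them allows at most one lifted cell near \<open>x\<close>.\<close>

lemma lifts_locally_finite:
  assumes "char_map n C P h"
  shows "\<exists>U. open U \<and> x \<in> U \<and> finite {g ` P | g. is_lift P h g \<and> g ` P \<inter> U \<noteq> {}}"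
proof -
  have "\<forall>k. \<exists>B U. k \<in> P \<longrightarrow> open B \<and> k \<in> B \<and> open U \<and> x \<in> U \<and>
    (\<forall>g g'. is_lift P h g \<and> is_lift P h g' \<and> g ` (P \<inter> B) \<inter> U \<noteq> {} \<and> g' ` (P \<inter> B) \<inter> U \<noteq> {} \<longrightarrow> g ` P = g' ` P)"
  proof
    fix k show "\<exists>B U. k \<in> P \<longrightarrow> open B \<and> k \<in> B \<and> open U \<and> x \<in> U \<and>
      (\<forall>g g'. is_lift P h g \<and> is_lift P h g' \<and> g ` (P \<inter> B) \<inter> U \<noteq> {} \<and> g' ` (P \<inter> B) \<inter> U \<noteq> {} \<longrightarrow> g ` P = g' ` P)"
    proof (cases "k \<in> P")
      case True
      show ?thesis using lifts_separated[OF assms True, of x] by (simp only: True simp_thms)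
    qed simp
  qed
  then obtain B U where BU: "\<And>k. k \<in> P \<Longrightarrow> open (B k) \<and> k \<in> B k \<and> open (U k) \<and> x \<in> U k"
    "\<And>k g g'. k \<in> P \<Longrightarrow> is_lift P h g \<Longrightarrow> is_lift P h g' \<Longrightarrow> g ` (P \<inter> B k) \<inter> U k \<noteq> {} \<Longrightarrow>
       g' ` (P \<inter> B k) \<inter> U k \<noteq> {} \<Longrightarrow> g ` P = g' ` P" by metis
  have cov: "P \<subseteq> (\<Union>k\<in>P. B k)" using BU(1) by blast
  obtain X where X: "X \<subseteq> P" "finite X" "P \<subseteq> (\<Union>k\<in>X. B k)"
    by (rule compactE_image[OF char_mapD(1)[OF assms] _ cov]) (use BU(1) in auto)
  let ?U = "\<Inter>k\<in>X. U k"
  have "open ?U" "x \<in> ?U" using X BU(1) by (auto intro!: open_INT)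
  moreover have "finite {g ` P | g. is_lift P h g \<and> g ` P \<inter> ?U \<noteq> {}}"
  proof (rule finite_subset)
    show "{g ` P | g. is_lift P h g \<and> g ` P \<inter> ?U \<noteq> {}} \<subseteq> (\<Union>k\<in>X. {g ` P | g. is_lift P h g \<and> g ` (P \<inter> B k) \<inter> U k \<noteq> {}})"
    proof
      fix S assume "S \<in> {g ` P | g. is_lift P h g \<and> g ` P \<inter> ?U \<noteq> {}}"
      then obtain g l where g: "S = g ` P" "is_lift P h g" "l \<in> P" "g l \<in> ?U" by auto
      then obtain k where "k \<in> X" "l \<in> B k" using X(3) by blast
      then have "g ` (P \<inter> B k) \<inter> U k \<noteq> {}" "k \<in> X" using g by auto
      then show "S \<in> (\<Union>k\<in>X. {g ` P | g. is_lift P h g \<and> g ` (P \<inter> B k) \<inter> U k \<noteq> {}})" using g(1,2) by blast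
    qed
    show "finite (\<Union>k\<in>X. {g ` P | g. is_lift P h g \<and> g ` (P \<inter> B k) \<inter> U k \<noteq> {}})"
    proof (rule finite_UN_I[OF X(2)])
      fix k assume "k \<in> X"
      then have "k \<in> P" using X(1) by blast
      show "finite {g ` P | g. is_lift P h g \<and> g ` (P \<inter> B k) \<inter> U k \<noteq> {}}"
      proof (rule finite_at_most_one)
        fix S S' assume SS: "S \<in> {g ` P | g. is_lift P h g \<and> g ` (P \<inter> B k) \<inter> U k \<noteq> {}}"
          "S' \<in> {g ` P | g. is_lift P h g \<and> g ` (P \<inter> B k) \<inter> U k \<noteq> {}}"
        obtain g where g: "S = g ` P" "is_lift P h g" "g ` (P \<inter> B k) \<inter> U k \<noteq> {}" using SS(1) by blast
        obtain g' where g': "S' = g' ` P" "is_lift P h g'" "g' ` (P \<inter> B k) \<inter> U k \<noteq> {}" using SS(2) by blast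
        show "S = S'" unfolding g(1) g'(1) by (rule BU(2)[OF \<open>k \<in> P\<close> g(2) g'(2) g(3) g'(3)])
      qed
    qed
  qed
  ultimately show ?thesis by blast
qed

lemma cells_locally_finite: "\<exists>U. open U \<and> x \<in> U \<and> finite {K \<in> cells. K \<inter> U \<noteq> {}}"
proof -
  have "\<forall>C\<in>D 2. \<exists>U. open U \<and> x \<in> U \<and> finite {g ` char_dom C | g. is_lift (char_dom C) (char_fun C) g \<and> g ` char_dom C \<inter> U \<noteq> {}}"
  proof
    fix C assume "C \<in> D 2"
    show "\<exists>U. open U \<and> x \<in> U \<and> finite {g ` char_dom C | g. is_lift (char_dom C) (char_fun C) g \<and> g ` char_dom C \<inter> U \<noteq> {}}"
      by (rule lifts_locally_finite[OF char_map_choice[OF \<open>C \<in> D 2\<close>]])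
  qed
  from bchoice[OF this] obtain U where U': "\<forall>C\<in>D 2. open (U C) \<and> x \<in> U C \<and>
      finite {g ` char_dom C | g. is_lift (char_dom C) (char_fun C) g \<and> g ` char_dom C \<inter> U C \<noteq> {}}" ..
  have U: "open (U C)" "x \<in> U C" "finite {g ` char_dom C | g. is_lift (char_dom C) (char_fun C) g \<and> g ` char_dom C \<inter> U C \<noteq> {}}"
    if "C \<in> D 2" for C using bspec[OF U' that] by simp_all
  have "open (\<Inter>C\<in>D 2. U C)" "x \<in> (\<Inter>C\<in>D 2. U C)" using U finite_D by (auto intro!: open_INT)
  moreover have "finite {K \<in> cells. K \<inter> (\<Inter>C\<in>D 2. U C) \<noteq> {}}"
  proof (rule finite_subset)
    show "{K \<in> cells. K \<inter> (\<Inter>C\<in>D 2. U C) \<noteq> {}} \<subseteq> (\<Union>C\<in>D 2. {g ` char_dom C | g. is_lift (char_dom C) (char_fun C) g \<and> g ` char_dom C \<inter> U C \<noteq> {}})"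
      unfolding cells_eq by blast
    show "finite (\<Union>C\<in>D 2. {g ` char_dom C | g. is_lift (char_dom C) (char_fun C) g \<and> g ` char_dom C \<inter> U C \<noteq> {}})"
      using finite_D U(3) by (rule finite_UN_I)
  qed
  ultimately show ?thesis by blast
qed

lemma finite_cells_at: "finite {K \<in> cells. x \<in> K}"
proof -
  obtain U where U: "open U" "x \<in> U" "finite {K \<in> cells. K \<inter> U \<noteq> {}}" using cells_locally_finite by blast
  show ?thesis by (rule finite_subset[OF _ U(3)]) (use U(2) in auto)
qed

text \<open>Remove from a neighbourhood that meets finitely many cells those that do not contain
  \<open>x\<close>: they are closed and finite in number.\<close>

lemma cells_star: "\<exists>W. open W \<and> x \<in> W \<and> W \<subseteq> \<Union>{K \<in> cells. x \<in> K}"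
proof -
  obtain U where U: "open U" "x \<in> U" "finite {K \<in> cells. K \<inter> U \<noteq> {}}" using cells_locally_finite by blast
  let ?F = "{K \<in> cells. K \<inter> U \<noteq> {} \<and> x \<notin> K}"
  have fin: "finite ?F" by (rule finite_subset[OF _ U(3)]) auto
  have "closed (\<Union>?F)" using fin compact_cells by (intro closed_Union) (auto simp: compact_imp_closed)
  then have "open (U - \<Union>?F)" using U(1) by (simp add: open_Diff)
  moreover have "x \<in> U - \<Union>?F" using U(2) by auto
  moreover have "U - \<Union>?F \<subseteq> \<Union>{K \<in> cells. x \<in> K}"
  proof
    fix y assume y: "y \<in> U - \<Union>?F"
    obtain K where "K \<in> cells" "y \<in> K" using cells_cover by blast
    then show "y \<in> \<Union>{K \<in> cells. x \<in> K}" using y by blast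
  qed
  ultimately show ?thesis by blast
qed

text \<open>One lift is chosen for each 2-cell. A deck transformation matches it with any other lift
  at one point, hence everywhere by uniqueness of lifts.\<close>

lemma cells_finite_mod_deck:
  "\<exists>\<F>. finite \<F> \<and> \<F> \<subseteq> cells \<and> (\<forall>K\<in>cells. \<exists>K0\<in>\<F>. \<exists>\<gamma>\<in>carrier (pi1 p). K = \<gamma> ` K0)"
proof -
  have "\<forall>C. \<exists>g. C \<in> D 2 \<longrightarrow> is_lift (char_dom C) (char_fun C) g"
  proof
    fix C show "\<exists>g. C \<in> D 2 \<longrightarrow> is_lift (char_dom C) (char_fun C) g"
    proof (cases "C \<in> D 2")
      case True
      obtain k where k: "k \<in> char_dom C" using char_mapD(3)[OF char_map_choice[OF True]] by blast
      obtain x where "char_fun C k = p x" using surj_p by (metis surjE)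
      then show ?thesis using lift_through[OF char_map_choice[OF True] k] by blast
    qed auto
  qed
  then obtain g where g: "\<And>C. C \<in> D 2 \<Longrightarrow> is_lift (char_dom C) (char_fun C) (g C)" by metis
  let ?F = "(\<lambda>C. g C ` char_dom C) ` D 2"
  have "\<exists>K0\<in>?F. \<exists>\<gamma>\<in>carrier (pi1 p). K = \<gamma> ` K0" if "K \<in> cells" for K
  proof -
    obtain C f where C: "C \<in> D 2" "is_lift (char_dom C) (char_fun C) f" "K = f ` char_dom C" using \<open>K \<in> cells\<close> by (auto simp: cells_eq)
    obtain k where k: "k \<in> char_dom C" using char_mapD(3)[OF char_map_choice[OF C(1)]] by blast
    have "p (g C k) = p (f k)" using g[OF C(1)] C(2) k by (simp add: is_lift_def)
    then obtain \<gamma> where \<gamma>: "\<gamma> \<in> carrier (pi1 p)" "\<gamma> (g C k) = f k" using deck by blast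
    obtain \<gamma>' where h: "homeomorphism UNIV UNIV \<gamma> \<gamma>'" and pg: "p \<circ> \<gamma> = p" using \<gamma>(1) by (auto simp: pi1_def)
    have "is_lift (char_dom C) (char_fun C) (\<gamma> \<circ> g C)"
      unfolding is_lift_def
    proof (intro conjI ballI)
      show "continuous_on (char_dom C) (\<gamma> \<circ> g C)"
        using g[OF C(1)] h by (intro continuous_on_compose) (auto simp: is_lift_def homeomorphism_def intro: continuous_on_subset)
      fix l assume "l \<in> char_dom C"
      then show "p ((\<gamma> \<circ> g C) l) = char_fun C l" using g[OF C(1)] fun_cong[OF pg, of "g C l"] by (simp add: is_lift_def)
    qed
    then have "(\<gamma> \<circ> g C) ` char_dom C = f ` char_dom C"
      by (rule lift_image_eq[OF char_map_choice[OF C(1)] _ C(2) k]) (simp add: \<gamma>(2))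
    then have "K = \<gamma> ` (g C ` char_dom C)" using C(3) by (simp add: image_comp)
    then show ?thesis using C(1) \<gamma>(1) by blast
  qed
  moreover have "finite ?F" "?F \<subseteq> cells" using finite_D g by (auto simp: cells_eq)
  ultimately show ?thesis by blast
qed

text \<open>The hypothesis describes the image of the open cell only. Its closure is compact, so it
  is mapped onto the closure of the image, which is the closed polygon.\<close>

lemma cell_polygon:
  assumes "polyhedral_wrt p D \<Phi>" "continuous_on UNIV \<Phi>" "C \<in> D 2" "T \<in> components (p -` C)"
  shows "\<exists>H. spacelike_plane H \<and> polytope (\<Phi> ` closure T) \<and> aff_dim (\<Phi> ` closure T) = 2 \<and> \<Phi> ` closure T \<subseteq> H \<and>
    \<Phi> ` T = rel_interior (\<Phi> ` closure T)"
proof -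
  obtain H Q where Q: "spacelike_plane H" "polytope Q" "aff_dim Q = 2" "Q \<subseteq> H" "\<Phi> ` T = rel_interior Q"
    using assms(1)[unfolded polyhedral_wrt_def, rule_format, OF assms(3,4)] by (elim exE conjE)
  have "closure T \<in> cells" using assms(3,4) by (auto simp: cells_def)
  then have "compact (\<Phi> ` closure T)" by (intro compact_continuous_image compact_cells continuous_on_subset[OF assms(2)]) auto
  then have "closure (\<Phi> ` T) \<subseteq> \<Phi> ` closure T"
    by (intro closure_minimal image_mono closure_subset compact_imp_closed)
  moreover have "\<Phi> ` closure T \<subseteq> closure (\<Phi> ` T)"
    by (rule image_closure_subset[OF continuous_on_subset[OF assms(2)] closed_closure closure_subset]) simp
  moreover have "closure (\<Phi> ` T) = Q"
    unfolding Q(5) using convex_closure_rel_interior[OF polytope_imp_convex[OF Q(2)]] polytope_imp_closed[OF Q(2)] by simp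
  ultimately have "\<Phi> ` closure T = Q" by blast
  then show ?thesis using Q by auto
qed

lemma base_cell_unique:
  assumes "C \<in> D i" "C' \<in> D j" "b \<in> C" "b \<in> C'"
  shows "C = C'"
proof (rule ccontr)
  assume "C \<noteq> C'"
  then have "C \<inter> C' = {}" by (intro disjointD[OF disjoint_D]) (use assms(1,2) in auto)
  then show False using assms(3,4) by blast
qed

text \<open>\<open>T\<close> is open, so it meets \<open>T'\<close> itself and not just its
  closure.\<close>

lemma component_cell_unique:
  assumes "C \<in> D 2" "T \<in> components (p -` C)" "C' \<in> D 2" "T' \<in> components (p -` C')" "x \<in> T" "x \<in> closure T'"
  shows "T = T'"
proof -
  have "open T" using lift_component[OF char_map_choice[OF assms(1)] assms(1)] lift_interior_open[OF char_map_choice[OF assms(1)] assms(1)] assms(2)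
    by auto
  then have "T \<inter> T' \<noteq> {}" using assms(5,6) by (metis IntI empty_iff open_Int_closure_eq_empty)
  then obtain y where y: "y \<in> T" "y \<in> T'" by blast
  then have "p y \<in> C" "p y \<in> C'" using in_components_subset assms(2,4) by blast+
  then have "C = C'" by (rule base_cell_unique[OF assms(1,3)])
  then show ?thesis using components_nonoverlap[OF assms(2)] assms(4) y by blast
qed

lemma open_component: "C \<in> D 2 \<Longrightarrow> T \<in> components (p -` C) \<Longrightarrow> open T"
  using lift_component[OF char_map_choice] lift_interior_open[OF char_map_choice] by auto

text \<open>Disjointness would make the 1-cell equal to a single point, whereas the relative
  interior of a segment has dimension 1.\<close>

lemma edge_not_vertex:
  assumes "b \<in> C" "C \<in> D 1"
  shows "b \<notin> \<Union>(D 0)"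
proof
  obtain P h where P: "char_map 1 C P h" using char_map_exists[OF assms(2)] by blast
  note c = char_mapD[OF P]
  assume "b \<in> \<Union>(D 0)"
  then obtain E where E: "E \<in> D 0" "b \<in> E" by blast
  then have "E = C" using base_cell_unique assms by metis
  then obtain b' where "C = {b'}" using D0_singleton[OF E(1)] by blast
  then have "h ` rel_interior P = {b'}" using c(7) by simp
  obtain a where a: "a \<in> rel_interior P" using c(4) by blast
  have "rel_interior P = {a}"
    using a \<open>h ` rel_interior P = {b'}\<close> inj_onD[OF c(8)] by (auto, metis image_eqI singletonD)
  then have "aff_dim (rel_interior P) = 0" by simp
  then show False using P c(2) by (simp add: char_map_def rel_interior_aff_dim)
qed

text \<open>Near a point of a 1-cell only this 1-cell and 2-cells are met. The position of the
  parameter along the segment is an injective real coordinate on the 1-cell.\<close>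

lemma edge_coordinate:
  assumes "p x \<in> C" "C \<in> D 1"
  shows "\<exists>W (g :: 'a \<Rightarrow> real). open W \<and> x \<in> W \<and> (\<forall>y\<in>W. y \<in> W \<inter> p -` C \<or> (\<exists>C'\<in>D 2. p y \<in> C')) \<and>
    continuous_on (W \<inter> p -` C) g \<and> inj_on g (W \<inter> p -` C)"
proof -
  obtain P h where P: "char_map 1 C P h" using char_map_exists[OF assms(2)] by blast
  obtain h' where h': "homeomorphism (rel_interior P) C h h'" using P by (auto simp: char_map_def)
  have "collinear P" using P by (simp add: collinear_aff_dim char_map_def)
  then obtain u where u: "\<And>a b. a \<in> P \<Longrightarrow> b \<in> P \<Longrightarrow> \<exists>c. a - b = c *\<^sub>R u" unfolding collinear_def by blast
  have uinj: "a = b" if "a \<in> P" "b \<in> P" "u \<bullet> a = u \<bullet> b" for a b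
  proof -
    obtain c where c: "a - b = c *\<^sub>R u" using u \<open>a \<in> P\<close> \<open>b \<in> P\<close> by blast
    have "c * (u \<bullet> u) = u \<bullet> (a - b)" by (simp add: c)
    also have "\<dots> = 0" using \<open>u \<bullet> a = u \<bullet> b\<close> by (simp add: inner_diff_right)
    finally have "c *\<^sub>R u = 0" by auto
    then have "a - b = 0" unfolding c .
    then show ?thesis by simp
  qed
  have hP: "h' b \<in> P" "h (h' b) = b" if "b \<in> C" for b
    using h' \<open>b \<in> C\<close> rel_interior_subset[of P] by (auto simp: homeomorphism_def)
  \<comment> \<open>The cells of dimension below 2 to be avoided. The other 1-cells are replaced by
    their compact closed versions, which add only vertices.\<close>
  define F where "F = \<Union>(D 0) \<union> \<Union>(D 1 - {C})"
  have "\<exists>V. open V \<and> p x \<in> V \<and> V \<inter> F = {}"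
  proof -
    have "\<forall>C'. \<exists>S. C' \<in> D 1 - {C} \<longrightarrow> closed S \<and> C' \<subseteq> S \<and> p x \<notin> S"
    proof
      fix C' show "\<exists>S. C' \<in> D 1 - {C} \<longrightarrow> closed S \<and> C' \<subseteq> S \<and> p x \<notin> S"
      proof (cases "C' \<in> D 1 - {C}")
        case True
        obtain P' k where P': "char_map 1 C' P' k" using char_map_exists True by blast
        note c = char_mapD[OF P']
        have "p x \<notin> C'" using base_cell_unique[OF assms(2) _ assms(1), of C' 1] True by auto
        moreover have "p x \<notin> \<Union>(D 0)" by (rule edge_not_vertex[OF assms])
        ultimately have "p x \<notin> k ` P'" using c(10) by (auto simp: lessThan_Suc)
        then show ?thesis using c(11,12) by (intro exI[of _ "k ` P'"]) (simp add: compact_imp_closed)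
      qed auto
    qed
    then obtain S where S: "\<And>C'. C' \<in> D 1 - {C} \<Longrightarrow> closed (S C') \<and> C' \<subseteq> S C' \<and> p x \<notin> S C'" by metis
    have px0: "p x \<notin> \<Union>(D 0)" by (rule edge_not_vertex[OF assms])
    let ?S = "\<Union>(D 0) \<union> (\<Union>C'\<in>D 1 - {C}. S C')"
    have cl: "closed ?S" using finite_D finite_D0 S by (intro closed_Un closed_UN) (auto simp: finite_imp_closed)
    have px: "p x \<notin> ?S" using px0 S by blast
    have "F \<subseteq> ?S" using S unfolding F_def by blast
    then have "- ?S \<inter> F = {}" by blast
    moreover have "p x \<in> - ?S" using px by (simp only: Compl_iff not_False_eq_True)
    ultimately show ?thesis using open_Compl[OF cl] by metis
  qed
  then obtain V where V: "open V" "p x \<in> V" "V \<inter> F = {}" by blast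
  obtain U where U: "open U" "x \<in> U" "inj_on p U" using local_inj by blast
  let ?W = "U \<inter> p -` V"
  define g where "g y = u \<bullet> h' (p y)" for y
  have "open ?W" using U(1) V(1) by (intro continuous_open_preimage cont_p)
  moreover have "y \<in> ?W \<inter> p -` C \<or> (\<exists>C'\<in>D 2. p y \<in> C')" if "y \<in> ?W" for y
    using Union_D_cases[of "p y"] that V(3) unfolding F_def by blast
  moreover have "continuous_on (?W \<inter> p -` C) g"
  proof -
    have "continuous_on (?W \<inter> p -` C) (\<lambda>y. h' (p y))"
      by (rule continuous_on_compose2[OF _ cont_p]) (use h' in \<open>auto simp: homeomorphism_def\<close>)
    then show ?thesis unfolding g_def by (intro continuous_intros)
  qed
  moreover have "inj_on g (?W \<inter> p -` C)"
  proof (rule inj_onI)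
    fix y z assume yz: "y \<in> ?W \<inter> p -` C" "z \<in> ?W \<inter> p -` C" "g y = g z"
    then have "h' (p y) = h' (p z)" using uinj hP(1) by (simp add: g_def)
    then have "p y = p z" using hP(2) yz by (metis IntD2 vimageE)
    then show "y = z" using U(3) yz by (auto dest: inj_onD)
  qed
  ultimately show ?thesis using U(2) V(2) by (intro exI[of _ ?W] exI[of _ g]) auto
qed

end

section \<open>Fuchsian convex polyhedral surfaces\<close>

lemma SO21_0_mink:
  assumes "M \<in> SO21_0" shows "mink (M *v u) (M *v v) = mink u v"
  using assms connected_component_subset unfolding SO21_0_def by (force simp: SO21_def)

text \<open>Differentiate the constant square of \<open>c t *v v\<close> along a curve
  \<open>c\<close> in the group.\<close>

lemma tangent_SO21_0_skew:
  assumes "w \<in> tangent_space SO21_0 b"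
  shows "mink (w *v v) (b *v v) = 0"
proof -
  obtain c where c: "c 0 = b" "\<And>t. c t \<in> SO21_0" "(c has_vector_derivative w) (at (0::real))"
    using assms unfolding tangent_space_def by blast
  have bl: "bounded_linear (\<lambda>M::real^3^3. M *v v)"
  proof -
    have "linear (\<lambda>M::real^3^3. M *v v)"
      by (rule linearI) (simp_all add: matrix_vector_mult_add_rdistrib scaleR_matrix_vector_assoc)
    then show ?thesis by (simp add: linear_conv_bounded_linear)
  qed
  have d: "((\<lambda>t. c t *v v) has_vector_derivative (w *v v)) (at 0)"
    by (rule bounded_linear.has_vector_derivative[OF bl c(3)])
  have "((\<lambda>t. mink (c t *v v) (c t *v v)) has_vector_derivative (mink (c 0 *v v) (w *v v) + mink (w *v v) (c 0 *v v))) (at 0)"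
    by (rule mink.has_vector_derivative[OF d d])
  moreover have "(\<lambda>t. mink (c t *v v) (c t *v v)) = (\<lambda>t. mink v v)" using SO21_0_mink c(2) by auto
  ultimately have "((\<lambda>t::real. mink v v) has_vector_derivative (mink (b *v v) (w *v v) + mink (w *v v) (b *v v))) (at 0)"
    using c(1) by simp
  then have "mink (b *v v) (w *v v) + mink (w *v v) (b *v v) = 0"
    using vector_derivative_unique_at has_vector_derivative_const by blast
  then show ?thesis by (simp add: mink_commute[of "b *v v"])
qed

locale polyhedral_cover = decomposed_cover p A "\<lambda>x. proj2 (axis 1 1) (axis 2 1) (\<phi> x)" D
  for p :: "'a::t2_space \<Rightarrow> 'b::t2_space" and A :: "'b atlas" and \<phi> :: "'a \<Rightarrow> real^3" and D :: "nat \<Rightarrow> 'b set set" +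
  assumes cont_surface: "continuous_on UNIV \<phi>" and inj_surface: "inj \<phi>"
    and polyhedral: "polyhedral_wrt p D \<phi>"
    and proj_surface: "\<And>H. spacelike_plane H \<Longrightarrow> inj_on (orth_proj H) (range \<phi>)"
begin

lemma cell_component: "K \<in> cells \<Longrightarrow> \<exists>C T. C \<in> D 2 \<and> T \<in> components (p -` C) \<and> K = closure T"
  unfolding cells_def by blast

lemma polytope_cell: "K \<in> cells \<Longrightarrow> \<exists>H. spacelike_plane H \<and> polytope (\<phi> ` K) \<and> aff_dim (\<phi> ` K) = 2 \<and> \<phi> ` K \<subseteq> H"
  using cell_component cell_polygon[OF polyhedral cont_surface] by blast

end

sublocale polyhedral_cover \<subseteq> spacelike_complex \<phi> cells
proof
  fix K assume K: "K \<in> cells"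
  show "convex (\<phi> ` K)" "\<exists>H. spacelike_plane H \<and> \<phi> ` K \<subseteq> H" "aff_dim (\<phi> ` K) = 2" "compact K"
    using polytope_cell[OF K] compact_cells[OF K] polytope_imp_convex by blast+
next
  fix f :: "'a \<Rightarrow> real^2" and W :: "'a set"
  assume "continuous_on UNIV f" "inj f" "open W"
  then show "open (f ` W)" by (rule invariance_of_domain_cover)
qed (use cont_surface inj_surface connected_cover finite_cells_at cells_star proj_surface in auto)

context polyhedral_cover
begin

lemma open_cell_closure:
  assumes "C \<in> D 2" "T \<in> components (p -` C)"
  shows "open_cell (closure T) = T"
proof -
  have eq: "\<phi> ` T = rel_interior (\<phi> ` closure T)" using cell_polygon[OF polyhedral cont_surface assms] by blast
  show ?thesis
    unfolding open_cell_def eq[symmetric] using inj_surface closure_subset[of T] by (auto simp: inj_image_mem_iff)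
qed

lemma open_open_cell: "K \<in> cells \<Longrightarrow> open (open_cell K)"
  using cell_component open_cell_closure open_component by metis

lemma open_cell_unique:
  assumes "K \<in> cells" "K' \<in> cells" "y \<in> open_cell K" "y \<in> K'"
  shows "K' = K"
proof -
  obtain C T where T: "C \<in> D 2" "T \<in> components (p -` C)" "K = closure T" using cell_component[OF assms(1)] by blast
  obtain C' T' where T': "C' \<in> D 2" "T' \<in> components (p -` C')" "K' = closure T'" using cell_component[OF assms(2)] by blast
  have "T = T'"
    using component_cell_unique[OF T(1,2) T'(1,2)] assms(3,4) open_cell_closure[OF T(1,2)] T(3) T'(3) by auto
  then show ?thesis using T T' by simp
qed

lemma in_open_cell:
  assumes "p y \<in> C" "C \<in> D 2"
  shows "\<exists>K\<in>cells. y \<in> open_cell K"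
proof -
  have "y \<in> p -` C" using assms by simp
  then obtain T where T: "T \<in> components (p -` C)" "y \<in> T" by (metis UnionE Union_components)
  then have "closure T \<in> cells" using assms(2) by (auto simp: cells_def)
  then show ?thesis using open_cell_closure[OF assms(2) T(1)] T(2) by blast
qed

text \<open>A point interior to a polygon lies strictly between two of its points, and a point of a
  1-cell is excluded by \<open>corner_not_on_arc\<close>; only the vertices remain.\<close>

lemma corner_is_vertex:
  assumes corner: "\<And>K a b s. K \<in> cells \<Longrightarrow> a \<in> K \<Longrightarrow> b \<in> K \<Longrightarrow> 0 < s \<Longrightarrow> s < 1 \<Longrightarrow>
      \<phi> x = (1 - s) *\<^sub>R \<phi> a + s *\<^sub>R \<phi> b \<Longrightarrow> a = b"
  shows "{p x} \<in> D 0"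
proof -
  have n2: "p x \<notin> \<Union>(D 2)"
  proof
    assume "p x \<in> \<Union>(D 2)"
    then obtain K where K: "K \<in> cells" "x \<in> open_cell K" using in_open_cell by blast
    then have x: "x \<in> K" "\<phi> x \<in> rel_interior (\<phi> ` K)" by (auto simp: open_cell_def)
    obtain y where y: "y \<in> K" "y \<noteq> x"
    proof (rule ccontr)
      assume "\<not> thesis"
      then have "K = {x}" using that x(1) by blast
      then show False using cell_dim[OF K(1)] by simp
    qed
    \<comment> \<open>The segment from another point of the cell can be prolonged beyond a relative
      interior point, which puts \<open>x\<close> strictly between two points of its cell.\<close>
    obtain e where e: "e > 1" "(1 - e) *\<^sub>R \<phi> y + e *\<^sub>R \<phi> x \<in> \<phi> ` K"
      using convex_rel_interior_if[OF convex_cell[OF K(1)] x(2)] y(1) hull_inc[of "\<phi> y" "\<phi> ` K"] by blast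
    then obtain z where z: "z \<in> K" "\<phi> z = (1 - e) *\<^sub>R \<phi> y + e *\<^sub>R \<phi> x" by auto
    have "(1 - 1/e) *\<^sub>R \<phi> y + (1/e) *\<^sub>R \<phi> z = ((1 - 1/e) + (1/e) * (1 - e)) *\<^sub>R \<phi> y + ((1/e) * e) *\<^sub>R \<phi> x"
      unfolding z(2) by (simp add: scaleR_add_right scaleR_add_left)
    moreover have "(1 - 1/e) + (1/e) * (1 - e) = 0" "(1/e) * e = 1" using e(1) by (auto simp: field_simps)
    ultimately have comb: "\<phi> x = (1 - 1/e) *\<^sub>R \<phi> y + (1/e) *\<^sub>R \<phi> z" by simp
    have "y = z" by (rule corner[OF K(1) y(1) z(1) _ _ comb]) (use e(1) in auto)
    then have "\<phi> x = \<phi> y" using comb by (simp add: scaleR_add_left[symmetric])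
    then show False using inj_surface y(2) by (auto dest: injD)
  qed
  have n1: "p x \<notin> \<Union>(D 1)"
  proof
    assume "p x \<in> \<Union>(D 1)"
    then obtain C where C: "p x \<in> C" "C \<in> D 1" by blast
    obtain W and g :: "'a \<Rightarrow> real" where W: "open W" "x \<in> W" "\<forall>y\<in>W. y \<in> W \<inter> p -` C \<or> (\<exists>C'\<in>D 2. p y \<in> C')"
      "continuous_on (W \<inter> p -` C) g" "inj_on g (W \<inter> p -` C)"
      using edge_coordinate[OF C] by (elim exE conjE)
    show False
    proof (rule corner_not_on_arc[OF open_cell_unique open_open_cell W(1,2) _ W(4,5) _ corner])
      show "y \<in> W \<inter> p -` C \<or> (\<exists>K\<in>cells. y \<in> open_cell K)" if "y \<in> W" for y
        using bspec[OF W(3) that] in_open_cell by blast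
      show "x \<in> W \<inter> p -` C" using W(2) C(1) by simp
    qed
  qed
  have "p x \<in> \<Union>(D 0)" using Union_D_cases[of "p x"] n1 n2 by blast
  then obtain C where "C \<in> D 0" "p x \<in> C" by blast
  then show ?thesis using D0_singleton[of C] by auto
qed

end

section \<open>Invariant functions and their maxima\<close>

locale fuchsian_polyhedral_cover = polyhedral_cover p A \<phi> D
  for p :: "'a::t2_space \<Rightarrow> 'b::t2_space" and A :: "'b atlas" and \<phi> :: "'a \<Rightarrow> real^3" and D :: "nat \<Rightarrow> 'b set set" +
  fixes \<rho> :: "('a \<Rightarrow> 'a) \<Rightarrow> real^3 \<Rightarrow> real^3"
  assumes fuchsian_rho: "fuchsian p \<rho>"
    and equivariant: "\<And>\<gamma> x. \<gamma> \<in> carrier (pi1 p) \<Longrightarrow> \<phi> (\<gamma> x) = \<rho> \<gamma> (\<phi> x)"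
begin

lemma rho_matrix:
  assumes "\<gamma> \<in> carrier (pi1 p)"
  shows "\<rho> \<gamma> v = matrix (\<rho> \<gamma>) *v v" "linear (\<rho> \<gamma>)" "mink (\<rho> \<gamma> u) (\<rho> \<gamma> v) = mink u v" "matrix (\<rho> \<gamma>) \<in> SO21_0"
proof -
  obtain M where M: "M \<in> SO21_0" "\<rho> \<gamma> = (*v) M" using fuchsian_rho assms unfolding fuchsian_def by blast
  then show "linear (\<rho> \<gamma>)" by (simp add: matrix_vector_mul_linear)
  show "\<rho> \<gamma> v = matrix (\<rho> \<gamma>) *v v" "matrix (\<rho> \<gamma>) \<in> SO21_0" using M by simp_all
  show "mink (\<rho> \<gamma> u) (\<rho> \<gamma> v) = mink u v" using M SO21_0_mink by simp
qed

text \<open>The surface is not compact, but both functions are invariant and there are finitely many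
  cells up to deck transformations. On a cell \<open>u\<close> is affine and the square of the
  position is convex, so bounds on finitely many vertices of polygons hold everywhere.\<close>

lemma lexicographic_maximum:
  assumes inv: "\<And>\<gamma> x. \<gamma> \<in> carrier (pi1 p) \<Longrightarrow> u (\<gamma> x) = (u x :: real)"
    and aff: "\<And>K x y m s. K \<in> cells \<Longrightarrow> x \<in> K \<Longrightarrow> y \<in> K \<Longrightarrow> m \<in> K \<Longrightarrow>
      \<phi> m = (1 - s) *\<^sub>R \<phi> x + s *\<^sub>R \<phi> y \<Longrightarrow> u m = (1 - s) * u x + s * u y"
  shows "\<exists>x0. (\<forall>y. u y \<le> u x0) \<and> (\<forall>y. u y = u x0 \<longrightarrow> mink (\<phi> y) (\<phi> y) \<le> mink (\<phi> x0) (\<phi> x0))"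
proof -
  define q where "q y = mink (\<phi> y) (\<phi> y)" for y
  obtain \<F> where \<F>: "finite \<F>" "\<F> \<subseteq> cells" "\<forall>K\<in>cells. \<exists>K0\<in>\<F>. \<exists>\<gamma>\<in>carrier (pi1 p). K = \<gamma> ` K0"
    using cells_finite_mod_deck by (elim exE conjE)
  have "\<forall>K. \<exists>V. K \<in> cells \<longrightarrow> finite V \<and> V \<subseteq> K \<and> \<phi> ` K = convex hull (\<phi> ` V)"
  proof
    fix K show "\<exists>V. K \<in> cells \<longrightarrow> finite V \<and> V \<subseteq> K \<and> \<phi> ` K = convex hull (\<phi> ` V)"
    proof (cases "K \<in> cells")
      case True
      obtain S where S: "finite S" "\<phi> ` K = convex hull S" using polytope_cell[OF True] unfolding polytope_def by blast
      then have "S \<subseteq> \<phi> ` K" by (simp add: hull_subset)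
      then obtain V where "V \<subseteq> K" "finite V" "S = \<phi> ` V" using finite_subset_image[OF S(1)] by metis
      then show ?thesis using S(2) by blast
    qed auto
  qed
  then obtain V where V: "\<And>K. K \<in> cells \<Longrightarrow> finite (V K) \<and> V K \<subseteq> K \<and> \<phi> ` K = convex hull (\<phi> ` V K)" by metis
  define \<V> where "\<V> = (\<Union>K\<in>\<F>. V K)"
  have fin: "finite \<V>" using \<F>(1,2) V by (auto simp: \<V>_def)
  \<comment> \<open>The one principle behind both maxima: weight 0 gives the bound on
    \<open>u\<close>, a small positive weight the bound on ties.\<close>
  have reduce: "u y + N * q y \<le> b" if N: "N \<ge> 0" and b: "\<And>v. v \<in> \<V> \<Longrightarrow> u v + N * q v \<le> b" for N b y
  proof -
    obtain K where K: "K \<in> cells" "y \<in> K" using cells_cover by blast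
    obtain K0 \<gamma> where K0: "K0 \<in> \<F>" "\<gamma> \<in> carrier (pi1 p)" "K = \<gamma> ` K0" using bspec[OF \<F>(3) K(1)] by blast
    then obtain x where x: "x \<in> K0" "y = \<gamma> x" using K(2) by blast
    have c0: "K0 \<in> cells" using K0(1) \<F>(2) by blast
    define w where "w v = u (inv_into UNIV \<phi> v) + N * mink v v" for v
    have w: "w (\<phi> z) = u z + N * q z" for z using inj_surface by (simp add: w_def q_def)
    have "convex_on (\<phi> ` K0) w"
    proof (rule convex_onI)
      show "convex (\<phi> ` K0)" by (rule convex_cell[OF c0])
      fix t :: real and v v' assume t: "0 < t" "t < 1" and v: "v \<in> \<phi> ` K0" "v' \<in> \<phi> ` K0"
      obtain a a' where a: "a \<in> K0" "v = \<phi> a" "a' \<in> K0" "v' = \<phi> a'" using v by blast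
      obtain m where m: "m \<in> K0" "\<phi> m = (1 - t) *\<^sub>R \<phi> a + t *\<^sub>R \<phi> a'" using cell_segment[OF c0 a(1,3)] t by (metis less_imp_le)
      have um: "u m = (1 - t) * u a + t * u a'" by (rule aff[OF c0 a(1,3) m])
      \<comment> \<open>The convexity defect of \<open>q\<close> along a chord is the square of the
        chord times a nonnegative factor, and chords of cells are spacelike.\<close>
      have "(1 - t) * q a + t * q a' - q m = t * (1 - t) * mink (\<phi> a - \<phi> a') (\<phi> a - \<phi> a')"
        unfolding q_def m(2) by (simp add: mink_simps mink_commute[of "\<phi> a'" "\<phi> a"]) (simp add: algebra_simps)
      moreover have "mink (\<phi> a - \<phi> a') (\<phi> a - \<phi> a') \<ge> 0"
        using same_cell_spacelike[OF c0 a(1,3)] by (cases "a = a'") (auto simp: mink_simps)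
      ultimately have "q m \<le> (1 - t) * q a + t * q a'" using t
        by (metis diff_ge_0_iff_ge less_imp_le mult_nonneg_nonneg)
      then have "N * q m \<le> N * ((1 - t) * q a + t * q a')" using N by (rule mult_left_mono)
      then have "u m + N * q m \<le> (1 - t) * (u a + N * q a) + t * (u a' + N * q a')" using um by (simp add: algebra_simps)
      then show "w ((1 - t) *\<^sub>R v + t *\<^sub>R v') \<le> (1 - t) * w v + t * w v'"
        unfolding a(2,4) m(2)[symmetric] w .
    qed
    then have cv: "convex_on (convex hull (\<phi> ` V K0)) w" using V[OF c0] by simp
    have "\<forall>v\<in>\<phi> ` V K0. w v \<le> b" using b K0(1) w by (auto simp: \<V>_def)
    then have "\<forall>v\<in>convex hull (\<phi> ` V K0). w v \<le> b" by (rule convex_on_convex_hull_bound[OF cv])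
    then have "w (\<phi> x) \<le> b" using V[OF c0] x(1) by blast
    moreover have "u y = u x" "q y = q x" using inv[OF K0(2)] equivariant[OF K0(2)] rho_matrix(3)[OF K0(2)] x(2) by (auto simp: q_def)
    ultimately show ?thesis by (simp add: w)
  qed
  have "\<V> \<noteq> {}"
  proof
    assume "\<V> = {}"
    \<comment> \<open>With no vertices at all, \<open>reduce\<close> would bound \<open>u\<close> at
      a point by its own value minus 1.\<close>
    then show False using reduce[of 0 "u undefined - 1" undefined] by simp
  qed
  define M where "M = Max (u ` \<V>)"
  have uM: "u v \<le> M" if "v \<in> \<V>" for v using that fin by (simp add: M_def)
  define \<M> where "\<M> = {v \<in> \<V>. u v = M}"
  have "M \<in> u ` \<V>" unfolding M_def using fin \<open>\<V> \<noteq> {}\<close> by (intro Max_in) auto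
  then have M: "\<M> \<noteq> {}" "finite \<M>" using fin by (auto simp: \<M>_def)
  define Q where "Q = Max (q ` \<M>)"
  have "Q \<in> q ` \<M>" unfolding Q_def using M by (intro Max_in) auto
  then obtain x0 where x0: "x0 \<in> \<M>" "q x0 = Q" by blast
  have qQ: "q v \<le> Q" if "v \<in> \<M>" for v using that M by (simp add: Q_def)
  have u0: "u x0 = M" using x0(1) by (simp add: \<M>_def)
  have umax: "u y \<le> M" for y using reduce[of 0 M y] uM by simp
  have "q y \<le> Q" if y: "u y = M" for y
  proof (rule ccontr)
    assume n: "\<not> q y \<le> Q"
    text \<open>Weighting \<open>q\<close> by a small positive number does not change the lexicographic maximum over finitely many
      vertices.\<close>
    define S where "S = (\<Sum>v\<in>\<V>. if u v = M then 0 else \<bar>q v - Q\<bar> / (M - u v))"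
    have S0: "S \<ge> 0" unfolding S_def using uM by (intro sum_nonneg) auto
    \<comment> \<open>Small enough that the gain in \<open>q\<close> at a vertex with
      \<open>u v < M\<close> never exceeds the loss \<open>M - u v\<close>; the summand 1 guards
      against \<open>S = 0\<close>.\<close>
    define N where "N = 1 / (S + 1)"
    have N: "N > 0" "N * S \<le> 1" using S0 by (auto simp: N_def field_simps)
    have bound: "u v + N * q v \<le> M + N * Q" if v: "v \<in> \<V>" for v
    proof (cases "u v = M")
      case True
      then show ?thesis using qQ[of v] v N(1) by (simp add: \<M>_def)
    next
      case False
      then have pos: "M - u v > 0" using uM[OF v] by simp
      have "\<bar>q v - Q\<bar> / (M - u v) = (if u v = M then 0 else \<bar>q v - Q\<bar> / (M - u v))" using False by simp
      also have "\<dots> \<le> S" unfolding S_def using uM by (intro member_le_sum[OF v _ fin]) auto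
      finally have "\<bar>q v - Q\<bar> \<le> S * (M - u v)" using pos by (simp add: field_simps)
      then have "N * \<bar>q v - Q\<bar> \<le> N * (S * (M - u v))" using N(1) by (intro mult_left_mono) auto
      also have "\<dots> = (N * S) * (M - u v)" by simp
      also have "\<dots> \<le> 1 * (M - u v)" using N(2) pos by (intro mult_right_mono) auto
      finally have "N * \<bar>q v - Q\<bar> \<le> M - u v" by simp
      moreover have "N * (q v - Q) \<le> N * \<bar>q v - Q\<bar>" using N(1) by (intro mult_left_mono) auto
      ultimately show ?thesis by (simp add: algebra_simps)
    qed
    have "u y + N * q y \<le> M + N * Q" by (rule reduce[OF less_imp_le[OF N(1)] bound])
    then have "N * q y \<le> N * Q" using y by simp
    then show False using N(1) n by simp
  qed
  then show ?thesis using umax u0 x0(2) unfolding q_def by (intro exI[of _ x0]) auto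
qed

lemma deck_isometry:
  assumes "p x' = p x"
  shows "\<exists>\<gamma> L. surj \<gamma> \<and> \<gamma> x' = x \<and> (\<forall>u. p (\<gamma> u) = p u) \<and> linear L \<and>
      (\<forall>v. mink (L v) (L v) = mink v v) \<and> (\<forall>u. \<phi> (\<gamma> u) = L (\<phi> u))"
proof -
  obtain \<gamma> where g: "\<gamma> \<in> carrier (pi1 p)" "\<gamma> x' = x" using deck[OF assms] by blast
  then have "surj \<gamma>" and pg: "p \<circ> \<gamma> = p" by (auto simp: pi1_def homeomorphism_def)
  have "p (\<gamma> u) = p u" for u using fun_cong[OF pg, of u] by simp
  then show ?thesis
    using \<open>surj \<gamma>\<close> g(2) equivariant[OF g(1)] rho_matrix(2)[OF g(1)] rho_matrix(3)[OF g(1)]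
    by (intro exI[of _ \<gamma>] exI[of _ "\<rho> \<gamma>"] conjI allI) simp_all
qed

text \<open>Stated for a general field \<open>F\<close> with the properties shared by
  \<open>d\<phi>\<close> and its negative, so that it yields both inequalities. The lexicographic
  maximum is flat, and it is also a corner of all its cells, hence a vertex.\<close>

lemma vertical_velocity_nonpos:
  fixes F :: "'a \<Rightarrow> real^3"
  assumes convex: "convex_surface (range \<phi>)"
    and iso: "\<And>K a b. K \<in> cells \<Longrightarrow> a \<in> K \<Longrightarrow> b \<in> K \<Longrightarrow> mink (F a - F b) (\<phi> a - \<phi> b) = 0"
    and aff: "\<And>K x y m s. K \<in> cells \<Longrightarrow> x \<in> K \<Longrightarrow> y \<in> K \<Longrightarrow> m \<in> K \<Longrightarrow>
      \<phi> m = (1 - s) *\<^sub>R \<phi> x + s *\<^sub>R \<phi> y \<Longrightarrow> F m = (1 - s) *\<^sub>R F x + s *\<^sub>R F y"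
    and inv: "\<And>\<gamma> x. \<gamma> \<in> carrier (pi1 p) \<Longrightarrow> mink (F (\<gamma> x)) (\<phi> (\<gamma> x)) = mink (F x) (\<phi> x)"
    and vertices: "\<And>x. {p x} \<in> D 0 \<Longrightarrow> \<not> flat_at \<phi> x"
  shows "mink (F x) (\<phi> x) \<le> 0"
proof (rule ccontr)
  assume n: "\<not> ?thesis"
  define u where "u x = mink (F x) (\<phi> x)" for x
  have uaff: "u m = (1 - s) * u x + s * u y"
    if "K \<in> cells" "x \<in> K" "y \<in> K" "m \<in> K" "\<phi> m = (1 - s) *\<^sub>R \<phi> x + s *\<^sub>R \<phi> y" for K x y m s
  proof -
    \<comment> \<open>The product of two affine functions is affine along a chord exactly when their
      increments pair to zero, which is the isometry condition.\<close>
    have "(1 - s) * u x + s * u y - u m = s * (1 - s) * mink (F x - F y) (\<phi> x - \<phi> y)"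
      unfolding u_def aff[OF that] that(5) by (simp add: mink_simps) (simp add: algebra_simps)
    then show ?thesis using iso[OF that(1-3)] by simp
  qed
  \<comment> \<open>With the constant function 0 only the tie-break remains, that is, the maximum of
    the square of the position.\<close>
  obtain xm where xm: "\<And>y. mink (\<phi> y) (\<phi> y) \<le> mink (\<phi> xm) (\<phi> xm)"
    using lexicographic_maximum[of "\<lambda>_. 0"] by auto
  obtain B where B: "closed B" "convex B" "interior B \<noteq> {}" "range \<phi> \<subseteq> frontier B"
    using convex unfolding convex_surface_def by blast
  interpret convex_spacelike_complex \<phi> cells B xm by standard (use B xm in auto)
  obtain x0 where x0: "\<And>y. u y \<le> u x0" "\<And>y. u y = u x0 \<Longrightarrow> mink (\<phi> y) (\<phi> y) \<le> mink (\<phi> x0) (\<phi> x0)"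
    using lexicographic_maximum[of u] uaff inv unfolding u_def by blast
  have pos: "u x0 > 0" using n x0(1)[of x] by (simp add: u_def)
  have flat: "flat_at \<phi> x0"
    by (rule flat_at_maximum[of F]) (use iso x0 pos in \<open>auto simp: u_def\<close>)
  have "{p x0} \<in> D 0"
  proof (rule corner_is_vertex)
    fix K a b s assume K: "K \<in> cells" "a \<in> K" "b \<in> K" and s: "0 < s" "s < 1"
      and eq: "\<phi> x0 = (1 - s) *\<^sub>R \<phi> a + s *\<^sub>R \<phi> b"
    obtain m where m: "m \<in> K" "\<phi> m = (1 - s) *\<^sub>R \<phi> a + s *\<^sub>R \<phi> b" using cell_segment[OF K] s by (metis less_imp_le)
    have "\<phi> m = \<phi> x0" unfolding m(2) eq ..
    then have "m = x0" by (rule injD[OF inj_surface])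
    then have xK: "x0 \<in> K" using m(1) by simp
    have u0: "u x0 = (1 - s) * u a + s * u b" by (rule uaff[OF K xK eq])
    then have e: "(1 - s) * (u x0 - u a) + s * (u x0 - u b) = 0" by (simp add: algebra_simps)
    have "(1 - s) * (u x0 - u a) \<ge> 0" "s * (u x0 - u b) \<ge> 0" using x0(1)[of a] x0(1)[of b] s by auto
    then have "(1 - s) * (u x0 - u a) = 0" "s * (u x0 - u b) = 0" using e by linarith+
    then have "u a = u x0" "u b = u x0" using s by auto
    then have qa: "mink (\<phi> a) (\<phi> a) \<le> mink (\<phi> x0) (\<phi> x0)" and qb: "mink (\<phi> b) (\<phi> b) \<le> mink (\<phi> x0) (\<phi> x0)"
      using x0(2) by auto
    \<comment> \<open>Both ends also maximise \<open>u\<close>, so the tie-break bounds their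
      squares by that of \<open>x0\<close>. For distinct ends the strict convexity in this identity
      would violate this bound.\<close>
    have id: "(1 - s) * mink (\<phi> a) (\<phi> a) + s * mink (\<phi> b) (\<phi> b) - mink (\<phi> x0) (\<phi> x0)
      = s * (1 - s) * mink (\<phi> a - \<phi> b) (\<phi> a - \<phi> b)"
      unfolding eq by (simp add: mink_simps mink_commute[of "\<phi> b" "\<phi> a"]) (simp add: algebra_simps)
    have "(1 - s) * mink (\<phi> a) (\<phi> a) \<le> (1 - s) * mink (\<phi> x0) (\<phi> x0)" "s * mink (\<phi> b) (\<phi> b) \<le> s * mink (\<phi> x0) (\<phi> x0)"
      using qa qb s by (auto intro: mult_left_mono)
    then have "(1 - s) * mink (\<phi> a) (\<phi> a) + s * mink (\<phi> b) (\<phi> b) \<le> mink (\<phi> x0) (\<phi> x0)" by (simp add: algebra_simps)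
    then have "(s * (1 - s)) * mink (\<phi> a - \<phi> b) (\<phi> a - \<phi> b) \<le> 0" using id by simp
    moreover have "s * (1 - s) > 0" using s by simp
    ultimately have "\<not> mink (\<phi> a - \<phi> b) (\<phi> a - \<phi> b) > 0" using mult_pos_pos[of "s * (1 - s)"] by fastforce
    then show "a = b" using same_cell_spacelike[OF K] by blast
  qed
  then show False using vertices flat by blast
qed

end

lemma killing_field_linear:
  assumes "linear L" "\<And>v w. mink (L v) w + mink v (L w) = 0"
  shows "killing_field L"
proof -
  have d: "(L has_derivative L) (at x)" for x
    using assms(1) by (simp add: linear_imp_has_derivative)
  then have "frechet_derivative L (at x) = L" for x using frechet_derivative_at by metis
  then show ?thesis unfolding killing_field_def using d assms(2) by (auto simp: differentiable_def)
qed

theorem theorem6p2: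
  fixes A :: "'b::t2_space atlas" and g :: nat
    and p :: "'a::t2_space \<Rightarrow> 'b"
    and \<phi> d\<phi> :: "'a \<Rightarrow> real^3"
    and \<rho> :: "('a \<Rightarrow> 'a) \<Rightarrow> real^3 \<Rightarrow> real^3"
    and d\<rho> :: "('a \<Rightarrow> 'a) \<Rightarrow> real^3^3"
    and \<Phi> :: "real \<Rightarrow> 'a \<Rightarrow> real^3"
    and R :: "real \<Rightarrow> ('a \<Rightarrow> 'a) \<Rightarrow> real^3 \<Rightarrow> real^3"
  assumes "closed_surface_of_genus A g" and "g \<ge> 2"
    and "universal_cover p"
    and "equivariant_embedding p A \<phi> \<rho>" and "fuchsian p \<rho>" and "convex_surface (range \<phi>)"
    and "first_order_deformation p A \<phi> \<rho> \<Phi> R d\<phi> d\<rho>"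
    and "metric_variation_vanishes p \<Phi>"
  shows "trivial_deformation p \<phi> \<rho> d\<phi> d\<rho>"
proof -
  have fod: "fuchsian_deformation p A \<phi> \<rho> \<Phi> R"
    and d\<Phi>: "\<And>x. ((\<lambda>t. \<Phi> t x) has_vector_derivative d\<phi> x) (at 0)"
    and d\<rho>: "\<And>\<gamma>. \<gamma> \<in> carrier (pi1 p) \<Longrightarrow> d\<rho> \<gamma> \<in> tangent_space SO21_0 (matrix (\<rho> \<gamma>))"
    and eqv: "\<And>\<gamma> x. \<gamma> \<in> carrier (pi1 p) \<Longrightarrow> d\<phi> (\<gamma> x) = matrix (\<rho> \<gamma>) *v d\<phi> x + d\<rho> \<gamma> *v \<phi> x"
    using assms(7) unfolding first_order_deformation_def by auto
  obtain \<epsilon> D where \<Phi>0: "\<Phi> 0 = \<phi>" and \<epsilon>: "\<epsilon> > 0" and D: "cell_decomposition A D"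
    and vertices: "\<And>x. {p x} \<in> D 0 \<Longrightarrow> \<not> flat_at \<phi> x"
    and \<Phi>: "\<And>t. \<bar>t\<bar> < \<epsilon> \<Longrightarrow> polyhedral_wrt p D (\<Phi> t) \<and> equivariant_embedding p A (\<Phi> t) (R t)"
    using fod unfolding fuchsian_deformation_def by blast
  have emb: "continuous_on UNIV (\<Phi> t)" "inj (\<Phi> t)" "\<And>H. spacelike_plane H \<Longrightarrow> inj_on (orth_proj H) (range (\<Phi> t))"
    if "\<bar>t\<bar> < \<epsilon>" for t
    using \<Phi>[OF that] unfolding equivariant_embedding_def spacelike_polyhedral_embedding_def by auto
  have emb0: "continuous_on UNIV \<phi>" "inj \<phi>" "\<And>H. spacelike_plane H \<Longrightarrow> inj_on (orth_proj H) (range \<phi>)"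
    using emb[of 0] \<epsilon> \<Phi>0 by auto
  \<comment> \<open>\<open>D\<close> is the decomposition carried by the deformation, which may be
    finer than the faces of \<open>\<phi>\<close>: the cells must stay polygons for all small times
    and their vertices must not be flat.\<close>
  interpret fuchsian_polyhedral_cover p A \<phi> D \<rho>
  proof
    show "smooth_atlas A" "compact (UNIV :: 'b set)" using assms(1) by (auto simp: closed_surface_of_genus_def)
    show "universal_cover p" "fuchsian p \<rho>" "cell_decomposition A D" by fact+
    show "continuous_on UNIV (\<lambda>x. proj2 (axis 1 1) (axis 2 1) (\<phi> x))"
      by (rule bounded_linear.continuous_on[OF bounded_linear_proj2 emb0(1)])
    show "inj (\<lambda>x. proj2 (axis 1 1) (axis 2 1) (\<phi> x))"
      using inj_proj2[OF emb0(3) standard_frame] emb0(2) by (auto simp: inj_on_def)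
    show "polyhedral_wrt p D \<phi>" using \<Phi>[of 0] \<epsilon> \<Phi>0 by auto
    show "\<phi> (\<gamma> x) = \<rho> \<gamma> (\<phi> x)" if "\<gamma> \<in> carrier (pi1 p)" for \<gamma> x
      using assms(4) that unfolding equivariant_embedding_def by blast
  qed (use emb0 in auto)
  have polygon: "\<exists>H. spacelike_plane H \<and> convex (\<Phi> t ` K) \<and> \<Phi> t ` K \<subseteq> H" if t: "\<bar>t\<bar> < \<epsilon>" and K: "K \<in> cells" for t K
  proof -
    obtain C T where T: "C \<in> D 2" "T \<in> components (p -` C)" "K = closure T" using cell_component[OF K] by blast
    show ?thesis
      using cell_polygon[OF conjunct1[OF \<Phi>[OF t]] emb(1)[OF t] T(1,2)] polytope_imp_convex unfolding T(3) by blast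
  qed
  obtain xm where xm: "\<And>y. mink (\<phi> y) (\<phi> y) \<le> mink (\<phi> xm) (\<phi> xm)"
    using lexicographic_maximum[of "\<lambda>_. 0"] by auto
  obtain B where B: "closed B" "convex B" "interior B \<noteq> {}" "range \<phi> \<subseteq> frontier B"
    using assms(6) unfolding convex_surface_def by blast
  interpret C: convex_spacelike_complex \<phi> cells B xm by standard (use B xm in auto)
  have loc: "\<exists>\<delta>>0. \<forall>y\<in>star x. mlen (\<phi> y - \<phi> x) < \<delta> \<longrightarrow> mink (d\<phi> y - d\<phi> x) (\<phi> y - \<phi> x) = 0" for x
  proof -
    obtain U where U: "open U" "x \<in> U" "inj_on p U" using local_inj by blast
    obtain \<delta> where \<delta>: "\<delta> > 0" "\<And>y. y \<in> star x \<Longrightarrow> mlen (\<phi> y - \<phi> x) < \<delta> \<Longrightarrow> induced_dist p \<phi> (p x) (p y) = mlen (\<phi> y - \<phi> x)"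
      using C.induced_dist_eq[OF deck_isometry U] by blast
    have "mink (d\<phi> y - d\<phi> x) (\<phi> y - \<phi> x) = 0" if y: "y \<in> star x" "mlen (\<phi> y - \<phi> x) < \<delta>" for y
    proof (cases "y = x")
      case False
      obtain K where K: "K \<in> cells" "x \<in> K" "y \<in> K" using y(1) by (auto simp: star_def)
      have "mink (d\<phi> y - d\<phi> x) (\<Phi> 0 y - \<Phi> 0 x) = 0"
      proof (rule isometric_if_metric_variation_vanishes[where \<Phi> = \<Phi> and x = x and y = y and p = p, OF \<epsilon>])
        fix t :: real assume t: "\<bar>t\<bar> < \<epsilon>"
        show "mink (\<Phi> t u - \<Phi> t v) (\<Phi> t u - \<Phi> t v) \<ge> 0" for u v
          by (rule not_timelike_diff[OF emb(3)[OF t]]) auto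
        have "closed_segment (\<Phi> t x) (\<Phi> t y) \<subseteq> \<Phi> t ` K"
          using polygon[OF t K(1)] K by (intro closed_segment_subset) auto
        then show "closed_segment (\<Phi> t x) (\<Phi> t y) \<subseteq> range (\<Phi> t)" by blast
      next
        show "((\<lambda>t. induced_dist p (\<Phi> t) (p x) (p y)) has_real_derivative 0) (at 0)"
          using assms(8) unfolding metric_variation_vanishes_def by blast
        show "induced_dist p (\<Phi> 0) (p x) (p y) = mlen (\<Phi> 0 y - \<Phi> 0 x)" unfolding \<Phi>0 by (rule \<delta>(2)[OF y])
        show "mink (\<Phi> 0 y - \<Phi> 0 x) (\<Phi> 0 y - \<Phi> 0 x) > 0" unfolding \<Phi>0 by (rule same_cell_spacelike[OF K(1,3,2) False])
      qed (rule d\<Phi>)+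
      then show ?thesis by (simp add: \<Phi>0)
    qed (simp add: mink_simps)
    then show ?thesis using \<delta>(1) by blast
  qed
  have iso: "mink (d\<phi> a - d\<phi> b) (\<phi> a - \<phi> b) = 0" if "K \<in> cells" "a \<in> K" "b \<in> K" for K a b
    by (rule cell_isometric[OF loc that])
  have aff: "d\<phi> m = (1 - s) *\<^sub>R d\<phi> x + s *\<^sub>R d\<phi> y"
    if K: "K \<in> cells" "x \<in> K" "y \<in> K" "m \<in> K" "\<phi> m = (1 - s) *\<^sub>R \<phi> x + s *\<^sub>R \<phi> y" for K x y m s
  proof (rule cell_affine[OF iso _ K])
    fix x y z m assume S: "{x, y, z, m} \<subseteq> K"
    have "(d\<phi> y - d\<phi> x) \<bullet> cross3 (\<Phi> 0 z - \<Phi> 0 x) (\<Phi> 0 m - \<Phi> 0 x) +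
      (\<Phi> 0 y - \<Phi> 0 x) \<bullet> (cross3 (d\<phi> z - d\<phi> x) (\<Phi> 0 m - \<Phi> 0 x) + cross3 (\<Phi> 0 z - \<Phi> 0 x) (d\<phi> m - d\<phi> x)) = 0"
    proof (rule coplanar_deformation[where \<Phi> = \<Phi> and F = d\<phi> and x = x and y = y and z = z and m = m, OF \<epsilon> _ d\<Phi>])
      fix t :: real assume "\<bar>t\<bar> < \<epsilon>"
      then obtain H where "spacelike_plane H" "\<Phi> t ` K \<subseteq> H" using polygon K(1) by blast
      then show "\<exists>H. affine H \<and> aff_dim H = 2 \<and> {\<Phi> t x, \<Phi> t y, \<Phi> t z, \<Phi> t m} \<subseteq> H"
        using S unfolding spacelike_plane_def by blast
    qed
    then show "(d\<phi> y - d\<phi> x) \<bullet> cross3 (\<phi> z - \<phi> x) (\<phi> m - \<phi> x) +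
      (\<phi> y - \<phi> x) \<bullet> (cross3 (d\<phi> z - d\<phi> x) (\<phi> m - \<phi> x) + cross3 (\<phi> z - \<phi> x) (d\<phi> m - d\<phi> x)) = 0"
      by (simp add: \<Phi>0)
  qed (use K(1) in auto)
  have inv: "mink (d\<phi> (\<gamma> x)) (\<phi> (\<gamma> x)) = mink (d\<phi> x) (\<phi> x)" if g: "\<gamma> \<in> carrier (pi1 p)" for \<gamma> x
  proof -
    \<comment> \<open>Only the infinitesimal part of the equivariance formula could break
      invariance, and tangent vectors to the group contribute nothing to the product with the
      transported point.\<close>
    have "mink (d\<phi> (\<gamma> x)) (\<phi> (\<gamma> x)) = mink (\<rho> \<gamma> (d\<phi> x)) (\<rho> \<gamma> (\<phi> x)) + mink (d\<rho> \<gamma> *v \<phi> x) (matrix (\<rho> \<gamma>) *v \<phi> x)"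
      using rho_matrix(1)[OF g] by (simp add: eqv[OF g] equivariant[OF g] mink_simps)
    then show ?thesis using tangent_SO21_0_skew[OF d\<rho>[OF g]] rho_matrix(3)[OF g] by simp
  qed
  have "mink (d\<phi> x) (\<phi> x) \<le> 0" for x
  proof (rule vertical_velocity_nonpos[OF assms(6) _ _ _ vertices])
    show "mink (d\<phi> a - d\<phi> b) (\<phi> a - \<phi> b) = 0" if "K \<in> cells" "a \<in> K" "b \<in> K" for K a b
      by (rule iso[OF that])
    show "d\<phi> m = (1 - s) *\<^sub>R d\<phi> x + s *\<^sub>R d\<phi> y"
      if "K \<in> cells" "x \<in> K" "y \<in> K" "m \<in> K" "\<phi> m = (1 - s) *\<^sub>R \<phi> x + s *\<^sub>R \<phi> y" for K x y m s
      by (rule aff[OF that])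
    show "mink (d\<phi> (\<gamma> x)) (\<phi> (\<gamma> x)) = mink (d\<phi> x) (\<phi> x)" if "\<gamma> \<in> carrier (pi1 p)" for \<gamma> x
      by (rule inv[OF that])
  qed
  moreover have "mink (- d\<phi> x) (\<phi> x) \<le> 0" for x
  proof (rule vertical_velocity_nonpos[OF assms(6) _ _ _ vertices])
    show "mink (- d\<phi> a - - d\<phi> b) (\<phi> a - \<phi> b) = 0" if "K \<in> cells" "a \<in> K" "b \<in> K" for K a b
      using iso[OF that] by (simp add: mink_simps)
    show "- d\<phi> m = (1 - s) *\<^sub>R - d\<phi> x + s *\<^sub>R - d\<phi> y"
      if "K \<in> cells" "x \<in> K" "y \<in> K" "m \<in> K" "\<phi> m = (1 - s) *\<^sub>R \<phi> x + s *\<^sub>R \<phi> y" for K x y m s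
      using aff[OF that] by simp
    show "mink (- d\<phi> (\<gamma> x)) (\<phi> (\<gamma> x)) = mink (- d\<phi> x) (\<phi> x)" if "\<gamma> \<in> carrier (pi1 p)" for \<gamma> x
      using inv[OF that] by (simp add: mink_simps)
  qed
  ultimately have zero: "mink (d\<phi> x) (\<phi> x) = 0" for x by (simp add: mink_simps order_antisym)
  have "\<exists>L. linear L \<and> (\<forall>v w. mink (L v) w + mink v (L w) = 0) \<and> (\<forall>x. d\<phi> x = L (\<phi> x))"
    by (rule global_rotation[OF _ zero C.timelike]) (rule iso)
  then obtain L where L: "linear L" "\<And>v w. mink (L v) w + mink v (L w) = 0" "\<And>x. d\<phi> x = L (\<phi> x)"
    by blast
  have "d\<rho> \<gamma> *v v - (L (\<rho> \<gamma> v) - \<rho> \<gamma> (L v)) = 0" if g: "\<gamma> \<in> carrier (pi1 p)" for \<gamma> v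
  proof -
    \<comment> \<open>The defect in the formula for \<open>d\<rho>\<close>: it is linear and
      vanishes on the surface by the equivariance of \<open>d\<phi>\<close>, and the surface spans
      the space.\<close>
    define Z where "Z v = d\<rho> \<gamma> *v v - (L (\<rho> \<gamma> v) - \<rho> \<gamma> (L v))" for v
    have lin: "linear Z"
      unfolding Z_def using L(1) rho_matrix(2)[OF g]
      by (intro linear_compose_sub matrix_vector_mul_linear) (auto intro: linear_compose[unfolded o_def])
    have Z0: "Z (\<phi> x) = 0" for x
      using eqv[OF g, of x] rho_matrix(1)[OF g, of "d\<phi> x"] equivariant[OF g, of x] L(3)[of "\<gamma> x"] L(3)[of x]
      by (simp add: Z_def)
    have "v \<in> span (range \<phi>)" using span_surface[OF C.timelike] by simp
    then have "Z v = 0"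
      by (induction rule: span_induct_alt) (use Z0 linear_0[OF lin] linear_add[OF lin] linear_cmul[OF lin] in auto)
    then show ?thesis by (simp add: Z_def)
  qed
  then show ?thesis
    unfolding trivial_deformation_def
    using killing_field_linear[OF L(1,2)] linear_0[OF L(1)] L(3) by (intro exI[of _ L]) simp
qed

end
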